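(* Let $l\ge 1$, $k\ge 1$ and $n>4$ be integers, let $p_1,p_2$ be entire functions, not identically zero, of order less than $k$, let $a,a_1,a_2$ be nonzero complex constants with $a_1\neq a_2$, and let $c\in\mathbb{C}$ be a constant. Then the equation $$f^n(z)+a\bigl(f^{(l)}(z+c)\bigr)^n=p_1(z)e^{a_1z^k}+p_2(z)e^{a_2z^k}$$ has no meromorphic solution $f$ in $\mathbb{C}$ such that $\rho_2(f)<1$ and $N(r,f)=S(r,f)$.
   Context: Standard notation of Nevanlinna theory is used: for a meromorphic function $f$ in $\mathbb{C}$, $T(r,f)$ is the Nevanlinna characteristic and $N(r,f)$ is the integrated counting function of poles (with multiplicity). $S(r,f)$ denotes any quantity satisfying $S(r,f)=o(T(r,f))$ as $r\to\infty$, outside of a possible exceptional set of finite linear measure. The order of $f$ is $\rho(f)=\limsup_{r\to\infty}\frac{\log^+T(r,f)}{\log r}$ and the hyper-order of $f$ is $\rho_2(f)=\limsup_{r\to\infty}\frac{\log^+\log^+T(r,f)}{\log r}$. $f^n$ denotes the $n$-th power and $f^{(l)}$ the $l$-th derivative of $f$; $f^{(l)}(z+c)$ is $f^{(l)}$ evaluated at $z+c$. *)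

theory Defs
  imports
    "HOL-Complex_Analysis.Complex_Analysis"
    "HOL-Library.Landau_Symbols"
begin

definition log_plus :: "real \<Rightarrow> real" where
  "log_plus x = ln (max 1 x)"

definition proximity :: "real \<Rightarrow> (complex \<Rightarrow> complex) \<Rightarrow> real" where
  "proximity r f = (LBINT t:{0..2*pi}. log_plus (cmod (f (rcis r t)))) / (2 * pi)"

(* At a pole, zorder is minus the multiplicity. A meromorphic function has finitely many poles
   in each closed disc, so the sum is a genuine one. *)
definition pole_count :: "real \<Rightarrow> (complex \<Rightarrow> complex) \<Rightarrow> real" where
  "pole_count t f = (\<Sum>z | cmod z \<le> t \<and> is_pole f z. real_of_int (- zorder f z))"

definition pole_counting :: "real \<Rightarrow> (complex \<Rightarrow> complex) \<Rightarrow> real" where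
  "pole_counting r f =
     (LBINT t:{0<..r}. (pole_count t f - pole_count 0 f) / t) + pole_count 0 f * ln r"

definition nevanlinna_char :: "real \<Rightarrow> (complex \<Rightarrow> complex) \<Rightarrow> real" where
  "nevanlinna_char r f = proximity r f + pole_counting r f"

definition growth_order :: "(complex \<Rightarrow> complex) \<Rightarrow> ereal" where
  "growth_order f =
     Limsup at_top (\<lambda>r. ereal (log_plus (nevanlinna_char r f) / ln r))"

definition hyper_order :: "(complex \<Rightarrow> complex) \<Rightarrow> ereal" where
  "hyper_order f =
     Limsup at_top (\<lambda>r. ereal (log_plus (log_plus (nevanlinna_char r f)) / ln r))"

(* h(r) = S(r,f). The elements of lmeasurable are the Lebesgue measurable sets of finite measure;
   the filter describes r tending to infinity outside E. *)
definition is_S :: "(real \<Rightarrow> real) \<Rightarrow> (complex \<Rightarrow> complex) \<Rightarrow> bool" where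
  "is_S h f \<longleftrightarrow>
     (\<exists>E \<in> lmeasurable. h \<in> o[inf at_top (principal (- E))](\<lambda>r. nevanlinna_char r f))"

end

(*
Write F0 = f^n, F1 = a g^n with g(z) = f^(l)(z+c), and F2, F3 for the two exponential terms, so that
F0 + F1 = F2 + F3. Cartan's argument is run directly on circle means: if the Wronskian W of F0, F1, F2
does not vanish identically, then max ln|F_j| is at most ln|F0 F1 F2 F3 / W| up to logarithmic
derivatives of the F_j. As W vanishes to order at least n - 2 at the zeros of f and g, Jensen's formula
bounds the mean J of the maximum by (4/n) J + O(N(r,f)) + o(r^k). Together with N(r,f) = S(r,f) this
gives J = o(r^k), whereas the two exponentials alone force J to be at least a multiple of r^k.

If W vanishes identically, f^n and g^n are linear combinations of F2 and F3. The three-term version of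
the argument leaves only f^n = F2, a g^n = F3 and the swapped case; there Cauchy's estimates for g in
terms of f contradict a1 /= a2.

In the main case the poles and the growth of g are controlled by the equation itself. The hypothesis on
the hyper-order enters through log T(2r,f) = o(r), which makes the logarithmic derivative estimate valid
on every large circle avoiding zeros and poles, so that no growth lemma is needed.
*)
theory Submission
  imports Defs "HOL-Real_Asymp.Real_Asymp"
begin

section \<open>Circle means\<close>

text \<open>The constant 4/n arises as follows. The Wronskian involves second derivatives and keeps
  n - 2 of the n orders of a zero, so subtracting the mean of ln|W| from that of ln|F0 F1| leaves
  twice the means of ln|f| and ln|g|. Each of these is at most J/n up to a constant, as ln|F0| and
  ln|F1| lie below the maximum. Smallness of N(r,f) against T(r,f) becomes smallness against J +
  r^k, because T(r,f) is itself bounded by a multiple of J + r^k plus N(r,f). The technical obstacle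
  is zeros and poles on the circle of integration. They are avoided rather than treated: means are
  taken on circles where the integrand is continuous. This excludes a null set of radii, whereas
  S(r,f) excludes a set of finite measure; together they leave radii for the final contradiction,
  and one is enough. Estimates that need further, larger circles take them from intervals of radii,
  each of which contains an admissible one.\<close>

definition cmean :: "real \<Rightarrow> (complex \<Rightarrow> real) \<Rightarrow> real" where
  "cmean r u = integral {0..2*pi} (\<lambda>t. u (rcis r t)) / (2*pi)"

lemma continuous_on_rcis_comp:
  assumes "continuous_on (sphere 0 r) u" "r \<ge> 0"
  shows   "continuous_on S (\<lambda>t. u (rcis r t))"
proof -
  have "continuous_on S (rcis r)"
    unfolding rcis_def by (intro continuous_intros)
  thus ?thesis
    by (rule continuous_on_compose2[OF assms(1)]) (use assms(2) in auto)
qed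

lemma rcis_integrable:
  fixes u :: "complex \<Rightarrow> 'a::banach"
  assumes "continuous_on (sphere 0 r) u" "r \<ge> 0"
  shows   "(\<lambda>t. u (rcis r t)) integrable_on {a..b}"
  by (intro integrable_continuous_interval continuous_on_rcis_comp assms)

lemma cmean_cong:
  assumes "\<And>z. cmod z = r \<Longrightarrow> u z = v z" "r \<ge> 0"
  shows   "cmean r u = cmean r v"
  unfolding cmean_def using assms by (simp cong: integral_cong)

lemma cmean_const [simp]: "cmean r (\<lambda>_. c) = c"
  by (simp add: cmean_def)

lemma cmean_mono:
  assumes "continuous_on (sphere 0 r) u" "continuous_on (sphere 0 r) v" "r \<ge> 0"
  assumes "\<And>z. cmod z = r \<Longrightarrow> u z \<le> v z"
  shows   "cmean r u \<le> cmean r v"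
  unfolding cmean_def
  by (intro divide_right_mono integral_le rcis_integrable assms) (use assms in auto)

lemma cmean_nonneg:
  assumes "continuous_on (sphere 0 r) u" "r \<ge> 0" "\<And>z. cmod z = r \<Longrightarrow> u z \<ge> 0"
  shows   "cmean r u \<ge> 0"
  using cmean_mono[of r "\<lambda>_. 0" u] assms by simp

lemma cmean_add:
  assumes "continuous_on (sphere 0 r) u" "continuous_on (sphere 0 r) v" "r \<ge> 0"
  shows   "cmean r (\<lambda>z. u z + v z) = cmean r u + cmean r v"
  unfolding cmean_def
  by (subst integral_add) (auto intro!: rcis_integrable assms simp: add_divide_distrib)

lemma cmean_cmul: "cmean r (\<lambda>z. c * u z) = c * cmean r u"
  unfolding cmean_def by simp

lemma cmean_uminus: "cmean r (\<lambda>z. - u z) = - cmean r u"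
  using cmean_cmul[of r "-1" u] by simp

lemma cmean_diff:
  assumes "continuous_on (sphere 0 r) u" "continuous_on (sphere 0 r) v" "r \<ge> 0"
  shows   "cmean r (\<lambda>z. u z - v z) = cmean r u - cmean r v"
  using cmean_add[of r u "\<lambda>z. - v z"] assms by (simp add: cmean_uminus continuous_on_minus)

lemma cmean_sum:
  assumes "\<And>i. i \<in> I \<Longrightarrow> continuous_on (sphere 0 r) (u i)" "r \<ge> 0"
  shows   "cmean r (\<lambda>z. \<Sum>i\<in>I. u i z) = (\<Sum>i\<in>I. cmean r (u i))"
  using assms(1)
proof (induction I rule: infinite_finite_induct)
  case (insert x F)
  then show ?case
    by (simp add: cmean_add continuous_on_sum assms(2))
qed auto

section \<open>Fourier coefficients on circles and bounds by the mean of the real part\<close>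

lemma has_integral_circle_iff:
  assumes "R > 0"
  shows "(f has_contour_integral I) (circlepath 0 R) \<longleftrightarrow>
           ((\<lambda>t. f (rcis R t) * (\<i> * rcis R t)) has_integral I) {0..2*pi}"
  unfolding circlepath_def
  by (subst has_contour_integral_part_circlepath_iff) (auto simp: rcis_def mult_ac)

text \<open>Cauchy's formula for the n-th derivative, read as the n-th Fourier coefficient of G on
  the circle. The factor \<open>R ^ n / \<i>\<close> cancels what the parametrization leaves
  over.\<close>

lemma holomorphic_circle_coeff:
  fixes G :: "complex \<Rightarrow> complex"
  assumes "G holomorphic_on ball 0 R'" "0 < R" "R < R'"
  shows "((\<lambda>t. G (rcis R t) * cis (- (real n * t))) has_integral
            of_real (2 * pi) * (deriv ^^ n) G 0 / fact n * of_real (R ^ n)) {0..2*pi}"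
proof -
  have sub: "cball 0 R \<subseteq> (ball 0 R' :: complex set)" using assms by auto
  have "((\<lambda>u. G u / (u - 0) ^ Suc n) has_contour_integral
          (2 * pi * \<i> / fact n * (deriv ^^ n) G 0)) (circlepath 0 R)"
    by (intro Cauchy_has_contour_integral_higher_derivative_circlepath)
       (use assms sub in \<open>auto intro: holomorphic_on_subset holomorphic_on_imp_continuous_on\<close>)
  hence "((\<lambda>t. G (rcis R t) / rcis R t ^ Suc n * (\<i> * rcis R t)) has_integral
          (2 * pi * \<i> / fact n * (deriv ^^ n) G 0)) {0..2*pi}"
    using assms(2) by (subst (asm) has_integral_circle_iff) auto
  hence "((\<lambda>t. G (rcis R t) / rcis R t ^ Suc n * (\<i> * rcis R t) * (R ^ n / \<i>)) has_integral
          (2 * pi * \<i> / fact n * (deriv ^^ n) G 0) * (R ^ n / \<i>)) {0..2*pi}"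
    by (rule has_integral_mult_left)
  also have "(\<lambda>t. G (rcis R t) / rcis R t ^ Suc n * (\<i> * rcis R t) * (R ^ n / \<i>)) =
             (\<lambda>t. G (rcis R t) * cis (- (real n * t)))"
  proof
    fix t
    have [simp]: "rcis R t \<noteq> 0" using assms by (simp add: rcis_def)
    have "cis (-(real n * t)) = inverse (cis t ^ n)"
      by (simp add: Complex.DeMoivre)
    hence *: "rcis R t ^ n * cis (-(real n * t)) = R ^ n"
      by (simp add: rcis_def power_mult_distrib)
    have "G (rcis R t) / rcis R t ^ Suc n * (\<i> * rcis R t) * (R ^ n / \<i>) =
          G (rcis R t) * (R ^ n / rcis R t ^ n)"
      using assms(2) by (simp add: field_simps)
    also have "R ^ n / rcis R t ^ n = cis (-(real n * t))"
      using assms(2) unfolding * [symmetric] by simp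
    finally show "G (rcis R t) / rcis R t ^ Suc n * (\<i> * rcis R t) * (R ^ n / \<i>) =
             G (rcis R t) * cis (- (real n * t))" by simp
  qed
  finally show ?thesis by (simp add: mult_ac)
qed

lemma cmean_Re_holomorphic:
  assumes "G holomorphic_on ball 0 R'" "0 < R" "R < R'"
  shows "cmean R (\<lambda>z. Re (G z)) = Re (G 0)"
proof -
  have "((\<lambda>t. G (rcis R t)) has_integral 2 * pi * G 0) {0..2*pi}"
    using holomorphic_circle_coeff[OF assms, of 0] by simp
  from has_integral_Re[OF this] show ?thesis
    by (simp add: cmean_def integral_unique)
qed

text \<open>Cauchy's theorem for \<open>G u * u ^ (n - 1)\<close>: a holomorphic function has no
  Fourier coefficients of negative index.\<close>

lemma holomorphic_circle_coeff_neg: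
  assumes "G holomorphic_on ball 0 R'" "0 < R" "R < R'" "n > 0"
  shows "((\<lambda>t. G (rcis R t) * cis (real n * t)) has_integral 0) {0..2*pi}"
proof -
  have "((\<lambda>u. G u * u ^ (n - 1)) has_contour_integral 0) (circlepath 0 R)"
    by (rule Cauchy_theorem_convex_simple[where S = "ball 0 R'"])
       (use assms in \<open>auto intro!: holomorphic_intros\<close>)
  hence "((\<lambda>t. G (rcis R t) * rcis R t ^ (n-1) * (\<i> * rcis R t)) has_integral 0) {0..2*pi}"
    using assms(2) by (subst (asm) has_integral_circle_iff) auto
  hence "((\<lambda>t. G (rcis R t) * rcis R t ^ (n-1) * (\<i> * rcis R t) * (1 / (\<i> * R ^ n))) has_integral
          0 * (1 / (\<i> * R ^ n))) {0..2*pi}"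
    by (rule has_integral_mult_left)
  also have "(\<lambda>t. G (rcis R t) * rcis R t ^ (n-1) * (\<i> * rcis R t) * (1 / (\<i> * R ^ n))) =
             (\<lambda>t. G (rcis R t) * cis (real n * t))"
  proof
    fix t
    have *: "rcis R t ^ n = R ^ n * cis (real n * t)"
      by (simp add: rcis_def power_mult_distrib Complex.DeMoivre)
    have "rcis R t ^ (n-1) * rcis R t = rcis R t ^ n"
      using \<open>n > 0\<close> by (metis power_minus_mult)
    thus "G (rcis R t) * rcis R t ^ (n-1) * (\<i> * rcis R t) * (1 / (\<i> * R ^ n)) =
             G (rcis R t) * cis (real n * t)"
      using assms(2) by (simp add: * [symmetric]) (simp add: * field_simps)
  qed
  finally show ?thesis by simp
qed

text \<open>Adding the vanishing Fourier coefficient of the conjugate shows that the Taylor coefficients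
  depend on the real part only.\<close>
lemma holomorphic_coeff_bound:
  assumes "G holomorphic_on ball 0 R'" "0 < R" "R < R'" "n > 0"
  shows "cmod ((deriv ^^ n) G 0 / fact n) * R ^ n \<le> 2 * cmean R (\<lambda>z. \<bar>Re (G z)\<bar>)"
proof -
  let ?I = "of_real (2 * pi) * (deriv ^^ n) G 0 / fact n * of_real (R ^ n)"
  have cont: "continuous_on (sphere 0 R) G"
    by (rule holomorphic_on_imp_continuous_on, rule holomorphic_on_subset[OF assms(1)])
       (use assms in auto)
  have 1: "((\<lambda>t. G (rcis R t) * cis (- (real n * t))) has_integral ?I) {0..2*pi}"
    by (rule holomorphic_circle_coeff) (use assms in auto)
  have 2: "((\<lambda>t. cnj (G (rcis R t)) * cis (- (real n * t))) has_integral 0) {0..2*pi}"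
    using holomorphic_circle_coeff_neg[OF assms]
    by (subst has_integral_cnj[symmetric]) (simp add: o_def cis_cnj)
  have "((\<lambda>t. (2 * Re (G (rcis R t))) * cis (- (real n * t))) has_integral ?I) {0..2*pi}"
    using has_integral_add[OF 1 2]
    by (simp add: ring_distribs(2)[symmetric] complex_add_cnj)
  hence eq: "?I = integral {0..2*pi} (\<lambda>t. (2 * Re (G (rcis R t))) * cis (- (real n * t)))"
    by (simp add: integral_unique)
  have "norm ?I \<le> integral {0..2*pi} (\<lambda>t. 2 * \<bar>Re (G (rcis R t))\<bar>)"
    unfolding eq
  proof (rule integral_norm_bound_integral)
    have "continuous_on {0..2*pi} (\<lambda>t. G (rcis R t))"
      by (rule continuous_on_rcis_comp[OF cont]) (use assms in auto)
    thus "(\<lambda>t. (2 * Re (G (rcis R t))) * cis (- (real n * t))) integrable_on {0..2*pi}"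
         "(\<lambda>t. 2 * \<bar>Re (G (rcis R t))\<bar>) integrable_on {0..2*pi}"
      by (auto intro!: integrable_continuous_interval continuous_intros)
  qed (auto simp: norm_mult)
  also have "\<dots> = 2 * (2 * pi * cmean R (\<lambda>z. \<bar>Re (G z)\<bar>))"
    by (simp add: cmean_def)
  finally show ?thesis using assms
    by (simp add: norm_mult norm_divide norm_power field_simps)
qed

text \<open>A Borel-Caratheodory inequality with the mean of |Re G| in place of the maximum of Re G.
  The Taylor coefficients are at most 2M/R^n, and 2M (3/4)^n summed over n >= 1 gives 6M.\<close>

lemma holomorphic_bound_by_Re_mean:
  assumes "G holomorphic_on ball 0 R'" "0 < R" "R < R'" "cmod z \<le> 3/4 * R"
  shows "cmod (G z - G 0) \<le> 6 * cmean R (\<lambda>z. \<bar>Re (G z)\<bar>)"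
proof -
  define M where "M = cmean R (\<lambda>z. \<bar>Re (G z)\<bar>)"
  define c where "c n = (deriv ^^ n) G 0 / fact n" for n
  have bd: "cmod (c n) * R ^ n \<le> 2 * M" if "n > 0" for n
    using holomorphic_coeff_bound[OF assms(1-3) that] by (simp add: c_def M_def)
  have sums: "(\<lambda>n. c n * z ^ n) sums G z"
    using holomorphic_power_series[OF assms(1), of z] assms(2-4) by (simp add: c_def)
  hence "(\<lambda>n. c (Suc n) * z ^ Suc n) sums (G z - c 0 * z ^ 0)"
    by (subst sums_Suc_iff) simp
  hence sums': "(\<lambda>n. c (Suc n) * z ^ Suc n) sums (G z - G 0)"
    by (simp add: c_def)
  have le: "norm (c (Suc n) * z ^ Suc n) \<le> (3/2 * M) * (3/4) ^ n" for n
  proof -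
    have "norm (c (Suc n) * z ^ Suc n) = cmod (c (Suc n)) * cmod z ^ Suc n"
      by (simp only: norm_mult norm_power)
    also have "\<dots> \<le> cmod (c (Suc n)) * (3/4 * R) ^ Suc n"
      by (intro mult_left_mono power_mono assms) auto
    also have "\<dots> = (cmod (c (Suc n)) * R ^ Suc n) * (3/4) ^ Suc n"
      by (simp only: power_mult_distrib mult_ac)
    also have "\<dots> \<le> (2 * M) * (3/4) ^ Suc n"
      by (intro mult_right_mono bd) auto
    finally show ?thesis by simp
  qed
  have geo: "(\<lambda>n. (3/2 * M) * (3/4) ^ n) sums ((3/2 * M) * (1 / (1 - 3/4)))"
    by (intro sums_mult geometric_sums) auto
  have "norm (\<Sum>n. c (Suc n) * z ^ Suc n) \<le> (\<Sum>n. (3/2 * M) * (3/4) ^ n)"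
    by (rule norm_suminf_le[OF le sums_summable[OF geo]])
  thus ?thesis
    using sums_unique[OF sums'] sums_unique[OF geo] by (simp add: M_def)
qed

text \<open>Cauchy's estimate on the disc of radius R/4 about z, which stays within radius 3R/4.
  Subtracting \<open>G 0\<close> does not affect derivatives of positive order.\<close>

lemma holomorphic_deriv_bound_by_Re_mean:
  assumes "G holomorphic_on ball 0 R'" "0 < R" "R < R'" "cmod z \<le> R / 2"
  shows "cmod ((deriv ^^ Suc n) G z) \<le> fact (Suc n) * (6 * cmean R (\<lambda>z. \<bar>Re (G z)\<bar>)) / (R/4) ^ Suc n"
proof -
  let ?H = "\<lambda>w. G w - G 0"
  have sub: "cball z (R/4) \<subseteq> ball 0 R'"
  proof
    fix x assume "x \<in> cball z (R/4)"
    hence "cmod (x - z) \<le> R/4" by (simp add: dist_norm norm_minus_commute)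
    thus "x \<in> ball 0 R'" using assms norm_triangle_sub[of x z] by simp
  qed
  have hol: "?H holomorphic_on cball z (R/4)"
    by (intro holomorphic_intros holomorphic_on_subset[OF assms(1)] sub)
  have "cmod ((deriv ^^ Suc n) ?H z) \<le> fact (Suc n) * (6 * cmean R (\<lambda>z. \<bar>Re (G z)\<bar>)) / (R/4) ^ Suc n"
  proof (rule Cauchy_inequality)
    fix x assume "cmod (z - x) = R / 4"
    hence "cmod x \<le> 3/4 * R"
      using assms(4) norm_triangle_sub[of x z] by (simp add: norm_minus_commute)
    thus "cmod (?H x) \<le> 6 * cmean R (\<lambda>z. \<bar>Re (G z)\<bar>)"
      by (intro holomorphic_bound_by_Re_mean[OF assms(1-3)])
  qed (use hol assms in \<open>auto intro: holomorphic_on_imp_continuous_on holomorphic_on_subset\<close>)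
  moreover have "z \<in> ball 0 R'" using assms by auto
  hence "(deriv ^^ Suc n) ?H z = (deriv ^^ Suc n) G z"
    using higher_deriv_diff[OF assms(1) holomorphic_on_const open_ball, of z "Suc n" "G 0"]
    by (simp del: funpow.simps add: higher_deriv_const)
  ultimately show ?thesis by simp
qed

text \<open>Reflection in the circle: where |z| = r, the distance |z - a| equals r |1 - q z| because
  z times its conjugate is r^2. The factor 1 - q z has no zero in the closed disc, so its logarithm
  is holomorphic there and the mean value property gives 0 for it.\<close>

lemma cmean_ln_dist:
  assumes "cmod a < r"
  shows   "cmean r (\<lambda>z. ln (cmod (z - a))) = ln r"
proof -
  have r: "r > 0" using assms norm_ge_zero[of a] by linarith
  \<comment> \<open>The modulus of the mirror image of a, which is the zero of
    \<open>1 - q * z\<close>. For a = 0 there is no such point and any radius beyond r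
    serves.\<close>
  define R' where "R' = (if a = 0 then r + 1 else r ^ 2 / cmod a)"
  have R': "r < R'"
    using assms r by (auto simp: R'_def field_simps power2_eq_square)
  define q where "q = cnj a / of_real (r ^ 2)"
  have *: "cmod (q * z) < 1" if "cmod z < R'" for z :: complex
  proof (cases "a = 0")
    case False
    thus ?thesis using that r by (auto simp: q_def norm_mult norm_divide R'_def field_simps norm_power)
  qed (auto simp: q_def)
  have "(\<lambda>z. Ln (1 - q * z)) holomorphic_on ball 0 R'"
  proof (intro holomorphic_intros)
    fix z :: complex assume "z \<in> ball 0 R'"
    hence "cmod (q * z) < 1" using * by auto
    hence "Re (1 - q * z) > 0" using abs_Re_le_cmod[of "q * z"] by simp
    thus "1 - q * z \<notin> \<real>\<^sub>\<le>\<^sub>0" by (auto simp: complex_nonpos_Reals_iff)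
  qed
  from cmean_Re_holomorphic[OF this r R'] have 0: "cmean r (\<lambda>z. Re (Ln (1 - q * z))) = 0"
    by simp
  have "cmean r (\<lambda>z. ln (cmod (z - a))) = cmean r (\<lambda>z. ln r + Re (Ln (1 - q * z)))"
  proof (rule cmean_cong)
    fix z assume z: "cmod z = r"
    have nz: "1 - q * z \<noteq> 0" using *[of z] z R' by auto
    have zz: "z * cnj z = of_real (r ^ 2)" using z by (simp add: complex_norm_square [symmetric])
    have "cmod (z - a) = cmod (cnj (z - a))" by (simp only: complex_mod_cnj)
    also have "\<dots> = cmod (cnj z * (1 - q * z))"
    proof -
      have "cnj z * (1 - q * z) = cnj z - cnj a * (z * cnj z) / of_real (r ^ 2)"
        by (simp add: q_def algebra_simps)
      also have "\<dots> = cnj (z - a)"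
        unfolding zz using r by simp
      finally show ?thesis by simp
    qed
    also have "\<dots> = r * cmod (1 - q * z)"
      by (simp add: norm_mult z)
    finally show "ln (cmod (z - a)) = ln r + Re (Ln (1 - q * z))"
      using r nz by (simp add: ln_mult)
  qed (use r in auto)
  also have "\<dots> = ln r + cmean r (\<lambda>z. Re (Ln (1 - q * z)))"
  proof (subst cmean_add)
    have "continuous_on (sphere 0 r) (\<lambda>z. Ln (1 - q * z))"
      by (rule holomorphic_on_imp_continuous_on,
          rule holomorphic_on_subset[OF \<open>(\<lambda>z. Ln (1 - q * z)) holomorphic_on ball 0 R'\<close>])
         (use R' in auto)
    thus "continuous_on (sphere 0 r) (\<lambda>z. Re (Ln (1 - q * z)))" by (rule continuous_on_Re)
  qed (use r in auto)
  finally show ?thesis using 0 by simp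
qed

section \<open>Meromorphic functions on generic circles\<close>

text \<open>Countable sets of radii are null, so along this filter a circle may be assumed to avoid all
  zeros and poles of a given meromorphic function.\<close>
definition ae_at_top :: "real filter" where
  "ae_at_top = inf at_top (ae_filter lborel)"

lemma eventually_ae_at_top:
  "eventually P ae_at_top \<longleftrightarrow> (\<exists>r0. AE r in lborel. r \<ge> r0 \<longrightarrow> P r)"
proof
  assume "eventually P ae_at_top"
  then obtain Q R where Q: "eventually Q at_top" and R: "AE r in lborel. R r"
    and imp: "\<And>r. Q r \<Longrightarrow> R r \<Longrightarrow> P r"
    unfolding ae_at_top_def eventually_inf by blast
  from Q obtain r0 where "\<And>r. r \<ge> r0 \<Longrightarrow> Q r" by (auto simp: eventually_at_top_linorder)
  with R imp have "AE r in lborel. r \<ge> r0 \<longrightarrow> P r" by (auto elim!: eventually_mono)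
  thus "\<exists>r0. AE r in lborel. r \<ge> r0 \<longrightarrow> P r" ..
next
  assume "\<exists>r0. AE r in lborel. r \<ge> r0 \<longrightarrow> P r"
  then obtain r0 where "AE r in lborel. r \<ge> r0 \<longrightarrow> P r" ..
  thus "eventually P ae_at_top"
    unfolding ae_at_top_def eventually_inf
    using eventually_ge_at_top[of r0] by (intro exI[of _ "\<lambda>r. r \<ge> r0"] exI[of _ "\<lambda>r. r \<ge> r0 \<longrightarrow> P r"]) auto
qed

lemma eventually_at_top_imp_ae_at_top: "eventually P at_top \<Longrightarrow> eventually P ae_at_top"
  unfolding ae_at_top_def by (rule filter_leD[OF inf_le1])

lemma eventually_ae_at_top_ge: "\<forall>\<^sub>F r in ae_at_top. r \<ge> c" and eventually_ae_at_top_gt: "\<forall>\<^sub>F r in ae_at_top. r > c"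
  by (intro eventually_at_top_imp_ae_at_top eventually_ge_at_top eventually_gt_at_top)+

text \<open>Open intervals have positive measure. This supplies the auxiliary larger radii, and it
  shows that the filter is proper.\<close>

lemma ae_at_top_in_intervals:
  assumes "eventually P ae_at_top"
  shows   "\<exists>r0. \<forall>a b. r0 \<le> a \<longrightarrow> a < b \<longrightarrow> (\<exists>r. a < r \<and> r < b \<and> P r)"
proof -
  obtain r0 where r0: "AE r in lborel. r \<ge> r0 \<longrightarrow> P r"
    using assms by (auto simp: eventually_ae_at_top)
  have "\<exists>r. a < r \<and> r < b \<and> P r" if "r0 \<le> a" "a < b" for a b
  proof (rule ccontr)
    assume *: "\<not> (\<exists>r. a < r \<and> r < b \<and> P r)"
    from r0 have "AE r in lborel. r \<notin> {a<..<b}"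
      by eventually_elim (use * that in auto)
    hence "{a<..<b} \<in> null_sets lborel"
      by (subst AE_iff_null_sets) auto
    thus False using that by (auto simp: null_sets_def)
  qed
  thus ?thesis by blast
qed

text \<open>A sparse set in the plane is countable, so the moduli of its points form a countable and
  hence null set of radii.\<close>

lemma eventually_cosparse_imp_ae_at_top:
  assumes "eventually P (cosparse UNIV)"
  shows   "\<forall>\<^sub>F r in ae_at_top. \<forall>z. cmod z = r \<longrightarrow> P z"
proof -
  have "countable (UNIV \<inter> {z. \<not>P z})"
    by (rule sparse_imp_countable) (use assms in \<open>auto simp: eventually_cosparse\<close>)
  hence "countable (cmod ` {z. \<not>P z})" by simp
  hence "AE r in lborel. r \<notin> cmod ` {z. \<not>P z}"
    by (intro AE_not_in countable_imp_null_set_lborel)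
  hence "AE r in lborel. r \<ge> 0 \<longrightarrow> (\<forall>z. cmod z = r \<longrightarrow> P z)"
    by eventually_elim auto
  thus ?thesis by (auto simp: eventually_ae_at_top)
qed

text \<open>Meromorphic and not identically zero. The second condition is phrased off a sparse set
  because the values of a meromorphic function on such a set, for instance at poles, are
  arbitrary.\<close>

definition nzmero :: "(complex \<Rightarrow> complex) \<Rightarrow> bool" where
  "nzmero h \<longleftrightarrow> h meromorphic_on UNIV \<and> (\<forall>\<^sub>F z in cosparse UNIV. h z \<noteq> 0)"

definition reg :: "(complex \<Rightarrow> complex) \<Rightarrow> complex \<Rightarrow> bool" where
  "reg h z \<longleftrightarrow> h analytic_on {z} \<and> h z \<noteq> 0"

lemma nzmero_mero [simp]: "nzmero h \<Longrightarrow> h meromorphic_on A"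
  unfolding nzmero_def using meromorphic_on_subset by blast

lemma nzmero_cosparse_reg: "nzmero h \<Longrightarrow> \<forall>\<^sub>F z in cosparse UNIV. reg h z"
  unfolding nzmero_def reg_def
  by (intro eventually_conj meromorphic_on_imp_analytic_cosparse) auto

lemma nzmero_eventually_at: "nzmero h \<Longrightarrow> \<forall>\<^sub>F z in at a. h z \<noteq> 0"
  unfolding nzmero_def by (auto intro: eventually_cosparse_imp_eventually_at)

lemma nzmero_frequently_at: "nzmero h \<Longrightarrow> \<exists>\<^sub>F z in at a. h z \<noteq> 0"
  using nzmero_eventually_at eventually_frequently at_neq_bot by blast

lemma nzmero_ae_at_top: "nzmero h \<Longrightarrow> \<forall>\<^sub>F r in ae_at_top. \<forall>z. cmod z = r \<longrightarrow> reg h z"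
  by (intro eventually_cosparse_imp_ae_at_top nzmero_cosparse_reg)

lemma nzmero_const: "c \<noteq> 0 \<Longrightarrow> nzmero (\<lambda>_. c)"
  by (auto simp: nzmero_def)

lemma nzmero_mult: "nzmero f \<Longrightarrow> nzmero g \<Longrightarrow> nzmero (\<lambda>z. f z * g z)"
  unfolding nzmero_def by (auto intro!: meromorphic_intros elim: eventually_elim2)

lemma nzmero_divide: "nzmero f \<Longrightarrow> nzmero g \<Longrightarrow> nzmero (\<lambda>z. f z / g z)"
  unfolding nzmero_def by (auto intro!: meromorphic_intros elim: eventually_elim2)

lemma nzmero_power: "nzmero f \<Longrightarrow> nzmero (\<lambda>z. f z ^ n)"
  unfolding nzmero_def
  by (intro conjI meromorphic_intros; elim conjE) (assumption, erule eventually_mono, simp)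

lemma nzmero_power_int: "nzmero f \<Longrightarrow> nzmero (\<lambda>z. f z powi n)"
  unfolding nzmero_def
  by (intro conjI meromorphic_intros; elim conjE) (assumption, erule eventually_mono, simp)

lemma nzmero_prod: "(\<And>a. a \<in> A \<Longrightarrow> nzmero (f a)) \<Longrightarrow> nzmero (\<lambda>z. \<Prod>a\<in>A. f a z)"
  by (induction A rule: infinite_finite_induct) (auto intro: nzmero_const nzmero_mult)

lemma nzmero_linear: "nzmero (\<lambda>z. z - a)"
  unfolding nzmero_def
  using eventually_not_in_cosparse[of "{a}" UNIV]
  by (auto intro!: meromorphic_intros elim: eventually_mono)

lemma nzmero_holomorphic:
  assumes "h holomorphic_on UNIV" "\<exists>z. h z \<noteq> 0"
  shows   "nzmero h"
proof -
  have mero: "h meromorphic_on UNIV"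
    using assms(1) analytic_on_open analytic_on_imp_meromorphic_on by blast
  obtain z where z: "h z \<noteq> 0" using assms by blast
  have "isCont h z" using assms(1) using continuous_on_eq_continuous_at holomorphic_on_imp_continuous_on by blast
  hence "h \<midarrow>z\<rightarrow> h z" by (simp add: isCont_def)
  hence "\<forall>\<^sub>F w in at z. h w \<noteq> 0" using z by (rule tendsto_imp_eventually_ne)
  moreover have "\<not> (\<forall>\<^sub>F w in at z. h w = 0)" if "\<forall>\<^sub>F w in at z. h w \<noteq> 0"
    using that eventually_frequently[OF at_neq_bot that] by (simp add: frequently_def)
  ultimately have "\<not> (\<forall>\<^sub>F z in cosparse UNIV. h z = 0)"
    using eventually_cosparse_imp_eventually_at[of "\<lambda>z. h z = 0" UNIV z UNIV] by auto
  thus ?thesis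
    using meromorphic_imp_constant_or_avoid[OF mero, of 0] mero by (auto simp: nzmero_def)
qed

lemma zorder_reg: "reg h z \<Longrightarrow> zorder h z = 0"
  unfolding reg_def by (intro zorder_eq_0I) auto

lemma finite_not_reg:
  assumes "nzmero h"
  shows   "finite {a. cmod a \<le> r \<and> \<not>reg h a}"
proof -
  have "{z. \<not>reg h z} sparse_in UNIV"
    using nzmero_cosparse_reg[OF assms] by (simp add: eventually_cosparse)
  hence "{z. \<not>reg h z} sparse_in cball 0 r" by (rule sparse_in_subset) auto
  hence "finite (cball 0 r \<inter> {z. \<not>reg h z})" by (rule sparse_in_compact_finite) auto
  thus ?thesis by (rule rev_finite_subset) auto
qed

lemma finite_zorder_support:
  assumes "nzmero h"
  shows   "finite {a. cmod a < r \<and> zorder h a \<noteq> 0}"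
  by (rule finite_subset[OF _ finite_not_reg[OF assms, of r]]) (auto dest: zorder_reg)

lemma zorder_linear_powi: "zorder (\<lambda>z. (z - a) powi n) w = (if w = a then n else 0)"
proof (cases "w = a")
  case True
  thus ?thesis by (auto intro!: zorder_eqI[where S = UNIV and g = "\<lambda>_. 1"])
next
  case False
  hence "(\<lambda>z. (z - a) powi n) analytic_on {w}"
    by (auto intro!: analytic_intros)
  with False show ?thesis by (intro zorder_eq_0I[THEN trans]) auto
qed

lemma zorder_0_imp_analytic_nonzero:
  assumes "h meromorphic_on {z}" "\<forall>\<^sub>F w in at z. h w \<noteq> 0" "zorder h z = 0"
  shows   "remove_sings h analytic_on {z}" "remove_sings h z \<noteq> 0"
proof -
  have iso: "isolated_singularity_at h z" "not_essential h z"
    using assms(1) by (auto simp: meromorphic_at_iff)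
  have fr: "\<exists>\<^sub>F w in at z. h w \<noteq> 0"
    using assms(2) eventually_frequently at_neq_bot by blast
  have np: "\<not>is_pole h z"
    using isolated_pole_imp_neg_zorder[OF iso(1)] assms(3) by auto
  thus an: "remove_sings h analytic_on {z}"
    using iso by (auto simp: not_essential_def intro: remove_sings_analytic_at)
  have "\<not>isolated_zero h z"
    using zorder_isolated_zero_pos'[OF _ iso(1)] assms(3) by auto
  thus "remove_sings h z \<noteq> 0"
    using np assms(2) iso(2) by (auto simp: remove_sings_eq_0_iff isolated_zero_def)
qed

text \<open>Dividing out the finitely many zeros and poles inside the circle leaves a function that
  is analytic and free of zeros on the closed disc. By compactness this persists on a larger disc,
  where a holomorphic logarithm G exists. The equation is claimed only at points where h is
  regular.\<close>

lemma meromorphic_factorization: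
  assumes h: "nzmero h" and R: "R > 0" and good: "\<And>z. cmod z = R \<Longrightarrow> reg h z"
  defines "A \<equiv> {a. cmod a < R \<and> zorder h a \<noteq> 0}"
  obtains G R' where "R' > R" "G holomorphic_on ball 0 R'"
    "\<And>z. cmod z \<le> R \<Longrightarrow> reg h z \<Longrightarrow> h z = (\<Prod>a\<in>A. (z - a) powi zorder h a) * exp (G z)"
proof -
  have fin: "finite A" unfolding A_def by (rule finite_zorder_support[OF h])
  define P where "P = (\<lambda>z. \<Prod>a\<in>A. (z - a) powi zorder h a)"
  have P: "nzmero P"
    unfolding P_def by (intro nzmero_prod nzmero_power_int nzmero_linear)
  define q where "q = (\<lambda>z. h z / P z)"
  have q: "nzmero q" unfolding q_def by (intro nzmero_divide h P)
  have zP: "zorder P z = (if z \<in> A then zorder h z else 0)" for z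
  proof -
    have "zorder P z = (\<Sum>a\<in>A. zorder (\<lambda>w. (w - a) powi zorder h a) z)"
      unfolding P_def
      by (rule zorder_prod)
         (use nzmero_eventually_at[OF P] in \<open>auto simp: P_def intro!: meromorphic_intros\<close>)
    also have "\<dots> = (\<Sum>a\<in>A. if z = a then zorder h a else 0)"
      by (simp add: zorder_linear_powi)
    also have "\<dots> = (if z \<in> A then zorder h z else 0)"
      using fin by (simp add: sum.delta')
    finally show ?thesis .
  qed
  have zq: "zorder q z = 0" if "cmod z \<le> R" for z
  proof -
    have "zorder q z = zorder h z - zorder P z"
      unfolding q_def
      by (rule zorder_divide) (auto simp: h P nzmero_frequently_at)
    moreover have "zorder h z = 0" if "z \<notin> A"
      using that \<open>cmod z \<le> R\<close> good[of z] zorder_reg[of h z] by (cases "cmod z = R") (auto simp: A_def)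
    ultimately show ?thesis by (auto simp: zP)
  qed
  \<comment> \<open>q may have arbitrary values at points of A and where h does. It has order 0
    everywhere in the closed disc, so that removing singularities makes it analytic and nonzero
    there.\<close>
  define u where "u = remove_sings q"
  have u: "u analytic_on {z}" "u z \<noteq> 0" if "cmod z \<le> R" for z
    using zorder_0_imp_analytic_nonzero[OF _ _ zq[OF that]] nzmero_eventually_at[OF q] q
    by (auto simp: u_def)
  have "u analytic_on cball 0 R"
    using u(1) by (subst analytic_on_analytic_at) auto
  then obtain U where U: "open U" "cball 0 R \<subseteq> U" "u holomorphic_on U"
    by (auto simp: analytic_on_holomorphic)
  define V where "V = {z\<in>U. u z \<noteq> 0}"
  have "open V"
  proof -
    have "V = U \<inter> u -` (- {0})" by (auto simp: V_def)
    thus ?thesis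
      using continuous_open_preimage[OF holomorphic_on_imp_continuous_on[OF U(3)] U(1), of "- {0}"]
      by (simp add: open_Compl)
  qed
  moreover have "cball 0 R \<subseteq> V" using U u(2) by (auto simp: V_def)
  ultimately obtain e where e: "e > 0" "(\<Union>x\<in>cball 0 R. ball x e) \<subseteq> V"
    using compact_subset_open_imp_ball_epsilon_subset[of "cball 0 R" V] by auto
  have sub: "ball 0 (R + e) \<subseteq> V"
  proof
    fix z :: complex assume z: "z \<in> ball 0 (R + e)"
    show "z \<in> V"
    proof (cases "cmod z \<le> R")
      case True thus ?thesis using \<open>cball 0 R \<subseteq> V\<close> by auto
    next
      case False
      \<comment> \<open>The radial projection of z to the circle; its distance from z is |z| - R,
        which is less than e.\<close>
      define x where "x = of_real (R / cmod z) * z"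
      have "cmod x = R" using False R by (auto simp: x_def norm_mult norm_divide)
      have "z - x = of_real (1 - R / cmod z) * z" by (simp add: x_def algebra_simps)
      hence "cmod (z - x) = (1 - R / cmod z) * cmod z"
        using False R by (simp only: norm_mult norm_of_real) (auto simp: field_simps abs_if)
      moreover have "z \<noteq> 0" using False R by auto
      ultimately have "cmod (z - x) = cmod z - R" by (simp add: left_diff_distrib)
      have "z \<in> ball x e" "x \<in> cball 0 R"
        using z \<open>cmod (z - x) = cmod z - R\<close> \<open>cmod x = R\<close> by (auto simp: dist_norm norm_minus_commute)
      thus ?thesis using e by blast
    qed
  qed
  obtain G where G: "G holomorphic_on ball 0 (R + e)" "\<And>x. x \<in> ball 0 (R + e) \<Longrightarrow> exp (G x) = u x"
  proof (rule holomorphic_logarithm_exists[of "ball 0 (R + e)" u 0])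
    show "u holomorphic_on ball 0 (R + e)"
      using sub U(3) by (auto simp: V_def intro: holomorphic_on_subset)
    show "u x \<noteq> 0" if "x \<in> ball 0 (R + e)" for x
      using sub that by (auto simp: V_def)
  qed (use R e in auto)
  show ?thesis
  proof (rule that[of "R + e" G])
    fix z assume z: "cmod z \<le> R" "reg h z"
    have "z \<notin> A" using zorder_reg[OF z(2)] by (auto simp: A_def)
    hence nz: "z \<noteq> a" if "a \<in> A" for a using that by blast
    hence Pz: "P z \<noteq> 0" using fin by (auto simp: P_def)
    have "P analytic_on {z}"
      unfolding P_def using nz by (auto intro!: analytic_intros)
    hence "q analytic_on {z}"
      unfolding q_def using z(2) Pz by (auto intro!: analytic_intros simp: reg_def)
    hence "u z = q z" by (simp add: u_def)
    moreover have "exp (G z) = u z" using z(1) e(1) by (intro G(2)) auto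
    ultimately show "h z = (\<Prod>a\<in>A. (z - a) powi zorder h a) * exp (G z)"
      using Pz by (simp add: q_def P_def)
  qed (use e G in auto)
qed

section \<open>Jensen's formula\<close>

text \<open>Because ln 0 = 0, the term at the origin is d 0 * ln r, as in the integrated counting
  function.\<close>
definition ordsum :: "real \<Rightarrow> (complex \<Rightarrow> int) \<Rightarrow> real" where
  "ordsum r d = (\<Sum>a | cmod a < r \<and> d a \<noteq> 0. of_int (d a) * (ln r - ln (cmod a)))"

text \<open>Local finiteness of a divisor. A sum over an infinite set is 0 by convention, so
  \<open>ordsum\<close> is meaningful only under this condition.\<close>

definition fin_orders :: "(complex \<Rightarrow> int) \<Rightarrow> bool" where
  "fin_orders d \<longleftrightarrow> (\<forall>r. finite {a. cmod a < r \<and> d a \<noteq> 0})"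

lemma fin_orders_zorder: "nzmero h \<Longrightarrow> fin_orders (zorder h)"
  unfolding fin_orders_def by (simp add: finite_zorder_support)

lemma fin_orders_compose:
  assumes "fin_orders d" "\<And>a. d a = 0 \<Longrightarrow> e a = 0"
  shows   "fin_orders e"
  unfolding fin_orders_def
proof
  fix r
  show "finite {a. cmod a < r \<and> e a \<noteq> 0}"
    by (rule finite_subset[of _ "{a. cmod a < r \<and> d a \<noteq> 0}"])
       (use assms in \<open>auto simp: fin_orders_def\<close>)
qed

lemma fin_orders_compose2:
  assumes "fin_orders d" "fin_orders d'" "\<And>a. d a = 0 \<Longrightarrow> d' a = 0 \<Longrightarrow> e a = 0"
  shows   "fin_orders e"
  unfolding fin_orders_def
proof
  fix r
  have "finite ({a. cmod a < r \<and> d a \<noteq> 0} \<union> {a. cmod a < r \<and> d' a \<noteq> 0})"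
    using assms(1,2) by (auto simp: fin_orders_def)
  thus "finite {a. cmod a < r \<and> e a \<noteq> 0}"
    by (rule rev_finite_subset) (use assms(3) in auto)
qed

lemma ordsum_superset:
  assumes "finite A" "\<And>a. a \<in> A \<Longrightarrow> cmod a < r" "\<And>a. cmod a < r \<Longrightarrow> d a \<noteq> 0 \<Longrightarrow> a \<in> A"
  shows   "ordsum r d = (\<Sum>a\<in>A. of_int (d a) * (ln r - ln (cmod a)))"
  unfolding ordsum_def by (rule sum.mono_neutral_left) (use assms in auto)

text \<open>The bound r >= 1 concerns the point 0, whose weight is ln r.\<close>

lemma ordsum_weight_nonneg:
  assumes "r \<ge> 1" "cmod a < r"
  shows   "ln r - ln (cmod a) \<ge> 0"
proof (cases "a = 0")
  case False
  thus ?thesis using assms by (simp add: ln_mono)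
qed (use assms in simp)

lemma
  assumes "fin_orders d" "fin_orders e"
  shows ordsum_add: "ordsum r (\<lambda>a. d a + e a) = ordsum r d + ordsum r e"
    and ordsum_mono: "r \<ge> 1 \<Longrightarrow> (\<And>a. d a \<le> e a) \<Longrightarrow> ordsum r d \<le> ordsum r e"
proof -
  define A where "A = {a. cmod a < r \<and> d a \<noteq> 0} \<union> {a. cmod a < r \<and> e a \<noteq> 0}"
  have A: "finite A" "\<And>a. a \<in> A \<Longrightarrow> cmod a < r"
    using assms by (auto simp: A_def fin_orders_def)
  have eq: "ordsum r d = (\<Sum>a\<in>A. of_int (d a) * (ln r - ln (cmod a)))"
           "ordsum r e = (\<Sum>a\<in>A. of_int (e a) * (ln r - ln (cmod a)))"
           "ordsum r (\<lambda>a. d a + e a) = (\<Sum>a\<in>A. of_int (d a + e a) * (ln r - ln (cmod a)))"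
    by (rule ordsum_superset; use A(1) in \<open>force simp: A_def\<close>)+
  show "ordsum r (\<lambda>a. d a + e a) = ordsum r d + ordsum r e"
    unfolding eq by (simp add: sum.distrib [symmetric] ring_distribs algebra_simps)
  show "ordsum r d \<le> ordsum r e" if "r \<ge> 1" "\<And>a. d a \<le> e a"
    unfolding eq using that A by (intro sum_mono mult_right_mono ordsum_weight_nonneg) auto
qed

lemma ordsum_cmul: "c \<noteq> 0 \<Longrightarrow> ordsum r (\<lambda>a. c * d a) = of_int c * ordsum r d"
  unfolding ordsum_def sum_distrib_left by (intro sum.cong) (auto simp: mult_ac)

lemma ordsum_nonneg:
  assumes "r \<ge> 1" "\<And>a. d a \<ge> 0"
  shows   "ordsum r d \<ge> 0"
  unfolding ordsum_def
  using assms by (intro sum_nonneg mult_nonneg_nonneg ordsum_weight_nonneg) auto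

text \<open>\<open>zor_poly h 0 0\<close> is the leading Laurent coefficient of h at 0; the constant
  is the logarithm of its modulus.\<close>

definition jensen_const :: "(complex \<Rightarrow> complex) \<Rightarrow> real" where
  "jensen_const h = ln (cmod (zor_poly h 0 0))"

lemma continuous_on_reg_sphere:
  assumes "\<And>z. cmod z = r \<Longrightarrow> h analytic_on {z}"
  shows   "continuous_on (sphere 0 r) h"
proof -
  have "h analytic_on sphere 0 r" using assms by (subst analytic_on_analytic_at) auto
  thus ?thesis by (intro analytic_imp_holomorphic holomorphic_on_imp_continuous_on)
qed

lemma continuous_on_ln_reg:
  assumes "\<And>z. cmod z = r \<Longrightarrow> reg h z"
  shows   "continuous_on (sphere 0 r) (\<lambda>z. ln (cmod (h z)))"
  using assms by (intro continuous_intros continuous_on_reg_sphere) (auto simp: reg_def)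

lemma continuous_on_ln_linear:
  assumes "cmod a < r"
  shows   "continuous_on (sphere 0 r) (\<lambda>z. ln (cmod (z - a)))"
  using assms by (intro continuous_intros) auto

lemma ln_cmod_prod_powi:
  assumes "finite A" "z \<notin> A"
  shows   "ln (cmod (\<Prod>a\<in>A. (z - a) powi m a)) = (\<Sum>a\<in>A. of_int (m a) * ln (cmod (z - a)))"
  using assms
proof (induction A rule: finite_induct)
  case (insert x F)
  have "(\<Prod>a\<in>F. (z - a) powi m a) \<noteq> 0" using insert by auto
  moreover have "z - x \<noteq> 0" using insert by auto
  ultimately have "ln (cmod (\<Prod>a\<in>insert x F. (z - a) powi m a)) =
        ln (cmod (z - x) powi m x) + ln (cmod (\<Prod>a\<in>F. (z - a) powi m a))"
    using insert(1,2) by (simp add: norm_mult norm_power_int ln_mult)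
  moreover have "ln (cmod (z - x) powi m x) = of_int (m x) * ln (cmod (z - x))"
    using \<open>z - x \<noteq> 0\<close> by (cases "m x \<ge> 0") (auto simp: power_int_def ln_realpow ln_inverse)
  ultimately show ?case using insert by simp
qed auto

lemma ln_cmod_factorization:
  assumes "finite A" "\<And>a. a \<in> A \<Longrightarrow> m a \<noteq> 0" "h z = (\<Prod>a\<in>A. (z - a) powi m a) * exp (G z)" "h z \<noteq> 0"
  shows   "ln (cmod (h z)) = (\<Sum>a\<in>A. of_int (m a) * ln (cmod (z - a))) + Re (G z)"
proof -
  have "z \<notin> A" using assms by (auto simp: prod_zero_iff)
  moreover from this have "(\<Prod>a\<in>A. (z - a) powi m a) \<noteq> 0" using assms(1) by auto
  ultimately show ?thesis
    by (simp add: assms(3) norm_mult ln_mult ln_cmod_prod_powi assms(1))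
qed

text \<open>In the factorization each ln|z - a| has mean ln R and Re G has mean Re (G 0). What does
  not belong to \<open>ordsum\<close> is the logarithm of the leading coefficient at 0.\<close>

theorem jensen_formula:
  assumes h: "nzmero h" and R: "R > 0" and good: "\<And>z. cmod z = R \<Longrightarrow> reg h z"
  shows   "cmean R (\<lambda>z. ln (cmod (h z))) = ordsum R (zorder h) + jensen_const h"
proof -
  define A where "A = {a. cmod a < R \<and> zorder h a \<noteq> 0}"
  have fin: "finite A" unfolding A_def by (rule finite_zorder_support[OF h])
  from meromorphic_factorization[OF h R good] obtain G R' where
    R': "R' > R" and G: "G holomorphic_on ball 0 R'" and
    eq: "\<And>z. cmod z \<le> R \<Longrightarrow> reg h z \<Longrightarrow> h z = (\<Prod>a\<in>A. (z - a) powi zorder h a) * exp (G z)"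
    unfolding A_def by blast
  have ReG: "continuous_on (sphere 0 R) (\<lambda>z. Re (G z))"
    by (rule continuous_on_Re, rule holomorphic_on_imp_continuous_on, rule holomorphic_on_subset[OF G])
       (use R' in auto)
  have contl: "continuous_on (sphere 0 R) (\<lambda>z. ln (cmod (z - a)))" if "a \<in> A" for a
    by (rule continuous_on_ln_linear) (use that in \<open>auto simp: A_def\<close>)
  have "cmean R (\<lambda>z. ln (cmod (h z))) =
        cmean R (\<lambda>z. (\<Sum>a\<in>A. of_int (zorder h a) * ln (cmod (z - a))) + Re (G z))"
    by (intro cmean_cong ln_cmod_factorization fin eq)
       (use good R in \<open>auto simp: reg_def A_def\<close>)
  also have "\<dots> = cmean R (\<lambda>z. (\<Sum>a\<in>A. of_int (zorder h a) * ln (cmod (z - a)))) + Re (G 0)"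
    using cmean_Re_holomorphic[OF G R R'] R
    by (subst cmean_add) (auto intro!: continuous_on_sum continuous_on_mult continuous_on_const contl ReG)
  also have "cmean R (\<lambda>z. (\<Sum>a\<in>A. of_int (zorder h a) * ln (cmod (z - a)))) =
             (\<Sum>a\<in>A. of_int (zorder h a) * ln R)"
    using R by (subst cmean_sum)
       (auto intro!: continuous_on_mult continuous_on_const contl sum.cong simp: cmean_cmul cmean_ln_dist A_def)
  \<comment> \<open>A zero or pole at 0 contributes nothing to the second sum, as
    \<open>ln 0 = 0\<close>.\<close>
  also have "\<dots> = ordsum R (zorder h) + (\<Sum>a\<in>A. of_int (zorder h a) * ln (cmod a))"
    by (simp add: ordsum_def A_def sum.distrib [symmetric] ring_distribs sum_subtractf)
  finally have 1: "cmean R (\<lambda>z. ln (cmod (h z))) =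
     ordsum R (zorder h) + ((\<Sum>a\<in>A. of_int (zorder h a) * ln (cmod a)) + Re (G 0))" by simp

  \<comment> \<open>The leading coefficient at 0: the factor belonging to 0 is stripped off and the
    rest is evaluated there.\<close>
  define L where "L = (\<Prod>a\<in>A-{0}. (0 - a) powi zorder h a) * exp (G 0)"
  have "zor_poly h 0 0 = L"
  proof (rule zor_poly_eqI[where F = "at 0" and g = "\<lambda>w. w"])
    have "isCont G 0"
      using G R R' by (intro continuous_on_interior[OF holomorphic_on_imp_continuous_on[OF G]]) auto
    hence "((\<lambda>w. (\<Prod>a\<in>A-{0}. (w - a) powi zorder h a) * exp (G w)) \<longlongrightarrow> L) (at 0)"
      unfolding L_def by (intro tendsto_intros) (auto simp: isCont_def)
    moreover have "\<forall>\<^sub>F w in at 0. h w * (w - 0) powi - zorder h 0 =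
                     (\<Prod>a\<in>A-{0}. (w - a) powi zorder h a) * exp (G w)"
    proof -
      have "\<forall>\<^sub>F w in at 0. reg h w"
        using nzmero_cosparse_reg[OF h] by (rule eventually_cosparse_imp_eventually_at) auto
      moreover have "\<forall>\<^sub>F w in at 0. w \<in> ball 0 R - {0}"
        using R by (intro eventually_at_in_open) auto
      ultimately show ?thesis
      proof eventually_elim
        case (elim w)
        have "h w = (\<Prod>a\<in>A. (w - a) powi zorder h a) * exp (G w)"
          using elim by (intro eq) auto
        also have "(\<Prod>a\<in>A. (w - a) powi zorder h a) =
                   w powi zorder h 0 * (\<Prod>a\<in>A-{0}. (w - a) powi zorder h a)"
        proof (cases "0 \<in> A")
          case True
          thus ?thesis using fin by (subst prod.remove[of A 0]) auto
        next
          case False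
          hence "zorder h 0 = 0" using R by (auto simp: A_def)
          thus ?thesis using False by simp
        qed
        finally show ?case using elim by (simp add: power_int_minus field_simps)
      qed
    qed
    ultimately show "((\<lambda>x. h x * (x - 0) powi - zorder h 0) \<longlongrightarrow> L) (at 0)"
      by (simp cong: filterlim_cong)
    show "isolated_singularity_at h 0" "not_essential h 0" "\<exists>\<^sub>F w in at 0. h w \<noteq> 0"
      using h by (simp_all add: meromorphic_on_isolated_singularity meromorphic_on_not_essential
                    nzmero_frequently_at)
  qed (simp_all add: filterlim_ident)
  hence "jensen_const h = ln (cmod L)" by (simp add: jensen_const_def)
  also have "\<dots> = (\<Sum>a\<in>A-{0}. of_int (zorder h a) * ln (cmod (0 - a))) + Re (G 0)"
    unfolding L_def using fin
    by (subst norm_mult, subst ln_mult) (auto simp: ln_cmod_prod_powi simp del: diff_0)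
  also have "(\<Sum>a\<in>A-{0}. of_int (zorder h a) * ln (cmod (0 - a))) =
             (\<Sum>a\<in>A. of_int (zorder h a) * ln (cmod a))"
    using fin by (intro sum.mono_neutral_cong_left) auto
  finally show ?thesis using 1 by simp
qed

section \<open>Poles and the integrated counting function\<close>

definition pole_order :: "(complex \<Rightarrow> complex) \<Rightarrow> complex \<Rightarrow> int" where
  "pole_order f a = max 0 (- zorder f a)"

lemma pole_order_nonneg [simp]: "pole_order f a \<ge> 0"
  by (simp add: pole_order_def)

lemma fin_orders_pole_order: "nzmero h \<Longrightarrow> fin_orders (pole_order h)"
  by (rule fin_orders_compose[OF fin_orders_zorder]) (auto simp: pole_order_def)

lemma is_pole_iff_zorder:
  assumes "nzmero f"
  shows "is_pole f z \<longleftrightarrow> zorder f z < 0"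
  using isolated_pole_imp_neg_zorder[of f z] zorder_neg_imp_is_pole[of f z] nzmero_eventually_at[OF assms]
    meromorphic_on_isolated_singularity[of f z] nzmero_mero[OF assms]
  by blast

text \<open>The contribution of one pole of modulus s and multiplicity m to the counting integral:
  its count jumps from 0 to m at t = s.\<close>

lemma set_integral_step_over_t:
  fixes m r s :: real
  assumes "0 < s" "s \<le> r"
  shows   "set_integrable lborel {0<..r} (\<lambda>t. (if s \<le> t then m else 0) / t)"
    and   "(LBINT t:{0<..r}. (if s \<le> t then m else 0) / t) = m * (ln r - ln s)"
proof -
  have eq: "(\<lambda>t. indicator {0<..r} t *\<^sub>R ((if s \<le> t then m else 0) / t)) =
            (\<lambda>t. indicator {s..r} t *\<^sub>R (m / t))"
    using assms by (auto simp: fun_eq_iff indicator_def dest: order.strict_trans2)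
  have cont: "continuous_on {s..r} (\<lambda>t. m / t)"
    using assms by (intro continuous_intros) auto
  have int: "set_integrable lborel {s..r} (\<lambda>t. m / t)"
    unfolding set_integrable_def
    by (rule borel_integrable_atLeastAtMost'[OF cont, unfolded set_integrable_def])
  show "set_integrable lborel {0<..r} (\<lambda>t. (if s \<le> t then m else 0) / t)"
    using int unfolding set_integrable_def eq .
  have "(LBINT t:{0<..r}. (if s \<le> t then m else 0) / t) = (LBINT t:{s..r}. m / t)"
    unfolding set_lebesgue_integral_def eq ..
  also have "\<dots> = integral {s..r} (\<lambda>t. m / t)"
    by (rule set_borel_integral_eq_integral(2)[OF int])
  also have "\<dots> = m * ln r - m * ln s"
    using assms
    by (intro integral_unique fundamental_theorem_of_calculus)
       (auto intro!: derivative_eq_intros simp: has_real_derivative_iff_has_vector_derivative [symmetric])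
  finally show "(LBINT t:{0<..r}. (if s \<le> t then m else 0) / t) = m * (ln r - ln s)"
    by (simp add: algebra_simps)
qed

text \<open>Up to radius r the pole count is a finite sum of step functions, one for each pole,
  integrated separately. The pole at 0 is removed by subtracting \<open>pole_count 0 f\<close> and
  comes back as the term with ln r.\<close>

lemma pole_counting_eq_ordsum:
  assumes f: "nzmero f" and r: "r > 0" and good: "\<And>z. cmod z = r \<Longrightarrow> reg f z"
  shows   "pole_counting r f = ordsum r (pole_order f)"
proof -
  define A where "A = {a. cmod a < r \<and> pole_order f a \<noteq> 0}"
  have fin: "finite A" using fin_orders_pole_order[OF f] by (simp add: A_def fin_orders_def)
  define m where "m = (\<lambda>a. real_of_int (pole_order f a))"
  have np: "\<not>is_pole f z" if "cmod z = r" for z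
    using zorder_reg[OF good[OF that]] by (simp add: is_pole_iff_zorder[OF f])
  have pc: "pole_count t f = (\<Sum>a\<in>A. if cmod a \<le> t then m a else 0)" if "t \<le> r" for t
  proof -
    have "pole_count t f = (\<Sum>a\<in>{a\<in>A. cmod a \<le> t}. m a)"
      unfolding pole_count_def
    proof (rule sum.cong)
      show "{z. cmod z \<le> t \<and> is_pole f z} = {a \<in> A. cmod a \<le> t}"
        using np that by (force simp: A_def pole_order_def is_pole_iff_zorder[OF f])
    qed (auto simp: A_def m_def pole_order_def)
    also have "\<dots> = (\<Sum>a\<in>A. if cmod a \<le> t then m a else 0)"
      using fin by (simp add: sum.inter_filter)
    finally show ?thesis .
  qed
  have pc0: "pole_count 0 f = (\<Sum>a\<in>A. if a = 0 then m a else 0)"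
    using pc[of 0] r by simp
  have "(LBINT t:{0<..r}. (pole_count t f - pole_count 0 f) / t) =
        (LBINT t:{0<..r}. (\<Sum>a\<in>A-{0}. (if cmod a \<le> t then m a else 0) / t))"
  proof (intro set_lebesgue_integral_cong ballI allI impI)
    fix t assume t: "t \<in> {0<..r}"
    have "pole_count t f - pole_count 0 f =
          (\<Sum>a\<in>A. (if cmod a \<le> t then m a else 0) - (if a = 0 then m a else 0))"
      using t by (simp add: pc pc0 sum_subtractf)
    also have "\<dots> = (\<Sum>a\<in>A-{0}. (if cmod a \<le> t then m a else 0))"
      using fin t by (intro sum.mono_neutral_cong_right) auto
    finally show "(pole_count t f - pole_count 0 f) / t = (\<Sum>a\<in>A-{0}. (if cmod a \<le> t then m a else 0) / t)"
      by (simp add: sum_divide_distrib)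
  qed auto
  also have "\<dots> = (\<Sum>a\<in>A-{0}. (LBINT t:{0<..r}. (if cmod a \<le> t then m a else 0) / t))"
    unfolding set_lebesgue_integral_def scaleR_sum_right
  proof (rule Bochner_Integration.integral_sum)
    fix a assume "a \<in> A - {0}"
    hence "0 < cmod a" "cmod a \<le> r" by (auto simp: A_def)
    from set_integral_step_over_t(1)[OF this, of "m a"]
    show "integrable lborel (\<lambda>t. indicat_real {0<..r} t *\<^sub>R ((if cmod a \<le> t then m a else 0) / t))"
      by (simp add: set_integrable_def)
  qed
  also have "\<dots> = (\<Sum>a\<in>A-{0}. m a * (ln r - ln (cmod a)))"
    by (intro sum.cong set_integral_step_over_t(2)) (auto simp: A_def)
  finally have "pole_counting r f = (\<Sum>a\<in>A-{0}. m a * (ln r - ln (cmod a))) +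
                                      (\<Sum>a\<in>A. if a = 0 then m a else 0) * ln r"
    by (simp add: pole_counting_def pc0)
  also have "\<dots> = (\<Sum>a\<in>A. m a * (ln r - ln (cmod a)))"
    using fin by (cases "0 \<in> A") (auto simp: sum.remove[of A 0])
  finally show ?thesis by (simp add: ordsum_def A_def m_def)
qed

section \<open>Zeros, poles and the quantitative factorization\<close>

text \<open>The proximity function as a circle mean. It agrees with \<open>proximity\<close>, a
  Lebesgue integral, on circles where h is continuous; \<open>nchar\<close> corresponds to
  \<open>nevanlinna_char\<close> in the same way.\<close>

definition prox :: "real \<Rightarrow> (complex \<Rightarrow> complex) \<Rightarrow> real" where
  "prox r h = cmean r (\<lambda>z. log_plus (cmod (h z)))"

definition nchar :: "real \<Rightarrow> (complex \<Rightarrow> complex) \<Rightarrow> real" where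
  "nchar r h = prox r h + ordsum r (pole_order h)"

lemma log_plus_nonneg [simp]: "log_plus x \<ge> 0"
  by (simp add: log_plus_def)

lemma ln_le_log_plus: "x \<ge> 0 \<Longrightarrow> ln x \<le> log_plus x"
  by (cases "x = 0") (auto simp: log_plus_def ln_mono)

lemma log_plus_mono: "x \<le> y \<Longrightarrow> log_plus x \<le> log_plus y"
  by (auto simp: log_plus_def intro!: ln_mono)

lemma abs_ln_eq_log_plus: "x > 0 \<Longrightarrow> \<bar>ln x\<bar> = 2 * log_plus x - ln x"
  by (cases "x \<ge> 1") (auto simp: log_plus_def max_def abs_if)

lemma log_plus_mult_le:
  assumes "x \<ge> 0" "y \<ge> 0"
  shows   "log_plus (x * y) \<le> log_plus x + log_plus y"
proof -
  have "x * y \<le> max 1 x * max 1 y"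
    by (intro mult_mono) (use assms in auto)
  moreover have "1 * 1 \<le> max 1 x * max 1 y"
    by (intro mult_mono) auto
  ultimately have "max 1 (x * y) \<le> max 1 x * max 1 y" by simp
  hence "ln (max 1 (x * y)) \<le> ln (max 1 x * max 1 y)"
    by (intro ln_mono) auto
  thus ?thesis by (simp add: log_plus_def ln_mult_pos less_max_iff_disj)
qed

lemma log_plus_add_le:
  assumes "x \<ge> 0" "y \<ge> 0"
  shows   "log_plus (x + y) \<le> log_plus x + log_plus y + ln 2"
proof -
  \<comment> \<open>For X, Y >= 1 this yields X + Y <= 1 + XY <= 2XY.\<close>
  have "0 \<le> (max 1 x - 1) * (max 1 y - 1)" by (intro mult_nonneg_nonneg) auto
  moreover have "1 * 1 \<le> max 1 x * max 1 y" by (intro mult_mono) auto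
  ultimately have "max 1 x + max 1 y \<le> 2 * (max 1 x * max 1 y)"
    unfolding ring_distribs left_diff_distrib right_diff_distrib by linarith
  hence "max 1 (x + y) \<le> 2 * (max 1 x * max 1 y)" by (simp add: max_def split: if_splits)
  hence "ln (max 1 (x + y)) \<le> ln (2 * (max 1 x * max 1 y))"
    by (intro ln_mono) auto
  thus ?thesis by (simp add: log_plus_def ln_mult_pos less_max_iff_disj)
qed

lemma continuous_on_log_plus [continuous_intros]:
  "continuous_on A f \<Longrightarrow> continuous_on A (\<lambda>x. log_plus (f x))"
  unfolding log_plus_def by (intro continuous_intros) (auto simp: max_def)

lemma prox_nonneg:
  assumes "continuous_on (sphere 0 r) h" "r \<ge> 0"
  shows   "prox r h \<ge> 0"
  unfolding prox_def using assms by (intro cmean_nonneg continuous_intros) auto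

lemma proximity_eq_prox:
  assumes "continuous_on (sphere 0 r) h" "r \<ge> 0"
  shows   "proximity r h = prox r h"
proof -
  have "continuous_on {0..2*pi} (\<lambda>t. h (rcis r t))"
    by (rule continuous_on_rcis_comp[OF assms])
  hence "continuous_on {0..2*pi} (\<lambda>t. log_plus (cmod (h (rcis r t))))"
    by (intro continuous_intros)
  hence "set_integrable lborel {0..2*pi} (\<lambda>t. log_plus (cmod (h (rcis r t))))"
    by (rule borel_integrable_atLeastAtMost')
  from set_borel_integral_eq_integral(2)[OF this] show ?thesis
    by (simp add: proximity_def prox_def cmean_def)
qed

lemma continuous_on_reg: "(\<And>z. cmod z = r \<Longrightarrow> reg h z) \<Longrightarrow> continuous_on (sphere 0 r) h"
  by (rule continuous_on_reg_sphere) (auto simp: reg_def)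

lemma nevanlinna_char_eq_nchar:
  assumes "nzmero h" "r > 0" "\<And>z. cmod z = r \<Longrightarrow> reg h z"
  shows   "nevanlinna_char r h = nchar r h"
  using proximity_eq_prox[OF continuous_on_reg] pole_counting_eq_ordsum assms
  by (simp add: nevanlinna_char_def nchar_def)

lemma nchar_nonneg:
  assumes "r \<ge> 1" "\<And>z. cmod z = r \<Longrightarrow> reg h z"
  shows   "nchar r h \<ge> 0"
  unfolding nchar_def using assms
  by (intro add_nonneg_nonneg prox_nonneg ordsum_nonneg continuous_on_reg) auto

text \<open>Jensen's formula with the zeros discarded: they can only raise the mean.\<close>

lemma cmean_ln_ge:
  assumes "nzmero h" "r \<ge> 1" "\<And>z. cmod z = r \<Longrightarrow> reg h z"
  shows   "cmean r (\<lambda>z. ln (cmod (h z))) \<ge> jensen_const h - ordsum r (pole_order h)"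
proof -
  have "ordsum r (\<lambda>a. (-1) * pole_order h a) \<le> ordsum r (zorder h)"
    using fin_orders_pole_order[OF assms(1)] fin_orders_zorder[OF assms(1)] assms(2)
    by (intro ordsum_mono) (auto intro: fin_orders_compose simp: pole_order_def)
  thus ?thesis
    using jensen_formula[of h r] assms by (subst (asm) ordsum_cmul) auto
qed

text \<open>The form of the first main theorem used here. Since |ln x| = 2 log+ x - ln x, the small
  values of h are controlled once the mean of ln|h| is bounded from below.\<close>

lemma cmean_abs_ln_le:
  assumes "nzmero h" "r \<ge> 1" "\<And>z. cmod z = r \<Longrightarrow> reg h z"
  shows   "cmean r (\<lambda>z. \<bar>ln (cmod (h z))\<bar>) \<le> 2 * nchar r h + \<bar>jensen_const h\<bar>"
proof -
  have c: "continuous_on (sphere 0 r) (\<lambda>z. log_plus (cmod (h z)))"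
    using continuous_on_reg[OF assms(3)] by (intro continuous_intros)
  have "cmean r (\<lambda>z. \<bar>ln (cmod (h z))\<bar>) =
        cmean r (\<lambda>z. 2 * log_plus (cmod (h z)) - ln (cmod (h z)))"
    using assms by (intro cmean_cong abs_ln_eq_log_plus) (auto simp: reg_def)
  also have "\<dots> = 2 * prox r h - cmean r (\<lambda>z. ln (cmod (h z)))"
    using assms c continuous_on_ln_reg[OF assms(3)]
    by (subst cmean_diff) (auto simp: cmean_cmul prox_def intro!: continuous_intros)
  also have "\<dots> \<le> 2 * nchar r h + \<bar>jensen_const h\<bar>"
    using cmean_ln_ge[OF assms] ordsum_nonneg[of r "pole_order h"] assms(2)
    by (simp add: nchar_def)
  finally show ?thesis .
qed

text \<open>Zeros plus poles are zeros minus poles plus twice the poles, and Jensen's formula turns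
  the difference into a mean of ln|h|.\<close>

lemma ordsum_abs_zorder_le:
  assumes "nzmero h" "r \<ge> 1" "\<And>z. cmod z = r \<Longrightarrow> reg h z"
  shows   "ordsum r (\<lambda>a. \<bar>zorder h a\<bar>) \<le> 2 * nchar r h + \<bar>jensen_const h\<bar>"
proof -
  have fo: "fin_orders (zorder h)" "fin_orders (\<lambda>a. 2 * pole_order h a)"
    using fin_orders_zorder[OF assms(1)] by (auto intro: fin_orders_compose simp: pole_order_def)
  have "(\<lambda>a. \<bar>zorder h a\<bar>) = (\<lambda>a. zorder h a + 2 * pole_order h a)"
    by (auto simp: pole_order_def)
  hence "ordsum r (\<lambda>a. \<bar>zorder h a\<bar>) = ordsum r (zorder h) + 2 * ordsum r (pole_order h)"
    using fo by (simp add: ordsum_add ordsum_cmul)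
  also have "ordsum r (zorder h) = cmean r (\<lambda>z. ln (cmod (h z))) - jensen_const h"
    using jensen_formula[of h r] assms by simp
  also have "cmean r (\<lambda>z. ln (cmod (h z))) \<le> prox r h"
    unfolding prox_def using assms continuous_on_reg[OF assms(3)]
    by (intro cmean_mono continuous_on_ln_reg continuous_intros ln_le_log_plus) auto
  finally show ?thesis
    using prox_nonneg[OF continuous_on_reg, of r h] assms(2,3) by (simp add: nchar_def)
qed

text \<open>Passage from the integrated to the plain count: a point of modulus below R has weight at
  least ln 2 >= 1/2 on a circle of radius at least 2R.\<close>

lemma zero_pole_count_le:
  assumes "nzmero h" "R \<ge> 1" "2 * R \<le> R2" "\<And>z. cmod z = R2 \<Longrightarrow> reg h z"
  shows   "(\<Sum>a | cmod a < R \<and> zorder h a \<noteq> 0. \<bar>real_of_int (zorder h a)\<bar>) \<le>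
             2 * (2 * nchar R2 h + \<bar>jensen_const h\<bar>)"
proof -
  have ln2: "ln 2 \<ge> (1/2::real)"
    using ln_ge_iff[of 2 "1/2"] exp_le by (smt (verit) exp_half_le2)
  have "(\<Sum>a | cmod a < R \<and> zorder h a \<noteq> 0. \<bar>real_of_int (zorder h a)\<bar> * (1/2)) \<le>
        (\<Sum>a | cmod a < R \<and> zorder h a \<noteq> 0. \<bar>real_of_int (zorder h a)\<bar> * (ln R2 - ln (cmod a)))"
  proof (intro sum_mono mult_left_mono)
    fix a assume "a \<in> {a. cmod a < R \<and> zorder h a \<noteq> 0}"
    hence a: "cmod a < R" by simp
    have "ln 2 \<le> ln R2 - ln (cmod a)"
    proof (cases "a = 0")
      case True
      thus ?thesis using assms by (auto intro!: ln_mono)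
    next
      case False
      have "ln (2 * cmod a) \<le> ln R2" using False a assms by (intro ln_mono) auto
      thus ?thesis using False by (simp add: ln_mult)
    qed
    thus "1/2 \<le> ln R2 - ln (cmod a)" using ln2 by simp
  qed auto
  also have "\<dots> \<le> (\<Sum>a | cmod a < R2 \<and> zorder h a \<noteq> 0. \<bar>real_of_int (zorder h a)\<bar> * (ln R2 - ln (cmod a)))"
  proof (intro sum_mono2)
    show "finite {a. cmod a < R2 \<and> zorder h a \<noteq> 0}" by (rule finite_zorder_support[OF assms(1)])
    fix b assume "b \<in> {a. cmod a < R2 \<and> zorder h a \<noteq> 0} - {a. cmod a < R \<and> zorder h a \<noteq> 0}"
    thus "\<bar>real_of_int (zorder h b)\<bar> * (ln R2 - ln (cmod b)) \<ge> 0"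
      using assms by (intro mult_nonneg_nonneg ordsum_weight_nonneg) auto
  qed (use assms in auto)
  also have "\<dots> = ordsum R2 (\<lambda>a. \<bar>zorder h a\<bar>)"
    by (simp add: ordsum_def)
  also have "\<dots> \<le> 2 * nchar R2 h + \<bar>jensen_const h\<bar>"
    using assms by (intro ordsum_abs_zorder_le) auto
  finally show ?thesis by (simp add: sum_divide_distrib [symmetric])
qed

lemma cmean_abs_ln_dist_le:
  assumes "cmod a < R" "R \<ge> 1"
  shows   "cmean R (\<lambda>z. \<bar>ln (cmod (z - a))\<bar>) \<le> 2 * ln (2 * R)"
proof -
  have cl: "continuous_on (sphere 0 R) (\<lambda>z. log_plus (cmod (z - a)))"
    by (intro continuous_intros)
  have "cmean R (\<lambda>z. \<bar>ln (cmod (z - a))\<bar>) =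
        cmean R (\<lambda>z. 2 * log_plus (cmod (z - a)) - ln (cmod (z - a)))"
    using assms by (intro cmean_cong abs_ln_eq_log_plus) auto
  also have "\<dots> = 2 * cmean R (\<lambda>z. log_plus (cmod (z - a))) - ln R"
    using assms cl by (subst cmean_diff)
      (auto intro!: continuous_on_ln_linear continuous_intros simp: cmean_cmul cmean_ln_dist)
  also have "cmean R (\<lambda>z. log_plus (cmod (z - a))) \<le> cmean R (\<lambda>_. ln (2 * R))"
  proof (intro cmean_mono)
    fix z assume "cmod z = R"
    hence "cmod (z - a) \<le> 2 * R" using assms norm_triangle_ineq4[of z a] by simp
    thus "log_plus (cmod (z - a)) \<le> ln (2 * R)"
      unfolding log_plus_def using assms by (intro ln_mono) auto
  qed (use cl assms in auto)
  finally have "cmean R (\<lambda>z. \<bar>ln (cmod (z - a))\<bar>) \<le> 2 * ln (2 * R) - ln R" using assms by simp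
  moreover have "ln R \<ge> 0" using assms by simp
  ultimately show ?thesis by linarith
qed

text \<open>The number N of zeros and poles is read off from the wider circle of radius R2. Re G is
  ln|h| minus the contributions of the linear factors, so its absolute mean costs at most the mean
  of |ln|h|| and a logarithm of R for each zero or pole.\<close>

lemma quantitative_factorization:
  assumes h: "nzmero h" and R: "R \<ge> 1" "2 * R \<le> R2"
    and good: "\<And>z. cmod z = R \<Longrightarrow> reg h z" "\<And>z. cmod z = R2 \<Longrightarrow> reg h z"
  defines "A \<equiv> {a. cmod a < R \<and> zorder h a \<noteq> 0}"
  defines "N \<equiv> (\<Sum>a\<in>A. \<bar>real_of_int (zorder h a)\<bar>)"
  obtains G R' where "R' > R" "G holomorphic_on ball 0 R'"
    "\<And>z. cmod z \<le> R \<Longrightarrow> reg h z \<Longrightarrow> h z = (\<Prod>a\<in>A. (z - a) powi zorder h a) * exp (G z)"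
    "N \<le> 4 * nchar R2 h + 2 * \<bar>jensen_const h\<bar>"
    "cmean R (\<lambda>z. \<bar>Re (G z)\<bar>) \<le> 2 * nchar R h + \<bar>jensen_const h\<bar> + N * (2 * ln (2 * R))"
proof -
  have R0: "R > 0" using R by simp
  have fin: "finite A" unfolding A_def by (rule finite_zorder_support[OF h])
  obtain G R' where R': "R' > R" and G: "G holomorphic_on ball 0 R'" and
    eq: "\<And>z. cmod z \<le> R \<Longrightarrow> reg h z \<Longrightarrow> h z = (\<Prod>a\<in>A. (z - a) powi zorder h a) * exp (G z)"
    using meromorphic_factorization[OF h R0 good(1)] unfolding A_def by blast
  have ReG: "continuous_on (sphere 0 R) (\<lambda>z. \<bar>Re (G z)\<bar>)"
    by (rule continuous_on_rabs, rule continuous_on_Re, rule holomorphic_on_imp_continuous_on,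
        rule holomorphic_on_subset[OF G])
       (use R' in auto)
  have contl: "continuous_on (sphere 0 R) (\<lambda>z. \<bar>real_of_int (zorder h a)\<bar> * \<bar>ln (cmod (z - a))\<bar>)" if "a \<in> A" for a
    by (intro continuous_on_mult continuous_on_const continuous_on_rabs continuous_on_ln_linear)
       (use that in \<open>auto simp: A_def\<close>)
  have contl': "continuous_on (sphere 0 R) (\<lambda>z. \<bar>ln (cmod (h z))\<bar>)"
    by (intro continuous_on_rabs continuous_on_ln_reg good)
  have "cmean R (\<lambda>z. \<bar>Re (G z)\<bar>) \<le>
        cmean R (\<lambda>z. \<bar>ln (cmod (h z))\<bar> + (\<Sum>a\<in>A. \<bar>real_of_int (zorder h a)\<bar> * \<bar>ln (cmod (z - a))\<bar>))"
  proof (intro cmean_mono ReG continuous_on_add continuous_on_sum contl contl')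
    fix z assume z: "cmod z = R"
    have "ln (cmod (h z)) = (\<Sum>a\<in>A. of_int (zorder h a) * ln (cmod (z - a))) + Re (G z)"
      by (intro ln_cmod_factorization fin eq) (use good z in \<open>auto simp: reg_def A_def\<close>)
    moreover have "\<bar>\<Sum>a\<in>A. of_int (zorder h a) * ln (cmod (z - a))\<bar> \<le>
                   (\<Sum>a\<in>A. \<bar>of_int (zorder h a) * ln (cmod (z - a))\<bar>)"
      by (rule sum_abs)
    ultimately show "\<bar>Re (G z)\<bar> \<le> \<bar>ln (cmod (h z))\<bar> +
        (\<Sum>a\<in>A. \<bar>real_of_int (zorder h a)\<bar> * \<bar>ln (cmod (z - a))\<bar>)"
      by (simp add: abs_mult)
  qed (use R0 in auto)
  also have "\<dots> = cmean R (\<lambda>z. \<bar>ln (cmod (h z))\<bar>) +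
                    (\<Sum>a\<in>A. \<bar>real_of_int (zorder h a)\<bar> * cmean R (\<lambda>z. \<bar>ln (cmod (z - a))\<bar>))"
    using R0 contl contl' by (subst cmean_add) (auto intro!: continuous_on_sum simp: cmean_sum cmean_cmul)
  also have "\<dots> \<le> (2 * nchar R h + \<bar>jensen_const h\<bar>) + (\<Sum>a\<in>A. \<bar>real_of_int (zorder h a)\<bar> * (2 * ln (2 * R)))"
    using R good
    by (intro add_mono sum_mono mult_left_mono cmean_abs_ln_dist_le cmean_abs_ln_le h) (auto simp: A_def)
  finally have b2: "cmean R (\<lambda>z. \<bar>Re (G z)\<bar>) \<le> 2 * nchar R h + \<bar>jensen_const h\<bar> + N * (2 * ln (2 * R))"
    by (simp add: N_def sum_distrib_right)
  have b1: "N \<le> 4 * nchar R2 h + 2 * \<bar>jensen_const h\<bar>"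
    using zero_pole_count_le[OF h R good(2)] by (simp add: N_def A_def)
  show ?thesis by (rule that[OF R' G _ b1 b2]) (rule eq)
qed

section \<open>The mean of the inverse square root of a distance\<close>

lemma abs_sin_ge_half:
  assumes "\<bar>x\<bar> \<le> pi / 2"
  shows   "\<bar>sin x\<bar> \<ge> \<bar>x\<bar> / 2"
proof -
  \<comment> \<open>The Taylor remainder |x|^3/6 is at most |x|/2 as soon as x^2 <= 3, and (8/5)^2 <
    3.\<close>
  have "pi / 2 \<le> 8/5" using pi_approx by simp
  hence "\<bar>x\<bar> ^ 2 \<le> (8/5) ^ 2" using assms by (intro power_mono) auto
  hence "\<bar>x\<bar> ^ 2 \<le> 3" by (simp add: power2_eq_square)
  hence "\<bar>x\<bar> * \<bar>x\<bar> ^ 2 \<le> \<bar>x\<bar> * 3" by (intro mult_left_mono) auto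
  hence 1: "\<bar>x\<bar> ^ 3 \<le> 3 * \<bar>x\<bar>" by (simp add: power3_eq_cube power2_eq_square)
  have "\<bar>sin x - x\<bar> \<le> \<bar>x\<bar> ^ 3 / 6"
    using Maclaurin_sin_bound[of x 3]
    by (simp add: eval_nat_numeral sin_coeff_def field_simps)
  with 1 show ?thesis by linarith
qed

lemma abs_sin_ge_dist:
  fixes x :: real
  shows "\<bar>sin x\<bar> \<ge> \<bar>x - of_int (round (x / pi)) * pi\<bar> / 2"
proof -
  define k where "k = round (x / pi)"
  have "\<bar>of_int k - x / pi\<bar> \<le> 1/2" unfolding k_def by (rule of_int_round_abs_le)
  hence "\<bar>of_int k - x / pi\<bar> * pi \<le> 1/2 * pi" by (intro mult_right_mono) auto
  hence "\<bar>(of_int k - x / pi) * pi\<bar> \<le> pi / 2" by (simp add: abs_mult)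
  hence le: "\<bar>x - of_int k * pi\<bar> \<le> pi / 2" by (simp add: algebra_simps abs_minus_commute)
  have s0: "sin (of_int k * pi) = 0" by (simp add: sin_zero_iff_int2)
  hence "\<bar>cos (of_int k * pi)\<bar> = 1" using sin_cos_squared_add[of "of_int k * pi"] by (simp add: abs_square_eq_1)
  hence "\<bar>sin (x - of_int k * pi)\<bar> = \<bar>sin x\<bar>"
    using s0 by (simp add: sin_diff abs_mult)
  thus ?thesis using abs_sin_ge_half[OF le] by (simp add: k_def)
qed

text \<open>The antiderivative is continuous across the singularity \<beta>, so the fundamental
  theorem of calculus with one exceptional point applies wherever \<beta> lies.\<close>

lemma has_integral_inverse_sqrt_abs:
  assumes "a \<le> b"
  shows   "((\<lambda>t. 1 / sqrt \<bar>t - \<beta>\<bar>) has_integral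
             (2 * sgn (b - \<beta>) * sqrt \<bar>b - \<beta>\<bar> - 2 * sgn (a - \<beta>) * sqrt \<bar>a - \<beta>\<bar>)) {a..b}"
proof (rule fundamental_theorem_of_calculus_strong[where S = "{\<beta>}"])
  fix x assume "x \<in> {a..b} - {\<beta>}"
  hence "x < \<beta> \<or> x > \<beta>" by auto
  thus "((\<lambda>x. 2 * sgn (x - \<beta>) * sqrt \<bar>x - \<beta>\<bar>) has_vector_derivative 1 / sqrt \<bar>x - \<beta>\<bar>) (at x)"
  proof
    assume x: "x < \<beta>"
    have "((\<lambda>x. - 2 * sqrt (\<beta> - x)) has_vector_derivative 1 / sqrt \<bar>x - \<beta>\<bar>) (at x)"
      using x by (auto intro!: derivative_eq_intros
          simp: has_real_derivative_iff_has_vector_derivative [symmetric] field_simps)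
    thus ?thesis
      by (rule has_vector_derivative_transform_within_open[where S = "{..<\<beta>}"]) (use x in auto)
  next
    assume x: "x > \<beta>"
    have "((\<lambda>x. 2 * sqrt (x - \<beta>)) has_vector_derivative 1 / sqrt \<bar>x - \<beta>\<bar>) (at x)"
      using x by (auto intro!: derivative_eq_intros
          simp: has_real_derivative_iff_has_vector_derivative [symmetric] field_simps)
    thus ?thesis
      by (rule has_vector_derivative_transform_within_open[where S = "{\<beta><..}"]) (use x in auto)
  qed
next
  have eq: "sgn (x - \<beta>) * sqrt \<bar>x - \<beta>\<bar> = sqrt (max 0 (x - \<beta>)) - sqrt (max 0 (\<beta> - x))" for x
    by (auto simp: sgn_if max_def)
  show "continuous_on {a..b} (\<lambda>x. 2 * sgn (x - \<beta>) * sqrt \<bar>x - \<beta>\<bar>)"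
    unfolding mult.assoc eq by (intro continuous_intros)
qed (use assms in auto)

text \<open>The distance from a point of the circle to a is at least its distance r |sin (t -
  \<alpha>)| to the line through 0 and a. This bound does not see how close a is to the circle, and
  its inverse square root is integrable.\<close>

lemma cmean_inverse_sqrt_dist_le:
  assumes r: "r > 0" and a: "cmod a \<noteq> r"
  shows   "cmean r (\<lambda>z. 1 / sqrt (cmod (z - a))) \<le> 80 / sqrt r"
proof -
  define \<alpha> where "\<alpha> = Arg a"
  have \<alpha>: "-pi < \<alpha>" "\<alpha> \<le> pi" using Arg_bounded[of a] by (auto simp: \<alpha>_def)
  have a_eq: "a = rcis (cmod a) \<alpha>" by (simp add: \<alpha>_def rcis_cmod_Arg)
  define \<beta> where "\<beta> k = \<alpha> + of_int k * pi" for k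
  \<comment> \<open>t - \<alpha> lies between -pi and 3 pi, so the zero of the sine nearest to t is
    some \<beta> k with k from -1 to 3.\<close>
  define g where "g t = (\<Sum>k\<in>{-1..3}. 1 / sqrt \<bar>t - \<beta> k\<bar>)" for t
  define S where "S = \<beta> ` {-1..3}"
  define u where "u t = 1 / sqrt (cmod (rcis r t - a))" for t
  have ne: "rcis r t \<noteq> a" for t using a r by auto
  have Ik: "((\<lambda>t. 1 / sqrt \<bar>t - \<beta> k\<bar>) has_integral
             (2 * sgn (2*pi - \<beta> k) * sqrt \<bar>2*pi - \<beta> k\<bar> - 2 * sgn (0 - \<beta> k) * sqrt \<bar>0 - \<beta> k\<bar>)) {0..2*pi}" for k
    by (rule has_integral_inverse_sqrt_abs) auto
  have le16: "2 * sgn (2*pi - \<beta> k) * sqrt \<bar>2*pi - \<beta> k\<bar> - 2 * sgn (0 - \<beta> k) * sqrt \<bar>0 - \<beta> k\<bar> \<le> 16"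
    if k: "k \<in> {-1..3}" for k
  proof -
    have "-1 * pi \<le> real_of_int k * pi" "real_of_int k * pi \<le> 3 * pi"
      using k by (intro mult_right_mono; simp)+
    hence "\<bar>2*pi - \<beta> k\<bar> \<le> 4 * pi" "\<bar>0 - \<beta> k\<bar> \<le> 4 * pi"
      using \<alpha> unfolding \<beta>_def by linarith+
    hence le: "\<bar>2*pi - \<beta> k\<bar> \<le> 4\<^sup>2" "\<bar>0 - \<beta> k\<bar> \<le> 4\<^sup>2"
      using pi_less_4 by auto
    have s4: "sqrt (4\<^sup>2) = (4::real)" by (rule real_sqrt_unique) auto
    have s: "sqrt \<bar>2*pi - \<beta> k\<bar> \<le> 4" "sqrt \<bar>0 - \<beta> k\<bar> \<le> 4"
      using real_sqrt_le_mono[OF le(1)] real_sqrt_le_mono[OF le(2)] unfolding s4 .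
    have e: "2 * sgn y * sqrt \<bar>y\<bar> \<le> 2 * sqrt \<bar>y\<bar>" "- (2 * sgn y * sqrt \<bar>y\<bar>) \<le> 2 * sqrt \<bar>y\<bar>" for y :: real
    proof -
      have "sgn y * sqrt \<bar>y\<bar> \<le> 1 * sqrt \<bar>y\<bar>" "- 1 * sqrt \<bar>y\<bar> \<le> sgn y * sqrt \<bar>y\<bar>"
        by (rule mult_right_mono; simp add: sgn_if)+
      thus "2 * sgn y * sqrt \<bar>y\<bar> \<le> 2 * sqrt \<bar>y\<bar>" "- (2 * sgn y * sqrt \<bar>y\<bar>) \<le> 2 * sqrt \<bar>y\<bar>"
        by linarith+
    qed
    show ?thesis
      using e(1)[of "2*pi - \<beta> k"] e(2)[of "0 - \<beta> k"] s by linarith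
  qed
  have g: "(g has_integral (\<Sum>k\<in>{-1..3}. (2 * sgn (2*pi - \<beta> k) * sqrt \<bar>2*pi - \<beta> k\<bar> - 2 * sgn (0 - \<beta> k) * sqrt \<bar>0 - \<beta> k\<bar>))) {0..2*pi}"
    (is "(_ has_integral ?I) _")
    unfolding g_def by (intro has_integral_sum Ik) auto
  \<comment> \<open>Five integrals, each at most 2 * 4 + 2 * 4, since the distances involved are at
    most 4 pi <= 16.\<close>
  have I: "?I \<le> 80"
    using sum_mono[of "{-1..3::int}" _ "\<lambda>_. 16::real", OF le16] by simp
  have "((\<lambda>t. 2 / sqrt r * g t) has_integral (2 / sqrt r * ?I)) {0..2*pi}"
    using g by (rule has_integral_mult_right)
  \<comment> \<open>At the points of S a summand of g is 1 / 0 = 0, so g need not be a majorant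
    there; the finitely many values are replaced by those of u.\<close>
  hence g': "((\<lambda>t. if t \<in> S then u t else 2 / sqrt r * g t) has_integral (2 / sqrt r * ?I)) {0..2*pi}"
    by (rule has_integral_spike_finite[where S = S, rotated 2]) (auto simp: S_def)
  have u: "u integrable_on {0..2*pi}"
    unfolding u_def using ne
    by (intro integrable_continuous_interval continuous_intros) (auto simp: rcis_def intro!: continuous_intros)
  have "integral {0..2*pi} u \<le> 2 / sqrt r * ?I"
  proof (rule has_integral_le[OF integrable_integral[OF u] g'])
    fix t :: real assume t: "t \<in> {0..2*pi}"
    show "u t \<le> (if t \<in> S then u t else 2 / sqrt r * g t)"
    proof (cases "t \<in> S")
      case False
      define k where "k = round ((t - \<alpha>) / pi)"
      have "(t - \<alpha>) / pi \<ge> -1" "(t - \<alpha>) / pi < 3"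
        using t \<alpha> by (auto simp: field_simps)
      moreover have "round (-1::real) = -1" using round_of_int[of "-1", where 'a = real] by simp
      ultimately have k: "k \<in> {-1..3}"
        using round_mono[of "-1" "(t - \<alpha>) / pi"] round_mono[of "(t - \<alpha>) / pi" 3] by (simp add: k_def)
      have nz: "\<bar>t - \<beta> k\<bar> > 0" using False k by (auto simp: S_def)
      have "cis (-\<alpha>) * rcis (cmod a) \<alpha> = of_real (cmod a)"
        unfolding rcis_def by (subst mult.left_commute) (simp add: cis_mult)
      moreover have "cis (-\<alpha>) * rcis r t = rcis r (t - \<alpha>)"
        unfolding rcis_def by (subst mult.left_commute) (simp add: cis_mult)
      ultimately have "cis (-\<alpha>) * (rcis r t - a) = rcis r (t - \<alpha>) - of_real (cmod a)"
        using a_eq by (simp add: right_diff_distrib)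
      hence "\<bar>Im (cis (-\<alpha>) * (rcis r t - a))\<bar> = r * \<bar>sin (t - \<alpha>)\<bar>"
        using r by (simp add: abs_mult)
      moreover have "\<bar>Im (cis (-\<alpha>) * (rcis r t - a))\<bar> \<le> cmod (cis (-\<alpha>) * (rcis r t - a))"
        by (rule abs_Im_le_cmod)
      moreover have "cmod (cis (-\<alpha>) * (rcis r t - a)) = cmod (rcis r t - a)"
        by (simp add: norm_mult)
      ultimately have "r * \<bar>sin (t - \<alpha>)\<bar> \<le> cmod (rcis r t - a)" by simp
      moreover have "\<bar>sin (t - \<alpha>)\<bar> \<ge> \<bar>t - \<beta> k\<bar> / 2"
        using abs_sin_ge_dist[of "t - \<alpha>"] by (simp add: k_def \<beta>_def algebra_simps)
      hence "r * (\<bar>t - \<beta> k\<bar> / 2) \<le> r * \<bar>sin (t - \<alpha>)\<bar>" using r by (intro mult_left_mono) auto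
      moreover have "0 \<le> r * \<bar>t - \<beta> k\<bar>" using r by simp
      ultimately have "r * \<bar>t - \<beta> k\<bar> / 4 \<le> cmod (rcis r t - a)" by linarith
      hence "sqrt (r * \<bar>t - \<beta> k\<bar> / 4) \<le> sqrt (cmod (rcis r t - a))" by (rule real_sqrt_le_mono)
      hence "sqrt r * sqrt \<bar>t - \<beta> k\<bar> / 2 \<le> sqrt (cmod (rcis r t - a))"
        by (simp add: real_sqrt_divide real_sqrt_mult)
      hence "u t \<le> 1 / (sqrt r * sqrt \<bar>t - \<beta> k\<bar> / 2)"
        unfolding u_def using r nz by (intro divide_left_mono mult_pos_pos) (auto simp: ne)
      also have "\<dots> = 2 / sqrt r * (1 / sqrt \<bar>t - \<beta> k\<bar>)" by simp
      also have "\<dots> \<le> 2 / sqrt r * g t"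
        unfolding g_def using k r by (intro mult_left_mono member_le_sum) auto
      finally show ?thesis using False by simp
    qed auto
  qed
  also have "\<dots> \<le> 2 / sqrt r * 80" using r I by (intro mult_left_mono) auto
  finally have "cmean r (\<lambda>z. 1 / sqrt (cmod (z - a))) \<le> (2 / sqrt r * 80) / (2 * pi)"
    unfolding cmean_def u_def by (intro divide_right_mono) auto
  also have "\<dots> \<le> (2 / sqrt r * 80) / 2"
    using r pi_gt3 by (intro divide_left_mono) auto
  finally show ?thesis by simp
qed

section \<open>Logarithmic derivatives\<close>

lemma reg_eventually_nhds:
  assumes "reg h z"
  shows   "\<forall>\<^sub>F w in nhds z. reg h w"
proof -
  obtain S where S: "open S" "z \<in> S" "h holomorphic_on S"
    using assms by (auto simp: reg_def analytic_at)
  have "isCont h z"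
    using S by (meson continuous_on_eq_continuous_at holomorphic_on_imp_continuous_on)
  hence "(h \<longlongrightarrow> h z) (nhds z)"
    unfolding isCont_def tendsto_nhds_iff by simp
  hence "\<forall>\<^sub>F w in nhds z. h w \<noteq> 0"
    by (rule tendsto_imp_eventually_ne) (use assms in \<open>auto simp: reg_def\<close>)
  moreover have "\<forall>\<^sub>F w in nhds z. w \<in> S"
    using S by (intro eventually_nhds_in_open)
  ultimately show ?thesis
    by eventually_elim (use S in \<open>auto simp: reg_def analytic_at\<close>)
qed

lemma DERIV_prod_linear_powi:
  assumes "z \<notin> A"
  shows   "((\<lambda>w. \<Prod>a\<in>A. (w - a) powi m a) has_field_derivative
              (\<Prod>a\<in>A. (z - a) powi m a) * (\<Sum>a\<in>A. of_int (m a) / (z - a))) (at z)"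
proof -
  have "((\<lambda>w. \<Prod>a\<in>A. (w - a) powi m a) has_field_derivative
          (\<Prod>a\<in>A. (z - a) powi m a) *
          (\<Sum>a\<in>A. of_int (m a) * (z - a) powi (m a - 1) / (z - a) powi m a)) (at z)"
    by (rule has_field_derivative_prod')
       (use assms in \<open>auto intro!: derivative_eq_intros\<close>)
  also have "(\<Sum>a\<in>A. of_int (m a) * (z - a) powi (m a - 1) / (z - a) powi m a) =
             (\<Sum>a\<in>A. of_int (m a) / (z - a))"
  proof (intro sum.cong refl)
    fix a assume "a \<in> A"
    hence "z - a \<noteq> 0" using assms by auto
    thus "of_int (m a) * (z - a) powi (m a - 1) / (z - a) powi m a = of_int (m a) / (z - a)"
      by (simp add: power_int_diff)
  qed
  finally show ?thesis .
qed

text \<open>For H = P exp G with logarithmic derivative L one has H' = H L and H'' = H (L^2 + L');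
  the sum of inverse squares comes from L'.\<close>

lemma logarithmic_derivatives_of_factorization:
  assumes A: "finite A" "z \<notin> A" and G: "G holomorphic_on S" "open S" "z \<in> S"
  assumes eq: "\<forall>\<^sub>F w in nhds z. h w = (\<Prod>a\<in>A. (w - a) powi m a) * exp (G w)"
  defines "el \<equiv> (\<Sum>a\<in>A. of_int (m a) / (z - a)) + deriv G z"
  shows   "deriv h z = h z * el"
    and   "deriv (deriv h) z = h z * (el\<^sup>2 + deriv (deriv G) z - (\<Sum>a\<in>A. of_int (m a) / (z - a)\<^sup>2))"
proof -
  define L where "L w = (\<Sum>a\<in>A. of_int (m a) / (w - a)) + deriv G w" for w
  define H where "H w = (\<Prod>a\<in>A. (w - a) powi m a) * exp (G w)" for w
  have H': "(H has_field_derivative H w * L w) (at w)" if "w \<in> S - A" for w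
  proof -
    have Gd: "(G has_field_derivative deriv G w) (at w)"
      using G that by (auto intro: holomorphic_derivI)
    have Pd: "((\<lambda>w. \<Prod>a\<in>A. (w - a) powi m a) has_field_derivative
              (\<Prod>a\<in>A. (w - a) powi m a) * (\<Sum>a\<in>A. of_int (m a) / (w - a))) (at w)"
      by (rule DERIV_prod_linear_powi) (use that in auto)
    show ?thesis unfolding H_def L_def
      by (rule derivative_eq_intros Pd Gd refl)+ (simp add: algebra_simps)
  qed
  have op: "open (S - A)" "z \<in> S - A"
    using G A by (auto intro: open_Diff finite_imp_closed)
  have evS: "\<forall>\<^sub>F w in nhds z. w \<in> S - A" using op by (intro eventually_nhds_in_open)
  have "\<forall>\<^sub>F w in nhds z. \<forall>\<^sub>F v in nhds w. h v = H v"
    using eq unfolding H_def [symmetric] by (simp add: eventually_eventually)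
  hence "\<forall>\<^sub>F w in nhds z. deriv h w = deriv H w"
    by eventually_elim (auto intro: deriv_cong_ev)
  hence d1: "\<forall>\<^sub>F w in nhds z. deriv h w = H w * L w"
    using evS by eventually_elim (use H' in \<open>auto dest: DERIV_imp_deriv\<close>)
  have hz: "h z = H z" using eq unfolding H_def [symmetric] by (rule eventually_nhds_x_imp_x)
  show "deriv h z = h z * el"
    using eventually_nhds_x_imp_x[OF d1] by (simp add: hz el_def L_def)
  have Gd: "(deriv G has_field_derivative deriv (deriv G) z) (at z)"
    using G by (intro holomorphic_derivI[of _ S] holomorphic_deriv) auto
  have "((\<lambda>w. \<Sum>a\<in>A. of_int (m a) / (w - a)) has_field_derivative
           (\<Sum>a\<in>A. - of_int (m a) / (z - a)\<^sup>2)) (at z)"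
    using A by (intro DERIV_sum) (auto intro!: derivative_eq_intros simp: power2_eq_square)
  hence L': "(L has_field_derivative ((\<Sum>a\<in>A. - of_int (m a) / (z - a)\<^sup>2) + deriv (deriv G) z)) (at z)"
    unfolding L_def by (intro DERIV_add Gd)
  have "deriv (deriv h) z = deriv (\<lambda>w. H w * L w) z"
    by (rule deriv_cong_ev[OF d1 refl])
  also have "\<dots> = H z * L z * L z + ((\<Sum>a\<in>A. - of_int (m a) / (z - a)\<^sup>2) + deriv (deriv G) z) * H z"
    by (rule DERIV_imp_deriv) (intro DERIV_mult H' L' op)
  finally show "deriv (deriv h) z = h z * (el\<^sup>2 + deriv (deriv G) z - (\<Sum>a\<in>A. of_int (m a) / (z - a)\<^sup>2))"
    by (simp add: hz el_def L_def sum_negf power2_eq_square algebra_simps)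
qed

lemma sum_squares_le_square_sum:
  fixes x :: "'a \<Rightarrow> real"
  assumes "finite A" "\<And>a. a \<in> A \<Longrightarrow> x a \<ge> 0"
  shows   "(\<Sum>a\<in>A. (x a)\<^sup>2) \<le> (\<Sum>a\<in>A. x a)\<^sup>2"
proof -
  have "(\<Sum>a\<in>A. (x a)\<^sup>2) \<le> (\<Sum>a\<in>A. x a * (\<Sum>b\<in>A. x b))"
    unfolding power2_eq_square
    using assms by (intro sum_mono mult_left_mono member_le_sum) auto
  thus ?thesis by (simp add: sum_distrib_right power2_eq_square)
qed

lemma sqrt_sum_le:
  assumes "finite A" "\<And>a. a \<in> A \<Longrightarrow> x a \<ge> 0"
  shows   "sqrt (\<Sum>a\<in>A. x a) \<le> (\<Sum>a\<in>A. sqrt (x a))"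
  using assms
proof (induction A rule: finite_induct)
  case (insert a A)
  have "sqrt (\<Sum>a\<in>insert a A. x a) \<le> sqrt (x a) + sqrt (\<Sum>a\<in>A. x a)"
    using insert by (auto intro!: sqrt_add_le_add_sqrt sum_nonneg)
  also have "sqrt (\<Sum>a\<in>A. x a) \<le> (\<Sum>a\<in>A. sqrt (x a))" using insert by auto
  finally show ?case using insert by simp
qed auto

text \<open>The concavity of the logarithm enters through its tangent at the mean.\<close>
lemma cmean_ln_le:
  assumes "continuous_on (sphere 0 r) u" "r \<ge> 0" "\<And>z. cmod z = r \<Longrightarrow> u z > 0"
    and "cmean r u \<le> M" "M > 0"
  shows   "cmean r (\<lambda>z. ln (u z)) \<le> ln M"
proof -
  have "cmean r (\<lambda>z. ln (u z)) \<le> cmean r (\<lambda>z. 1 / M * u z + (ln M - 1))"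
  proof (intro cmean_mono)
    fix z assume "cmod z = r"
    hence u: "u z > 0" using assms by auto
    have "ln (u z / M) \<le> u z / M - 1" using u assms by (intro ln_le_minus_one) auto
    thus "ln (u z) \<le> 1 / M * u z + (ln M - 1)" using u assms by (simp add: ln_div)
  next
    show "continuous_on (sphere 0 r) (\<lambda>z. ln (u z))"
      using assms by (intro continuous_on_ln) force+
    show "continuous_on (sphere 0 r) (\<lambda>z. 1 / M * u z + (ln M - 1))"
      using assms by (intro continuous_intros)
  qed (use assms in auto)
  also have "\<dots> = 1 / M * cmean r u + (ln M - 1)"
    using assms by (subst cmean_add) (auto simp: cmean_cmul[of _ "1/M", simplified] intro!: continuous_intros)
  also have "1 / M * cmean r u \<le> 1" using assms by (simp add: field_simps)
  finally show ?thesis by simp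
qed

text \<open>The terms m/(z - a) of a logarithmic derivative become large when a is close to the
  circle. As only logarithms matter, a square root is taken: 1/sqrt|z - a| has a mean bounded
  uniformly in a. With U = sqrt (1 + s + 48M), where s is the sum of all |m|/|z - a|, both quotients
  are at most 3 U^4, and the concavity of the logarithm reduces the claim to the mean of U.\<close>

lemma log_derivative_estimate_explicit:
  assumes h: "nzmero h" and r: "r \<ge> 1" "2 * r \<le> R" "R \<le> 3 * r" "2 * R \<le> R2"
    and good: "\<And>z. cmod z = r \<Longrightarrow> reg h z" "\<And>z. cmod z = R \<Longrightarrow> reg h z" "\<And>z. cmod z = R2 \<Longrightarrow> reg h z"
    and B: "nchar R h \<le> B" "nchar R2 h \<le> B" "\<bar>jensen_const h\<bar> \<le> B" "B \<ge> 1"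
  shows "prox r (\<lambda>z. deriv h z / h z) \<le> ln 3 + 4 * ln (5000 * B * r)"
    and "prox r (\<lambda>z. deriv (deriv h) z / h z) \<le> ln 3 + 4 * ln (5000 * B * r)"
proof -
  define A where "A = {a. cmod a < R \<and> zorder h a \<noteq> 0}"
  define m where "m = zorder h"
  define N where "N = (\<Sum>a\<in>A. \<bar>real_of_int (m a)\<bar>)"
  have fin: "finite A" unfolding A_def by (rule finite_zorder_support[OF h])
  have R: "R \<ge> 1" using r by simp
  obtain G R' where R': "R' > R" and G: "G holomorphic_on ball 0 R'" and
    eq: "\<And>z. cmod z \<le> R \<Longrightarrow> reg h z \<Longrightarrow> h z = (\<Prod>a\<in>A. (z - a) powi m a) * exp (G z)" and
    N_le: "N \<le> 4 * nchar R2 h + 2 * \<bar>jensen_const h\<bar>" and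
    M_le: "cmean R (\<lambda>z. \<bar>Re (G z)\<bar>) \<le> 2 * nchar R h + \<bar>jensen_const h\<bar> + N * (2 * ln (2 * R))"
    using quantitative_factorization[OF h R r(4) good(2,3)] unfolding A_def m_def N_def by blast
  define M where "M = cmean R (\<lambda>z. \<bar>Re (G z)\<bar>)"
  have N: "0 \<le> N" "N \<le> 6 * B" using N_le B by (auto simp: N_def intro: sum_nonneg)
  \<comment> \<open>With ln (2R) <= 2R <= 6r this is 72 B r; together with 2B + B it makes 75 B
    r.\<close>
  have "N * (2 * ln (2 * R)) \<le> (6 * B) * (2 * (6 * r))"
    using N r B ln_le_minus_one[of "2 * R"] by (intro mult_mono) auto
  moreover have "3 * B \<le> 3 * B * r" using B r by simp
  ultimately have M: "M \<le> 75 * B * r" using M_le B unfolding M_def by linarith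
  have M0: "M \<ge> 0"
    unfolding M_def using R R'
    by (intro cmean_nonneg continuous_on_rabs continuous_on_Re holomorphic_on_imp_continuous_on
          holomorphic_on_subset[OF G]) auto
  have G1: "cmod (deriv G z) \<le> 12 * M" if "cmod z = r" for z
  proof -
    have "cmod (deriv G z) \<le> 6 * M / (R / 4)"
      using holomorphic_deriv_bound_by_Re_mean[OF G _ R', of z 0] R r that by (simp add: M_def)
    also have "\<dots> \<le> 6 * M / (1 / 2)"
      using M0 r by (intro divide_left_mono) auto
    finally show ?thesis by simp
  qed
  have G2: "cmod (deriv (deriv G) z) \<le> 48 * M" if "cmod z = r" for z
  proof -
    have "cmod (deriv (deriv G) z) \<le> 2 * (6 * M) / (R / 4) ^ 2"
      using holomorphic_deriv_bound_by_Re_mean[OF G _ R', of z 1] R r that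
      by (simp add: M_def fact_numeral numeral_2_eq_2 del: power_divide)
    also have "\<dots> \<le> 2 * (6 * M) / (1 / 2) ^ 2"
      using M0 r by (intro divide_left_mono power_mono mult_pos_pos) auto
    finally show ?thesis by (simp add: power2_eq_square)
  qed
  have nA: "z \<notin> A" if "cmod z = r" for z
    using zorder_reg[OF good(1)[OF that]] by (auto simp: A_def)
  define s where "s z = (\<Sum>a\<in>A. \<bar>real_of_int (m a)\<bar> / cmod (z - a))" for z
  define U where "U z = sqrt (1 + s z + 48 * M)" for z
  have s0: "s z \<ge> 0" for z by (auto simp: s_def intro: sum_nonneg)
  have U0: "U z \<ge> 1" for z using s0[of z] M0 by (simp add: U_def)
  have scont: "continuous_on (sphere 0 r) s"
    unfolding s_def using nA by (intro continuous_intros) auto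
  hence Ucont: "continuous_on (sphere 0 r) U"
    unfolding U_def by (intro continuous_intros)
  have icont: "continuous_on (sphere 0 r) (\<lambda>z. 1 / sqrt (cmod (z - a)))" if "a \<in> A" for a
    using nA that by (intro continuous_intros) auto
  have "cmean r U \<le> cmean r (\<lambda>z. (1 + 48 * M) + (\<Sum>a\<in>A. \<bar>real_of_int (m a)\<bar> * (1 / sqrt (cmod (z - a)))))"
  proof (intro cmean_mono Ucont continuous_on_add continuous_on_sum continuous_on_mult continuous_on_const icont)
    fix z assume z: "cmod z = r"
    have "U z \<le> sqrt (1 + 48 * M) + sqrt (s z)"
      using sqrt_add_le_add_sqrt[of "1 + 48 * M" "s z"] M0 s0[of z] by (simp add: U_def add_ac)
    also have "sqrt (1 + 48 * M) \<le> 1 + 48 * M"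
    proof (rule real_le_lsqrt)
      show "1 + 48 * M \<le> (1 + 48 * M)\<^sup>2" using M0 by (intro self_le_power) auto
    qed (use M0 in auto)
    also have "sqrt (s z) \<le> (\<Sum>a\<in>A. sqrt (\<bar>real_of_int (m a)\<bar> / cmod (z - a)))"
      unfolding s_def by (rule sqrt_sum_le) (use fin in auto)
    also have "\<dots> \<le> (\<Sum>a\<in>A. \<bar>real_of_int (m a)\<bar> * (1 / sqrt (cmod (z - a))))"
    proof (intro sum_mono)
      fix a assume a: "a \<in> A"
      hence "\<bar>m a\<bar> \<ge> 1" by (auto simp: A_def m_def)
      hence "\<bar>real_of_int (m a)\<bar> \<ge> 1" by linarith
      hence "sqrt \<bar>real_of_int (m a)\<bar> \<le> \<bar>real_of_int (m a)\<bar>"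
        by (intro real_le_lsqrt self_le_power) auto
      hence "sqrt \<bar>real_of_int (m a)\<bar> * (1 / sqrt (cmod (z - a))) \<le> \<bar>real_of_int (m a)\<bar> * (1 / sqrt (cmod (z - a)))"
        by (intro mult_right_mono) auto
      thus "sqrt (\<bar>real_of_int (m a)\<bar> / cmod (z - a)) \<le> \<bar>real_of_int (m a)\<bar> * (1 / sqrt (cmod (z - a)))"
        by (simp add: real_sqrt_divide)
    qed
    finally show "U z \<le> (1 + 48 * M) + (\<Sum>a\<in>A. \<bar>real_of_int (m a)\<bar> * (1 / sqrt (cmod (z - a))))" by simp
  qed (use r in auto)
  also have "\<dots> = (1 + 48 * M) + (\<Sum>a\<in>A. \<bar>real_of_int (m a)\<bar> * cmean r (\<lambda>z. 1 / sqrt (cmod (z - a))))"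
  proof -
    have "cmean r (\<lambda>z. \<Sum>a\<in>A. \<bar>real_of_int (m a)\<bar> * (1 / sqrt (cmod (z - a)))) =
          (\<Sum>a\<in>A. \<bar>real_of_int (m a)\<bar> * cmean r (\<lambda>z. 1 / sqrt (cmod (z - a))))"
      unfolding cmean_cmul[symmetric] using r
      by (intro cmean_sum continuous_on_mult continuous_on_const icont) auto
    moreover have "continuous_on (sphere 0 r) (\<lambda>z. \<Sum>a\<in>A. \<bar>real_of_int (m a)\<bar> * (1 / sqrt (cmod (z - a))))"
      by (intro continuous_on_sum continuous_on_mult continuous_on_const icont)
    ultimately show ?thesis using r by (subst cmean_add) (auto simp del: times_divide_eq_right)
  qed
  also have "\<dots> \<le> (1 + 48 * M) + (\<Sum>a\<in>A. \<bar>real_of_int (m a)\<bar> * 80)"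
  proof (intro add_left_mono sum_mono mult_left_mono)
    fix a assume "a \<in> A"
    hence "cmean r (\<lambda>z. 1 / sqrt (cmod (z - a))) \<le> 80 / sqrt r"
      using nA[of a] r by (intro cmean_inverse_sqrt_dist_le) auto
    also have "\<dots> \<le> 80" using r by (simp add: field_simps)
    finally show "cmean r (\<lambda>z. 1 / sqrt (cmod (z - a))) \<le> 80" .
  qed auto
  also have "\<dots> = 1 + 48 * M + 80 * N" by (simp add: N_def sum_distrib_right mult.commute)
  \<comment> \<open>1 + 48 * 75 + 80 * 6 = 4081, rounded up.\<close>
  also have "\<dots> \<le> 5000 * B * r"
  proof -
    have "1 * 1 \<le> B * r" using B r by (intro mult_mono) auto
    moreover have "B \<le> B * r" using B r by simp
    ultimately show ?thesis using M N by simp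
  qed
  finally have Umean: "cmean r U \<le> 5000 * B * r" .
  have Br: "5000 * B * r > 0" using B r by simp
  have lnU: "cmean r (\<lambda>z. ln 3 + 4 * ln (U z)) \<le> ln 3 + 4 * ln (5000 * B * r)"
  proof -
    have "cmean r (\<lambda>z. ln (U z)) \<le> ln (5000 * B * r)"
      using Ucont r U0 Umean Br by (intro cmean_ln_le) (auto intro: less_le_trans[OF _ U0])
    moreover have "continuous_on (sphere 0 r) (\<lambda>z. ln (U z))"
    proof (intro continuous_on_ln Ucont ballI)
      show "U z \<noteq> 0" for z using U0[of z] by linarith
    qed
    hence "cmean r (\<lambda>z. ln 3 + 4 * ln (U z)) = ln 3 + 4 * cmean r (\<lambda>z. ln (U z))"
      using r by (subst cmean_add) (auto simp: cmean_cmul intro!: continuous_intros)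
    ultimately show ?thesis by simp
  qed
  \<comment> \<open>The logarithmic derivative is at most U^2. The second quotient consists of its
    square, G'' and the sum of inverse squares, each at most U^4.\<close>
  have bound: "cmod (deriv h z / h z) \<le> 3 * U z ^ 4" "cmod (deriv (deriv h) z / h z) \<le> 3 * U z ^ 4"
    if z: "cmod z = r" for z
  proof -
    have regz: "reg h z" by (rule good(1)[OF z])
    hence hz: "h z \<noteq> 0" by (simp add: reg_def)
    have "\<forall>\<^sub>F w in nhds z. w \<in> ball 0 R" using z r by (intro eventually_nhds_in_open) auto
    hence ev: "\<forall>\<^sub>F w in nhds z. h w = (\<Prod>a\<in>A. (w - a) powi m a) * exp (G w)"
      using reg_eventually_nhds[OF regz] by eventually_elim (intro eq, auto)
    define el where "el = (\<Sum>a\<in>A. of_int (m a) / (z - a)) + deriv G z"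
    have zS: "z \<in> ball 0 R'" using z r R' by auto
    note d = logarithmic_derivatives_of_factorization[OF fin nA[OF z] G open_ball zS ev, folded el_def]
    have "cmod el \<le> cmod (\<Sum>a\<in>A. of_int (m a) / (z - a)) + cmod (deriv G z)"
      unfolding el_def by (rule norm_triangle_ineq)
    also have "cmod (\<Sum>a\<in>A. of_int (m a) / (z - a)) \<le> s z"
      unfolding s_def by (rule order.trans[OF norm_sum]) (simp add: norm_divide)
    also have "cmod (deriv G z) \<le> 48 * M" using G1[OF z] M0 by simp
    finally have l: "cmod el \<le> U z ^ 2" using s0[of z] M0 by (simp add: U_def)
    have U24: "U z ^ 2 \<le> U z ^ 4" using U0[of z] by (intro power_increasing) auto
    show "cmod (deriv h z / h z) \<le> 3 * U z ^ 4"
    proof -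
      have "0 \<le> U z ^ 4" by (simp add: U_def)
      hence "cmod el \<le> 3 * U z ^ 4" using l U24 by linarith
      thus ?thesis using d(1) hz by simp
    qed
    have "cmod (\<Sum>a\<in>A. of_int (m a) / (z - a)\<^sup>2) \<le> (\<Sum>a\<in>A. (\<bar>real_of_int (m a)\<bar> / cmod (z - a))\<^sup>2)"
    proof (rule order.trans[OF norm_sum], rule sum_mono)
      fix a assume a: "a \<in> A"
      hence "\<bar>m a\<bar> \<ge> 1" by (auto simp: A_def m_def)
      hence "\<bar>real_of_int (m a)\<bar> \<ge> 1" by linarith
      hence "\<bar>real_of_int (m a)\<bar> \<le> \<bar>real_of_int (m a)\<bar> ^ 2" by (intro self_le_power) auto
      hence "\<bar>real_of_int (m a)\<bar> / cmod (z - a) ^ 2 \<le> \<bar>real_of_int (m a)\<bar> ^ 2 / cmod (z - a) ^ 2"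
        by (intro divide_right_mono) auto
      thus "cmod (of_int (m a) / (z - a)\<^sup>2) \<le> (\<bar>real_of_int (m a)\<bar> / cmod (z - a))\<^sup>2"
        by (simp add: norm_divide norm_power power_divide)
    qed
    also have "\<dots> \<le> (s z)\<^sup>2"
      unfolding s_def by (rule sum_squares_le_square_sum) (use fin in auto)
    also have "\<dots> \<le> (U z ^ 2)\<^sup>2" using s0[of z] M0 by (intro power_mono) (auto simp: U_def)
    finally have q: "cmod (\<Sum>a\<in>A. of_int (m a) / (z - a)\<^sup>2) \<le> U z ^ 4" by simp
    have "cmod (deriv (deriv G) z) \<le> U z ^ 2" using G2[OF z] s0[of z] M0 by (simp add: U_def)
    hence g: "cmod (deriv (deriv G) z) \<le> U z ^ 4" using U24 by simp
    have "cmod (el\<^sup>2) \<le> (U z ^ 2)\<^sup>2" unfolding norm_power using l by (intro power_mono) auto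
    hence l2: "cmod (el\<^sup>2) \<le> U z ^ 4" by simp
    have "deriv (deriv h) z / h z = el\<^sup>2 + deriv (deriv G) z - (\<Sum>a\<in>A. of_int (m a) / (z - a)\<^sup>2)"
      using d(2) hz by simp
    also have "cmod \<dots> \<le> cmod (el\<^sup>2 + deriv (deriv G) z) + cmod (\<Sum>a\<in>A. of_int (m a) / (z - a)\<^sup>2)"
      by (rule norm_triangle_ineq4)
    also have "\<dots> \<le> 3 * U z ^ 4"
      using norm_triangle_ineq[of "el\<^sup>2" "deriv (deriv G) z"] l2 g q by linarith
    finally show "cmod (deriv (deriv h) z / h z) \<le> 3 * U z ^ 4" .
  qed
  have lp: "log_plus x \<le> ln 3 + 4 * ln (U z)" if "x \<le> 3 * U z ^ 4" for x z
  proof -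
    have "1 \<le> U z ^ 4" using U0[of z] by simp
    hence "max 1 x \<le> 3 * U z ^ 4" using that by simp
    hence "log_plus x \<le> ln (3 * U z ^ 4)"
      unfolding log_plus_def by (intro ln_mono) auto
    also have "\<dots> = ln 3 + 4 * ln (U z)"
      using U0[of z] by (subst ln_mult_pos) (auto simp: ln_realpow)
    finally show ?thesis .
  qed
  have hd: "h analytic_on {z}" "h z \<noteq> 0" if "cmod z = r" for z
    using good(1)[OF that] by (auto simp: reg_def)
  have c1: "continuous_on (sphere 0 r) (\<lambda>z. deriv h z / h z)"
    by (rule continuous_on_reg_sphere) (auto intro!: analytic_intros analytic_deriv hd)
  have c2: "continuous_on (sphere 0 r) (\<lambda>z. deriv (deriv h) z / h z)"
    by (rule continuous_on_reg_sphere) (auto intro!: analytic_intros analytic_deriv hd)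
  have c3: "continuous_on (sphere 0 r) (\<lambda>z. ln 3 + 4 * ln (U z))"
  proof -
    have "U z \<noteq> 0" for z using U0[of z] by linarith
    thus ?thesis using Ucont by (intro continuous_intros) auto
  qed
  show "prox r (\<lambda>z. deriv h z / h z) \<le> ln 3 + 4 * ln (5000 * B * r)"
    unfolding prox_def
    by (rule order.trans[OF cmean_mono lnU]) (use r in \<open>auto intro!: continuous_intros c1 c3 lp bound\<close>)
  show "prox r (\<lambda>z. deriv (deriv h) z / h z) \<le> ln 3 + 4 * ln (5000 * B * r)"
    unfolding prox_def
    by (rule order.trans[OF cmean_mono lnU]) (use r in \<open>auto intro!: continuous_intros c2 c3 lp bound\<close>)
qed

section \<open>Growth\<close>

text \<open>A one-sided o(r^k) along almost all radii: error terms enter the estimates only from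
  above.\<close>

definition negligible :: "nat \<Rightarrow> (real \<Rightarrow> real) \<Rightarrow> bool" where
  "negligible k u \<longleftrightarrow> (\<forall>\<epsilon>>0. \<forall>\<^sub>F r in ae_at_top. u r \<le> \<epsilon> * r ^ k)"

lemma neglD: "negligible k u \<Longrightarrow> \<epsilon> > 0 \<Longrightarrow> \<forall>\<^sub>F r in ae_at_top. u r \<le> \<epsilon> * r ^ k"
  by (auto simp: negligible_def)

lemma negligible_mono:
  assumes "negligible k v" "\<forall>\<^sub>F r in ae_at_top. u r \<le> v r"
  shows   "negligible k u"
  unfolding negligible_def
proof (intro allI impI)
  fix \<epsilon> :: real assume "\<epsilon> > 0"
  from neglD[OF assms(1) this] assms(2) show "\<forall>\<^sub>F r in ae_at_top. u r \<le> \<epsilon> * r ^ k"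
    by eventually_elim auto
qed

lemma negligible_add:
  assumes "negligible k u" "negligible k v"
  shows   "negligible k (\<lambda>r. u r + v r)"
  unfolding negligible_def
proof (intro allI impI)
  fix \<epsilon> :: real assume "\<epsilon> > 0"
  hence "\<epsilon> / 2 > 0" by simp
  from neglD[OF assms(1) this] neglD[OF assms(2) this] show "\<forall>\<^sub>F r in ae_at_top. u r + v r \<le> \<epsilon> * r ^ k"
    by eventually_elim (simp add: field_simps)
qed

lemma negligible_cmul:
  assumes "negligible k u" "c \<ge> 0"
  shows   "negligible k (\<lambda>r. c * u r)"
proof (cases "c = 0")
  case False
  hence c: "c > 0" using assms by simp
  show ?thesis
    unfolding negligible_def
  proof (intro allI impI)
    fix \<epsilon> :: real assume "\<epsilon> > 0"
    hence "\<epsilon> / c > 0" using c by simp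
    from neglD[OF assms(1) this] show "\<forall>\<^sub>F r in ae_at_top. c * u r \<le> \<epsilon> * r ^ k"
      by eventually_elim (use c in \<open>simp add: field_simps\<close>)
  qed
next
  case True
  have "\<forall>\<^sub>F r in ae_at_top. (0::real) \<le> \<epsilon> * r ^ k" if "\<epsilon> > 0" for \<epsilon>
    using eventually_ae_at_top_ge[of 0] by eventually_elim (use that in auto)
  thus ?thesis using True by (auto simp: negligible_def)
qed

lemma negligible_smallo:
  assumes "u \<in> o(\<lambda>r. r ^ k)"
  shows   "negligible k u"
  unfolding negligible_def
proof (intro allI impI)
  fix \<epsilon> :: real assume "\<epsilon> > 0"
  from landau_o.smallD[OF assms this]
  have "\<forall>\<^sub>F r in ae_at_top. norm (u r) \<le> \<epsilon> * norm (r ^ k)" by (rule eventually_at_top_imp_ae_at_top)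
  thus "\<forall>\<^sub>F r in ae_at_top. u r \<le> \<epsilon> * r ^ k"
    using eventually_ae_at_top_ge[of 0] by eventually_elim (auto simp: power_abs)
qed

lemma negligible_const: "k \<ge> 1 \<Longrightarrow> negligible k (\<lambda>_. c)"
  by (rule negligible_smallo) real_asymp

lemma negligible_powr: "\<kappa> < real k \<Longrightarrow> negligible k (\<lambda>r. C * r powr \<kappa>)"
proof (rule negligible_smallo)
  assume \<kappa>: "\<kappa> < real k"
  have "(\<lambda>r. C * r powr \<kappa>) \<in> O(\<lambda>r. r powr \<kappa>)" by simp
  also have "(\<lambda>r::real. r powr \<kappa>) \<in> o(\<lambda>r. r powr real k)"
    using \<kappa> by real_asymp
  also have "(\<lambda>r::real. r powr real k) \<in> \<Theta>(\<lambda>r. r ^ k)"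
    by (intro bigthetaI_cong eventually_mono[OF eventually_gt_at_top[of 0]]) (auto simp: powr_realpow)
  finally show "(\<lambda>r. C * r powr \<kappa>) \<in> o(\<lambda>r. r ^ k)" .
qed

text \<open>R is taken from (2r, 3r) and R2 from (6r, 9r), which forces 2R <= R2. The conclusion
  holds for all large r, whether or not r itself is admissible.\<close>

lemma two_good_radii:
  assumes "\<forall>\<^sub>F r in ae_at_top. P r"
  shows   "\<forall>\<^sub>F r in at_top. \<exists>R R2. P R \<and> P R2 \<and> 2 * r \<le> R \<and> R \<le> 3 * r \<and> 2 * R \<le> R2 \<and> R2 \<le> 9 * r"
proof -
  obtain r0 where r0: "\<And>a b. r0 \<le> a \<Longrightarrow> a < b \<Longrightarrow> \<exists>r. a < r \<and> r < b \<and> P r"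
    using ae_at_top_in_intervals[OF assms] by blast
  show ?thesis
    using eventually_ge_at_top[of r0] eventually_gt_at_top[of 0]
  proof eventually_elim
    case (elim r)
    obtain R where "2 * r < R" "R < 3 * r" "P R" using r0[of "2 * r" "3 * r"] elim by auto
    moreover obtain R2 where "6 * r < R2" "R2 < 9 * r" "P R2" using r0[of "6 * r" "9 * r"] elim by auto
    ultimately show ?case by (intro exI[of _ R] exI[of _ R2]) auto
  qed
qed

text \<open>Growth of hyper-order less than one is moderate enough for the error to be negligible on all
  large circles that avoid zeros and poles; the usual exceptional set does not appear.\<close>
lemma log_derivative_negligible:
  assumes h: "nzmero h" and \<delta>: "\<delta> > 0" "\<delta> < real k"
    and growth: "\<forall>\<^sub>F r in ae_at_top. nchar r h \<le> exp (C * r powr \<delta>)" and C: "C > 0"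
  shows "negligible k (\<lambda>r. prox r (\<lambda>z. deriv h z / h z))"
    and "negligible k (\<lambda>r. prox r (\<lambda>z. deriv (deriv h) z / h z))"
proof -
  \<comment> \<open>4 ln B equals 4 C (9r)^\<delta>, since all auxiliary radii are at most 9r; the
    summand 1 absorbs the logarithms of r and of the constants.\<close>
  define K where "K = 4 * C * 9 powr \<delta> + 1"
  have "\<forall>\<^sub>F r in at_top. \<exists>R R2. ((\<forall>z. cmod z = R \<longrightarrow> reg h z) \<and> nchar R h \<le> exp (C * R powr \<delta>)) \<and>
          ((\<forall>z. cmod z = R2 \<longrightarrow> reg h z) \<and> nchar R2 h \<le> exp (C * R2 powr \<delta>)) \<and>
          2 * r \<le> R \<and> R \<le> 3 * r \<and> 2 * R \<le> R2 \<and> R2 \<le> 9 * r"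
    by (rule two_good_radii) (intro eventually_conj nzmero_ae_at_top h growth)
  moreover have "\<forall>\<^sub>F r in at_top. ln 3 + 4 * ln 5000 + 4 * ln r \<le> r powr \<delta>"
    using \<delta>(1) by real_asymp
  moreover have "\<forall>\<^sub>F r in at_top. \<bar>jensen_const h\<bar> \<le> exp (C * (9 * r) powr \<delta>)"
  proof -
    have "filterlim (\<lambda>r. exp (C * (9 * r) powr \<delta>)) at_top at_top"
      using \<delta>(1) C by real_asymp
    thus ?thesis by (simp add: filterlim_at_top)
  qed
  moreover have "\<forall>\<^sub>F r::real in at_top. r \<ge> 1" by (rule eventually_ge_at_top)
  ultimately have "\<forall>\<^sub>F r in at_top. (\<forall>z. cmod z = r \<longrightarrow> reg h z) \<longrightarrow>
         prox r (\<lambda>z. deriv h z / h z) \<le> K * r powr \<delta> \<and>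
         prox r (\<lambda>z. deriv (deriv h) z / h z) \<le> K * r powr \<delta>"
  proof eventually_elim
    case (elim r)
    define B where "B = exp (C * (9 * r) powr \<delta>)"
    show ?case
    proof
      assume good: "\<forall>z. cmod z = r \<longrightarrow> reg h z"
      from elim obtain R R2 where R: "\<And>z. cmod z = R \<Longrightarrow> reg h z" "nchar R h \<le> exp (C * R powr \<delta>)"
         "\<And>z. cmod z = R2 \<Longrightarrow> reg h z" "nchar R2 h \<le> exp (C * R2 powr \<delta>)"
         "2 * r \<le> R" "R \<le> 3 * r" "2 * R \<le> R2" "R2 \<le> 9 * r" by blast
      have mono: "exp (C * x powr \<delta>) \<le> B" if "0 \<le> x" "x \<le> 9 * r" for x
        unfolding B_def using that \<delta> C by (auto intro!: mult_left_mono powr_mono2)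
      have B: "nchar R h \<le> B" "nchar R2 h \<le> B" "\<bar>jensen_const h\<bar> \<le> B" "B \<ge> 1"
      proof -
        show "nchar R h \<le> B" "nchar R2 h \<le> B"
          by (rule order.trans[OF R(2) mono] order.trans[OF R(4) mono]; use R(5-8) elim(4) in linarith)+
      qed (use elim C in \<open>auto simp: B_def\<close>)
      have "ln (5000 * B * r) = ln 5000 + C * (9 * r) powr \<delta> + ln r"
        using elim by (simp add: ln_mult_pos B_def)
      also have "(9 * r) powr \<delta> = 9 powr \<delta> * r powr \<delta>"
        using elim by (simp add: powr_mult)
      finally have "ln 3 + 4 * ln (5000 * B * r) \<le> K * r powr \<delta>"
        using elim by (simp add: K_def algebra_simps)
      moreover note log_derivative_estimate_explicit[OF h _ R(5,6,7) _ R(1,3) B]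
      ultimately show "prox r (\<lambda>z. deriv h z / h z) \<le> K * r powr \<delta> \<and>
         prox r (\<lambda>z. deriv (deriv h) z / h z) \<le> K * r powr \<delta>"
        using good elim by fastforce
    qed
  qed
  from eventually_at_top_imp_ae_at_top[OF this] nzmero_ae_at_top[OF h]
  have *: "\<forall>\<^sub>F r in ae_at_top. prox r (\<lambda>z. deriv h z / h z) \<le> K * r powr \<delta> \<and>
         prox r (\<lambda>z. deriv (deriv h) z / h z) \<le> K * r powr \<delta>"
    by eventually_elim auto
  show "negligible k (\<lambda>r. prox r (\<lambda>z. deriv h z / h z))"
       "negligible k (\<lambda>r. prox r (\<lambda>z. deriv (deriv h) z / h z))"
    using * by (auto intro!: negligible_mono[OF negligible_powr[OF \<delta>(2), of K]] elim: eventually_mono)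
qed

section \<open>Entire functions, maximum modulus and the hypotheses on the orders\<close>

lemma entire_zorder_nonneg:
  assumes "p holomorphic_on UNIV" "nzmero p"
  shows   "zorder p a \<ge> 0" "pole_order p = (\<lambda>_. 0)"
proof -
  have an: "p analytic_on {a}" for a using assms(1) by (auto simp: analytic_at)
  have *: "zorder p a \<ge> 0" for a
    using is_pole_iff_zorder[OF assms(2), of a] analytic_at_imp_no_pole[OF an[of a]] by auto
  show "zorder p a \<ge> 0" by (rule *)
  show "pole_order p = (\<lambda>_. 0)" using * by (auto simp: pole_order_def fun_eq_iff max_def) (meson order.antisym)
qed

lemma entire_nchar_eq_prox:
  assumes "p holomorphic_on UNIV" "nzmero p"
  shows   "nchar r p = prox r p"
  by (simp add: nchar_def entire_zorder_nonneg(2)[OF assms] ordsum_def)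

lemma entire_continuous [intro]: "p holomorphic_on UNIV \<Longrightarrow> continuous_on A p"
  using holomorphic_on_imp_continuous_on holomorphic_on_subset by blast

text \<open>The step from means to the maximum modulus goes through the factorization, where ln|p|
  is a sum of m ln|z - a| plus Re G. It costs a factor of order ln r, which the larger exponent
  \<kappa>' absorbs.\<close>

lemma maximum_modulus_growth:
  assumes hol: "p holomorphic_on UNIV" and p: "nzmero p" and \<kappa>: "\<kappa> > 0" "\<kappa> < \<kappa>'"
    and growth: "\<forall>\<^sub>F r in ae_at_top. prox r p \<le> r powr \<kappa>"
  shows "\<forall>\<^sub>F r in at_top. \<forall>z. cmod z \<le> r \<longrightarrow> cmod (p z) \<le> exp (r powr \<kappa>')"
proof -
  define j where "j = \<bar>jensen_const p\<bar>"
  have "\<forall>\<^sub>F r in at_top. \<exists>R R2. ((\<forall>z. cmod z = R \<longrightarrow> reg p z) \<and> prox R p \<le> R powr \<kappa>) \<and>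
          ((\<forall>z. cmod z = R2 \<longrightarrow> reg p z) \<and> prox R2 p \<le> R2 powr \<kappa>) \<and>
          2 * r \<le> R \<and> R \<le> 3 * r \<and> 2 * R \<le> R2 \<and> R2 \<le> 9 * r"
    by (rule two_good_radii) (intro eventually_conj nzmero_ae_at_top p growth)
  moreover have "\<forall>\<^sub>F r in at_top. 15 * ((4 * (9 * r) powr \<kappa> + 2 * j) * (1 + ln (6 * r))) \<le> r powr \<kappa>'"
    using \<kappa> by real_asymp
  moreover have "\<forall>\<^sub>F r::real in at_top. r \<ge> 1" by (rule eventually_ge_at_top)
  ultimately show ?thesis
  proof eventually_elim
    case (elim r)
    from elim obtain R R2 where R: "\<And>z. cmod z = R \<Longrightarrow> reg p z" "prox R p \<le> R powr \<kappa>"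
       "\<And>z. cmod z = R2 \<Longrightarrow> reg p z" "prox R2 p \<le> R2 powr \<kappa>"
       "2 * r \<le> R" "R \<le> 3 * r" "2 * R \<le> R2" "R2 \<le> 9 * r" by blast
    have R1: "R \<ge> 1" using R elim by simp
    define A where "A = {a. cmod a < R \<and> zorder p a \<noteq> 0}"
    define N where "N = (\<Sum>a\<in>A. \<bar>real_of_int (zorder p a)\<bar>)"
    have fin: "finite A" unfolding A_def by (rule finite_zorder_support[OF p])
    obtain G R' where R': "R' > R" and G: "G holomorphic_on ball 0 R'" and
      eq: "\<And>z. cmod z \<le> R \<Longrightarrow> reg p z \<Longrightarrow> p z = (\<Prod>a\<in>A. (z - a) powi zorder p a) * exp (G z)" and
      N_le: "N \<le> 4 * prox R2 p + 2 * j" and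
      M_le: "cmean R (\<lambda>z. \<bar>Re (G z)\<bar>) \<le> 2 * prox R p + j + N * (2 * ln (2 * R))"
      using quantitative_factorization[OF p R1 R(7) R(1,3)]
      unfolding A_def N_def j_def entire_nchar_eq_prox[OF hol p] by blast
    define M where "M = cmean R (\<lambda>z. \<bar>Re (G z)\<bar>)"
    define Q where "Q = 4 * (9 * r) powr \<kappa> + 2 * j"
    define l where "l = ln (6 * r)"
    have l0: "l \<ge> 0" using elim by (simp add: l_def)
    have mono: "x powr \<kappa> \<le> (9 * r) powr \<kappa>" if "0 \<le> x" "x \<le> 9 * r" for x
      using that \<kappa> by (auto intro!: powr_mono2)
    have N: "0 \<le> N" "N \<le> Q"
      using N_le R mono[of R2] elim by (auto simp: N_def Q_def intro: sum_nonneg)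
    have lR: "0 \<le> ln (2 * R)" "ln (2 * R) \<le> l"
      using R R1 by (auto simp: l_def intro!: ln_mono)
    have "N * (2 * ln (2 * R)) \<le> Q * (2 * l)"
      using N lR by (intro mult_mono) auto
    moreover have "2 * prox R p + j \<le> Q"
    proof -
      have "prox R p \<le> (9 * r) powr \<kappa>"
        by (rule order.trans[OF R(2) mono]) (use R(5,6) elim(3) in linarith)+
      moreover have "0 \<le> (9 * r) powr \<kappa>" "0 \<le> j" by (simp_all add: j_def)
      ultimately show ?thesis unfolding Q_def by linarith
    qed
    ultimately have M: "M \<le> Q + Q * (2 * l)" using M_le by (simp add: M_def)
    show "\<forall>z. cmod z \<le> r \<longrightarrow> cmod (p z) \<le> exp (r powr \<kappa>')"
    proof (intro allI impI)
      fix z assume z: "cmod z \<le> r"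
      show "cmod (p z) \<le> exp (r powr \<kappa>')"
      proof (cases "p z = 0")
        case False
        have "reg p z" using False hol by (auto simp: reg_def analytic_at)
        hence "ln (cmod (p z)) = (\<Sum>a\<in>A. of_int (zorder p a) * ln (cmod (z - a))) + Re (G z)"
          using z R(5) elim False
          by (intro ln_cmod_factorization fin eq) (auto simp: A_def)
        \<comment> \<open>The orders of an entire function are nonnegative, so an upper bound for
          ln|z - a| is enough and a nearby zero does no harm.\<close>
        also have "(\<Sum>a\<in>A. of_int (zorder p a) * ln (cmod (z - a))) \<le> (\<Sum>a\<in>A. \<bar>real_of_int (zorder p a)\<bar> * l)"
        proof (intro sum_mono)
          fix a assume a: "a \<in> A"
          have "z \<noteq> a" using a zorder_reg[OF \<open>reg p z\<close>] by (auto simp: A_def)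
          moreover have "cmod (z - a) \<le> 6 * r"
            using norm_triangle_ineq4[of z a] a z R elim by (auto simp: A_def)
          ultimately have "ln (cmod (z - a)) \<le> l" unfolding l_def by (intro ln_mono) auto
          thus "of_int (zorder p a) * ln (cmod (z - a)) \<le> \<bar>real_of_int (zorder p a)\<bar> * l"
            using entire_zorder_nonneg(1)[OF hol p, of a] by (auto intro!: mult_left_mono)
        qed
        also have "(\<Sum>a\<in>A. \<bar>real_of_int (zorder p a)\<bar> * l) = N * l" by (simp add: N_def sum_distrib_right)
        also have "N * l \<le> Q * l" using N l0 by (intro mult_right_mono)
        also have "Re (G z) \<le> 7 * M"
        proof -
          have c: "continuous_on (sphere 0 R) (\<lambda>z. Re (G z))"
            by (rule continuous_on_Re, rule holomorphic_on_imp_continuous_on,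
                rule holomorphic_on_subset[OF G]) (use R' in auto)
          have "Re (G 0) = cmean R (\<lambda>z. Re (G z))"
            using cmean_Re_holomorphic[OF G _ R'] R1 by simp
          also have "\<dots> \<le> M" unfolding M_def
            using R1 by (intro cmean_mono c continuous_on_rabs) auto
          finally have "Re (G 0) \<le> M" .
          moreover have "cmod (G z - G 0) \<le> 6 * M"
            unfolding M_def using R1 R z elim by (intro holomorphic_bound_by_Re_mean[OF G _ R']) auto
          moreover have "Re (G z - G 0) \<le> cmod (G z - G 0)" by (rule complex_Re_le_cmod)
          ultimately show ?thesis by simp
        qed
        \<comment> \<open>M <= Q + 2 Q l turns the left side into at most 7 Q + 15 Q l.\<close>
        also have "Q * l + 7 * M \<le> 15 * (Q * (1 + l))"
          using M N l0 by (simp add: algebra_simps)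
        also have "\<dots> \<le> r powr \<kappa>'" using elim by (simp add: Q_def l_def)
        finally have "ln (cmod (p z)) \<le> r powr \<kappa>'" by simp
        thus ?thesis using False by (metis exp_ln exp_le_cancel_iff zero_less_norm_iff)
      qed auto
    qed
  qed
qed

lemma growth_order_imp_prox:
  assumes hol: "p holomorphic_on UNIV" and ord: "growth_order p < ereal (real k)" and k: "k \<ge> 1"
  shows   "\<exists>\<kappa>. 0 < \<kappa> \<and> \<kappa> < real k \<and> (\<forall>\<^sub>F r in ae_at_top. prox r p \<le> r powr \<kappa>)"
proof -
  \<comment> \<open>The maximum with 0 makes the exponent chosen in between positive.\<close>
  have "max (growth_order p) 0 < ereal (real k)" using ord k by simp
  then obtain \<kappa> where \<kappa>: "max (growth_order p) 0 < ereal \<kappa>" "ereal \<kappa> < ereal (real k)"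
    using ereal_dense2 by blast
  have np: "\<not>is_pole p z" for z
    using hol by (intro analytic_at_imp_no_pole) (auto simp: analytic_at)
  have nev: "nevanlinna_char r p = prox r p" if "r \<ge> 0" for r
    using proximity_eq_prox[OF entire_continuous[OF hol] that] np
    by (simp add: nevanlinna_char_def pole_counting_def pole_count_def)
  have "growth_order p < ereal \<kappa>" using \<kappa> by simp
  hence "\<forall>\<^sub>F r in at_top. ereal (log_plus (nevanlinna_char r p) / ln r) < ereal \<kappa>"
    unfolding growth_order_def by (rule Limsup_lessD)
  hence "\<forall>\<^sub>F r in at_top. prox r p \<le> r powr \<kappa>"
    using eventually_gt_at_top[of 1]
  proof eventually_elim
    case (elim r)
    have "log_plus (prox r p) < \<kappa> * ln r" using elim by (simp add: nev field_simps)
    hence "ln (max 1 (prox r p)) < \<kappa> * ln r" by (simp add: log_plus_def)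
    hence "max 1 (prox r p) < exp (\<kappa> * ln r)"
      by (metis exp_less_cancel_iff exp_ln less_max_iff_disj zero_less_one)
    thus ?case using elim by (simp add: powr_def)
  qed
  thus ?thesis using \<kappa> by (intro exI[of _ \<kappa>]) (auto intro: eventually_at_top_imp_ae_at_top)
qed

lemma hyper_order_imp_nchar:
  assumes f: "nzmero f" and ord: "hyper_order f < 1"
  shows   "\<exists>\<delta>. 0 < \<delta> \<and> \<delta> < 1 \<and> (\<forall>\<^sub>F r in ae_at_top. nchar r f \<le> exp (r powr \<delta>))"
proof -
  have "max (hyper_order f) 0 < ereal 1" using ord by (simp add: one_ereal_def)
  then obtain \<delta> where \<delta>: "max (hyper_order f) 0 < ereal \<delta>" "ereal \<delta> < ereal 1"
    using ereal_dense2 by blast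
  have "hyper_order f < ereal \<delta>" using \<delta> by simp
  hence "\<forall>\<^sub>F r in at_top. ereal (log_plus (log_plus (nevanlinna_char r f)) / ln r) < ereal \<delta>"
    unfolding hyper_order_def by (rule Limsup_lessD)
  from eventually_at_top_imp_ae_at_top[OF this] eventually_ae_at_top_gt[of 1] nzmero_ae_at_top[OF f]
  have "\<forall>\<^sub>F r in ae_at_top. nchar r f \<le> exp (r powr \<delta>)"
  proof eventually_elim
    case (elim r)
    hence "nevanlinna_char r f = nchar r f" by (intro nevanlinna_char_eq_nchar f) auto
    hence "ln (max 1 (log_plus (nchar r f))) < \<delta> * ln r"
      using elim by (simp add: log_plus_def[of "log_plus _"] field_simps)
    hence "max 1 (log_plus (nchar r f)) < r powr \<delta>"
      using elim(2) by (metis exp_less_cancel_iff exp_ln less_max_iff_disj zero_less_one powr_def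
          less_irrefl order.strict_trans)
    hence "ln (max 1 (nchar r f)) < r powr \<delta>" by (simp add: log_plus_def)
    hence "max 1 (nchar r f) < exp (r powr \<delta>)"
      by (metis exp_less_cancel_iff exp_ln less_max_iff_disj zero_less_one)
    thus ?case by simp
  qed
  thus ?thesis using \<delta> by (intro exI[of _ \<delta>]) auto
qed

section \<open>Lower bounds for orders and for sums of exponentials\<close>

text \<open>The zero function satisfies this for every k. Sums, differences and derivatives can
  therefore be treated without knowing that they do not vanish identically, which arguments with
  \<open>zorder\<close> would require.\<close>

definition ord_ge :: "(complex \<Rightarrow> complex) \<Rightarrow> complex \<Rightarrow> int \<Rightarrow> bool" where
  "ord_ge h a k \<longleftrightarrow> (\<exists>\<phi>. \<phi> analytic_on {a} \<and> (\<forall>\<^sub>F z in at a. h z = (z - a) powi k * \<phi> z))"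

lemma eventually_at_neq: "\<forall>\<^sub>F z in at a. z \<noteq> (a::complex)"
  by (simp add: eventually_at_filter)

lemma ord_ge_zorder:
  assumes "nzmero h"
  shows   "ord_ge h a (zorder h a)"
proof -
  have "isolated_singularity_at h a" "not_essential h a" "\<exists>\<^sub>F w in at a. h w \<noteq> 0"
    using assms by (simp_all add: meromorphic_on_isolated_singularity meromorphic_on_not_essential
                    nzmero_frequently_at)
  from zorder_exist[OF this] obtain r where r: "r > 0" "zor_poly h a holomorphic_on cball a r"
    "\<forall>w\<in>cball a r - {a}. h w = zor_poly h a w * (w - a) powi zorder h a" by blast
  have "zor_poly h a analytic_on {a}"
    using r by (auto simp: analytic_at intro!: exI[of _ "ball a r"] holomorphic_on_subset[OF r(2)])
  moreover have "\<forall>\<^sub>F w in at a. w \<in> ball a r - {a}"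
    using r by (intro eventually_at_in_open) auto
  hence "\<forall>\<^sub>F z in at a. h z = (z - a) powi zorder h a * zor_poly h a z"
    by eventually_elim (use r(3) in auto)
  ultimately show ?thesis unfolding ord_ge_def by blast
qed

lemma ord_ge_mono:
  assumes "ord_ge h a k" "j \<le> k"
  shows   "ord_ge h a j"
proof -
  obtain \<phi> where \<phi>: "\<phi> analytic_on {a}" "\<forall>\<^sub>F z in at a. h z = (z - a) powi k * \<phi> z"
    using assms by (auto simp: ord_ge_def)
  obtain n where n: "k = j + int n" using assms(2) zle_iff_zadd by blast
  have "\<forall>\<^sub>F z in at a. h z = (z - a) powi j * ((z - a) ^ n * \<phi> z)"
    using \<phi>(2) eventually_at_neq
    by eventually_elim (simp add: n power_int_add)
  moreover have "(\<lambda>z. (z - a) ^ n * \<phi> z) analytic_on {a}"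
    using \<phi> by (auto intro!: analytic_intros)
  ultimately show ?thesis unfolding ord_ge_def by blast
qed

lemma ord_ge_cong:
  assumes "ord_ge h a k" "\<forall>\<^sub>F z in at a. h z = g z"
  shows   "ord_ge g a k"
proof -
  obtain \<phi> where \<phi>: "\<phi> analytic_on {a}" "\<forall>\<^sub>F z in at a. h z = (z - a) powi k * \<phi> z"
    using assms by (auto simp: ord_ge_def)
  from \<phi>(2) assms(2) have "\<forall>\<^sub>F z in at a. g z = (z - a) powi k * \<phi> z"
    by eventually_elim auto
  with \<phi>(1) show ?thesis unfolding ord_ge_def by blast
qed

lemma ord_ge_mult:
  assumes "ord_ge h a k" "ord_ge g a j"
  shows   "ord_ge (\<lambda>z. h z * g z) a (k + j)"
proof -
  obtain \<phi> \<psi> where \<phi>: "\<phi> analytic_on {a}" "\<forall>\<^sub>F z in at a. h z = (z - a) powi k * \<phi> z"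
    and \<psi>: "\<psi> analytic_on {a}" "\<forall>\<^sub>F z in at a. g z = (z - a) powi j * \<psi> z"
    using assms by (auto simp: ord_ge_def)
  from \<phi>(2) \<psi>(2) eventually_at_neq have "\<forall>\<^sub>F z in at a. h z * g z = (z - a) powi (k + j) * (\<phi> z * \<psi> z)"
    by eventually_elim (auto simp: power_int_add)
  moreover have "(\<lambda>z. \<phi> z * \<psi> z) analytic_on {a}" using \<phi> \<psi> by (auto intro!: analytic_intros)
  ultimately show ?thesis unfolding ord_ge_def by blast
qed

lemma
  assumes "ord_ge h a k" "ord_ge g a k"
  shows   ord_ge_add: "ord_ge (\<lambda>z. h z + g z) a k"
    and   ord_ge_diff: "ord_ge (\<lambda>z. h z - g z) a k"
proof -
  obtain \<phi> \<psi> where \<phi>: "\<phi> analytic_on {a}" "\<forall>\<^sub>F z in at a. h z = (z - a) powi k * \<phi> z"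
    and \<psi>: "\<psi> analytic_on {a}" "\<forall>\<^sub>F z in at a. g z = (z - a) powi k * \<psi> z"
    using assms by (auto simp: ord_ge_def)
  from \<phi>(2) \<psi>(2) have "\<forall>\<^sub>F z in at a. h z + g z = (z - a) powi k * (\<phi> z + \<psi> z)"
    by eventually_elim (auto simp: algebra_simps)
  moreover have "(\<lambda>z. \<phi> z + \<psi> z) analytic_on {a}" using \<phi> \<psi> by (auto intro!: analytic_intros)
  ultimately show "ord_ge (\<lambda>z. h z + g z) a k" unfolding ord_ge_def by blast
  from \<phi>(2) \<psi>(2) have "\<forall>\<^sub>F z in at a. h z - g z = (z - a) powi k * (\<phi> z - \<psi> z)"
    by eventually_elim (auto simp: algebra_simps)
  moreover have "(\<lambda>z. \<phi> z - \<psi> z) analytic_on {a}" using \<phi> \<psi> by (auto intro!: analytic_intros)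
  ultimately show "ord_ge (\<lambda>z. h z - g z) a k" unfolding ord_ge_def by blast
qed

lemma analytic_at_eventually:
  assumes "f analytic_on {a}"
  shows   "\<forall>\<^sub>F z in at a. f analytic_on {z}"
proof -
  obtain S where S: "open S" "a \<in> S" "f holomorphic_on S"
    using assms by (auto simp: analytic_at)
  have "\<forall>\<^sub>F z in at a. z \<in> S" using S by (intro eventually_at_in_open')
  thus ?thesis by eventually_elim (use S in \<open>auto simp: analytic_at\<close>)
qed

lemma deriv_eventually_at:
  assumes "\<forall>\<^sub>F z in at a. h z = g z"
  shows   "\<forall>\<^sub>F z in at (a::complex). deriv h z = deriv g z"
proof -
  obtain S where S: "open S" "a \<in> S" "\<And>z. z \<in> S - {a} \<Longrightarrow> h z = g z"
    using assms by (auto simp: eventually_at_topological)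
  have "\<forall>\<^sub>F z in at a. z \<in> S - {a}" using S by (intro eventually_at_in_open)
  thus ?thesis
  proof eventually_elim
    case (elim z)
    have "open (S - {a})" using S by auto
    hence "\<forall>\<^sub>F w in nhds z. w \<in> S - {a}" using elim by (rule eventually_nhds_in_open)
    hence "\<forall>\<^sub>F w in nhds z. h w = g w" by eventually_elim (use S in auto)
    thus ?case by (intro deriv_cong_ev) auto
  qed
qed

lemma ord_ge_deriv:
  assumes "ord_ge h a k"
  shows   "ord_ge (deriv h) a (k - 1)"
proof -
  obtain \<phi> where \<phi>: "\<phi> analytic_on {a}" "\<forall>\<^sub>F z in at a. h z = (z - a) powi k * \<phi> z"
    using assms by (auto simp: ord_ge_def)
  have "\<forall>\<^sub>F z in at a. deriv h z = deriv (\<lambda>z. (z - a) powi k * \<phi> z) z"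
    by (rule deriv_eventually_at[OF \<phi>(2)])
  hence "\<forall>\<^sub>F z in at a. deriv h z = (z - a) powi (k - 1) * (of_int k * \<phi> z + (z - a) * deriv \<phi> z)"
    using analytic_at_eventually[OF \<phi>(1)] eventually_at_neq
  proof eventually_elim
    case (elim z)
    have nz: "z - a \<noteq> 0" using elim by auto
    have "(\<phi> has_field_derivative deriv \<phi> z) (at z)"
      using elim(2) by (simp add: analytic_on_imp_differentiable_at DERIV_deriv_iff_field_differentiable)
    hence "((\<lambda>z. (z - a) powi k * \<phi> z) has_field_derivative
            (of_int k * (z - a) powi (k - 1)) * \<phi> z + deriv \<phi> z * (z - a) powi k) (at z)"
      using nz by (intro DERIV_mult) (auto intro!: derivative_eq_intros)
    from DERIV_imp_deriv[OF this] elim(1)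
    have "deriv h z = of_int k * (z - a) powi (k - 1) * \<phi> z + deriv \<phi> z * (z - a) powi k" by simp
    also have "(z - a) powi k = (z - a) powi (k - 1) * (z - a)"
      using nz power_int_add[of "z - a" "k - 1" 1] by simp
    finally show ?case by (simp add: algebra_simps)
  qed
  moreover have "(\<lambda>z. of_int k * \<phi> z + (z - a) * deriv \<phi> z) analytic_on {a}"
    using \<phi> by (auto intro!: analytic_intros analytic_deriv)
  ultimately show ?thesis unfolding ord_ge_def by blast
qed

text \<open>The general rule loses one order; at order 0 nothing is lost, since derivatives of
  analytic functions are analytic.\<close>

lemma ord_ge_deriv_0:
  assumes "ord_ge h a 0"
  shows   "ord_ge (deriv h) a 0"
proof -
  obtain \<phi> where \<phi>: "\<phi> analytic_on {a}" "\<forall>\<^sub>F z in at a. h z = \<phi> z"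
    using assms by (auto simp: ord_ge_def)
  have "\<forall>\<^sub>F z in at a. deriv h z = (z - a) powi 0 * deriv \<phi> z"
    using deriv_eventually_at[OF \<phi>(2)] by simp
  with \<phi>(1) show ?thesis unfolding ord_ge_def by (blast intro: analytic_deriv)
qed

lemma zorder_geI:
  assumes "nzmero h" "ord_ge h a k"
  shows   "k \<le> zorder h a"
proof -
  obtain \<phi> where \<phi>: "\<phi> analytic_on {a}" "\<forall>\<^sub>F z in at a. h z = (z - a) powi k * \<phi> z"
    using assms by (auto simp: ord_ge_def)
  have "\<forall>\<^sub>F z in at a. \<phi> z \<noteq> 0"
    using \<phi>(2) nzmero_eventually_at[OF assms(1)] by eventually_elim auto
  hence fr: "\<exists>\<^sub>F z in at a. \<phi> z \<noteq> 0" using eventually_frequently at_neq_bot by blast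
  have "zorder h a = zorder (\<lambda>z. (z - a) powi k * \<phi> z) a"
    by (rule zorder_cong) (use \<phi> in auto)
  also have "\<dots> = zorder (\<lambda>z. (z - a) powi k) a + zorder \<phi> a"
  proof (rule zorder_mult)
    have "nzmero (\<lambda>z. (z - a) powi k)" by (intro nzmero_power_int nzmero_linear)
    thus "(\<lambda>z. (z - a) powi k) meromorphic_on {a}" "\<exists>\<^sub>F z in at a. (z - a) powi k \<noteq> 0"
      using nzmero_mero nzmero_frequently_at by blast+
  qed (use \<phi> fr in \<open>auto intro: analytic_on_imp_meromorphic_on\<close>)
  also have "zorder (\<lambda>z. (z - a) powi k) a = k" by (simp add: zorder_linear_powi)
  finally have "zorder h a = k + zorder \<phi> a" .
  moreover have "zorder \<phi> a \<ge> 0"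
    using zorder_eq_0_iff[OF \<phi>(1) fr] zorder_pos_iff'[OF \<phi>(1) fr] by (cases "\<phi> a = 0") auto
  ultimately show ?thesis by simp
qed

text \<open>The hypothesis of order less than k in the form in which it is used: for an entire
  function the characteristic is \<open>prox\<close>, and the exponent \<kappa> is kept strictly
  below k.\<close>

definition small_entire :: "nat \<Rightarrow> (complex \<Rightarrow> complex) \<Rightarrow> bool" where
  "small_entire k p \<longleftrightarrow> p holomorphic_on UNIV \<and> nzmero p \<and>
     (\<exists>\<kappa>. 0 < \<kappa> \<and> \<kappa> < real k \<and> (\<forall>\<^sub>F r in ae_at_top. prox r p \<le> r powr \<kappa>))"

lemma small_entire_negligible:
  assumes "small_entire k p"
  shows   "negligible k (\<lambda>r. prox r p)"
proof -
  obtain \<kappa> where "\<kappa> < real k" "\<forall>\<^sub>F r in ae_at_top. prox r p \<le> r powr \<kappa>"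
    using assms by (auto simp: small_entire_def)
  thus ?thesis by (intro negligible_mono[OF negligible_powr[of \<kappa> k 1]]) auto
qed

lemma small_entire_abs_ln_negligible:
  assumes "small_entire k p" "k \<ge> 1"
  shows   "negligible k (\<lambda>r. cmean r (\<lambda>z. \<bar>ln (cmod (p z))\<bar>))"
proof -
  have p: "nzmero p" "p holomorphic_on UNIV" using assms by (auto simp: small_entire_def)
  have "negligible k (\<lambda>r. 2 * prox r p + \<bar>jensen_const p\<bar>)"
    by (intro negligible_add negligible_cmul small_entire_negligible assms negligible_const) auto
  moreover have "\<forall>\<^sub>F r in ae_at_top. cmean r (\<lambda>z. \<bar>ln (cmod (p z))\<bar>) \<le> 2 * prox r p + \<bar>jensen_const p\<bar>"
    using nzmero_ae_at_top[OF p(1)] eventually_ae_at_top_ge[of 1]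
    by eventually_elim (use cmean_abs_ln_le[OF p(1)] entire_nchar_eq_prox[OF p(2,1)] in auto)
  ultimately show ?thesis by (rule negligible_mono)
qed

section \<open>Circle means of exponentials of monomials\<close>

lemma cmean_Re_monomial:
  assumes "k \<ge> 1" "r > 0"
  shows   "cmean r (\<lambda>z. Re (b * z ^ k)) = 0"
proof -
  have "cmean r (\<lambda>z. Re (b * z ^ k)) = Re (b * 0 ^ k)"
    by (rule cmean_Re_holomorphic[where R' = "r + 1"]) (use assms in \<open>auto intro!: holomorphic_intros\<close>)
  thus ?thesis using assms by simp
qed

text \<open>Put w = b z^k, so |w| = M is constant on the circle. Then |Re w| >= (Re w)^2 / M = (M +
  Re (w^2) / M) / 2, whose mean is M/2, and the positive part is half of |Re w| + Re w. The exact
  constant would be 1/pi; 1/4 needs only means of monomials.\<close>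

lemma cmean_pos_part_monomial_ge:
  assumes k: "k \<ge> 1" and r: "r > 0"
  shows   "cmean r (\<lambda>z. max 0 (Re (b * z ^ k))) \<ge> cmod b * r ^ k / 4"
proof (cases "b = 0")
  case False
  define M where "M = cmod b * r ^ k"
  have M: "M > 0" using False r by (simp add: M_def)
  have le: "M / 4 + 1 / (4 * M) * Re (b\<^sup>2 * z ^ (2 * k)) + 1 / 2 * Re (b * z ^ k) \<le> max 0 (Re (b * z ^ k))"
    if z: "cmod z = r" for z
  proof -
    define w where "w = b * z ^ k"
    have cw: "cmod w = M" by (simp add: w_def M_def norm_mult norm_power z)
    have "Re (w\<^sup>2) = 2 * (Re w)\<^sup>2 - M\<^sup>2"
      using cmod_power2[of w] cw by (simp add: power2_eq_square)
    moreover have "b\<^sup>2 * z ^ (2 * k) = w\<^sup>2"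
      by (simp add: w_def power_mult_distrib power_mult [symmetric] mult.commute)
    ultimately have "M / 4 + 1 / (4 * M) * Re (b\<^sup>2 * z ^ (2 * k)) = (Re w)\<^sup>2 / (2 * M)"
      using M by (simp add: field_simps power2_eq_square)
    also have "(Re w)\<^sup>2 \<le> M * \<bar>Re w\<bar>"
      using abs_Re_le_cmod[of w] cw mult_right_mono[of "\<bar>Re w\<bar>" M "\<bar>Re w\<bar>"] by (simp add: power2_eq_square)
    hence "(Re w)\<^sup>2 / (2 * M) \<le> \<bar>Re w\<bar> / 2"
      using M by (simp add: field_simps)
    finally have "M / 4 + 1 / (4 * M) * Re (b\<^sup>2 * z ^ (2 * k)) \<le> \<bar>Re w\<bar> / 2" .
    moreover have "\<bar>Re w\<bar> / 2 + 1 / 2 * Re w \<le> max 0 (Re w)" by (simp add: max_def abs_if)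
    ultimately show ?thesis unfolding w_def [symmetric] by linarith
  qed
  have c: "continuous_on (sphere 0 r) (\<lambda>z. Re (b * z ^ k))" for b k
    by (intro continuous_intros)
  have "cmean r (\<lambda>z. M / 4 + 1 / (4 * M) * Re (b\<^sup>2 * z ^ (2 * k)) + 1 / 2 * Re (b * z ^ k)) \<le>
        cmean r (\<lambda>z. max 0 (Re (b * z ^ k)))"
    by (intro cmean_mono le continuous_intros less_imp_le[OF r]; assumption)
  also have "cmean r (\<lambda>z. M / 4 + 1 / (4 * M) * Re (b\<^sup>2 * z ^ (2 * k)) + 1 / 2 * Re (b * z ^ k)) =
             M / 4 + 1 / (4 * M) * cmean r (\<lambda>z. Re (b\<^sup>2 * z ^ (2 * k))) + 1 / 2 * cmean r (\<lambda>z. Re (b * z ^ k))"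
  proof -
    have r': "r \<ge> 0" using r by simp
    show ?thesis
      by (subst cmean_add[OF _ _ r'], intro continuous_intros, intro continuous_intros)+
         (simp only: cmean_cmul cmean_const)
  qed
  finally have "M / 4 + 1 / (4 * M) * cmean r (\<lambda>z. Re (b\<^sup>2 * z ^ (2 * k))) + 1 / 2 * cmean r (\<lambda>z. Re (b * z ^ k))
      \<le> cmean r (\<lambda>z. max 0 (Re (b * z ^ k)))" .
  moreover have "1 \<le> 2 * k" using k by simp
  ultimately show ?thesis
    unfolding cmean_Re_monomial[OF k r] cmean_Re_monomial[OF \<open>1 \<le> 2 * k\<close> r] M_def by simp
qed (use assms in \<open>auto intro!: cmean_nonneg continuous_intros\<close>)

text \<open>The larger of the two exponents is Re (b1 z^k) plus the positive part of Re ((b2 - b1)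
  z^k). The first has mean 0, the second mean at least |b2 - b1| r^k / 4, and half of this is given
  up to the factors p1 and p2.\<close>

lemma two_exponentials_lower_bound:
  assumes k: "k \<ge> 1" and p: "small_entire k p1" "small_entire k p2" and b: "b1 \<noteq> b2"
    and J: "\<forall>\<^sub>F r in ae_at_top. continuous_on (sphere 0 r) J"
    and le: "\<forall>\<^sub>F r in ae_at_top. \<forall>z. cmod z = r \<longrightarrow>
               ln (cmod (p1 z * exp (b1 * z ^ k))) \<le> J z \<and> ln (cmod (p2 z * exp (b2 * z ^ k))) \<le> J z"
  shows "\<forall>\<^sub>F r in ae_at_top. cmod (b2 - b1) / 8 * r ^ k \<le> cmean r J"
proof -
  have nz: "nzmero p1" "nzmero p2" using p by (auto simp: small_entire_def)
  have "negligible k (\<lambda>r. cmean r (\<lambda>z. \<bar>ln (cmod (p1 z))\<bar>) + cmean r (\<lambda>z. \<bar>ln (cmod (p2 z))\<bar>))"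
    by (intro negligible_add small_entire_abs_ln_negligible p k)
  moreover have "cmod (b2 - b1) / 8 > 0" using b by simp
  ultimately have "\<forall>\<^sub>F r in ae_at_top. cmean r (\<lambda>z. \<bar>ln (cmod (p1 z))\<bar>) + cmean r (\<lambda>z. \<bar>ln (cmod (p2 z))\<bar>)
                     \<le> cmod (b2 - b1) / 8 * r ^ k"
    by (rule neglD)
  thus ?thesis
    using J le nzmero_ae_at_top[OF nz(1)] nzmero_ae_at_top[OF nz(2)] eventually_ae_at_top_gt[of 0]
  proof eventually_elim
    case (elim r)
    have c: "continuous_on (sphere 0 r) (\<lambda>z. \<bar>ln (cmod (p1 z))\<bar>)"
            "continuous_on (sphere 0 r) (\<lambda>z. \<bar>ln (cmod (p2 z))\<bar>)"
            "continuous_on (sphere 0 r) (\<lambda>z. Re (b1 * z ^ k))"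
            "continuous_on (sphere 0 r) (\<lambda>z. max 0 (Re ((b2 - b1) * z ^ k)))"
      using elim by (auto intro!: continuous_on_rabs continuous_on_ln_reg continuous_intros)
    have "cmean r (\<lambda>z. Re (b1 * z ^ k) + max 0 (Re ((b2 - b1) * z ^ k)) -
                       (\<bar>ln (cmod (p1 z))\<bar> + \<bar>ln (cmod (p2 z))\<bar>)) \<le> cmean r J"
    proof (rule cmean_mono)
      fix z assume z: "cmod z = r"
      have "p1 z \<noteq> 0" "p2 z \<noteq> 0" using elim z by (auto simp: reg_def)
      hence "ln (cmod (p1 z * exp (b1 * z ^ k))) = ln (cmod (p1 z)) + Re (b1 * z ^ k)"
            "ln (cmod (p2 z * exp (b2 * z ^ k))) = ln (cmod (p2 z)) + Re (b2 * z ^ k)"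
        by (simp_all add: norm_mult ln_mult)
      moreover have "ln (cmod (p1 z * exp (b1 * z ^ k))) \<le> J z" "ln (cmod (p2 z * exp (b2 * z ^ k))) \<le> J z"
        using elim z by auto
      moreover have "Re ((b2 - b1) * z ^ k) = Re (b2 * z ^ k) - Re (b1 * z ^ k)"
        by (simp add: left_diff_distrib)
      ultimately show "Re (b1 * z ^ k) + max 0 (Re ((b2 - b1) * z ^ k)) -
                       (\<bar>ln (cmod (p1 z))\<bar> + \<bar>ln (cmod (p2 z))\<bar>) \<le> J z"
        by linarith
    qed (use c elim in \<open>auto intro!: continuous_on_diff continuous_on_add\<close>)
    also have "cmean r (\<lambda>z. Re (b1 * z ^ k) + max 0 (Re ((b2 - b1) * z ^ k)) -
                       (\<bar>ln (cmod (p1 z))\<bar> + \<bar>ln (cmod (p2 z))\<bar>)) =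
               cmean r (\<lambda>z. Re (b1 * z ^ k)) + cmean r (\<lambda>z. max 0 (Re ((b2 - b1) * z ^ k))) -
               (cmean r (\<lambda>z. \<bar>ln (cmod (p1 z))\<bar>) + cmean r (\<lambda>z. \<bar>ln (cmod (p2 z))\<bar>))"
    proof -
      have r: "r \<ge> 0" using elim by simp
      show ?thesis
        unfolding cmean_diff[OF continuous_on_add[OF c(3,4)] continuous_on_add[OF c(1,2)] r]
          cmean_add[OF c(3,4) r] cmean_add[OF c(1,2) r] ..
    qed
    finally show ?case
      using elim(1) cmean_pos_part_monomial_ge[OF k elim(6), of "b2 - b1"] cmean_Re_monomial[OF k elim(6), of b1]
      by linarith
  qed
qed

lemma
  assumes "continuous_on (sphere 0 r) f" "continuous_on (sphere 0 r) g" "r \<ge> 0"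
  shows   prox_add_le: "prox r (\<lambda>z. f z + g z) \<le> prox r f + prox r g + ln 2"
    and   prox_mult_le: "prox r (\<lambda>z. f z * g z) \<le> prox r f + prox r g"
proof -
  have c: "continuous_on (sphere 0 r) (\<lambda>z. log_plus (cmod (f z)))"
          "continuous_on (sphere 0 r) (\<lambda>z. log_plus (cmod (g z)))"
    using assms by (auto intro!: continuous_intros)
  have "prox r (\<lambda>z. f z + g z) \<le> cmean r (\<lambda>z. log_plus (cmod (f z)) + log_plus (cmod (g z)) + ln 2)"
    unfolding prox_def
  proof (intro cmean_mono)
    fix z
    have "log_plus (cmod (f z + g z)) \<le> log_plus (cmod (f z) + cmod (g z))"
      by (intro log_plus_mono norm_triangle_ineq)
    also have "\<dots> \<le> log_plus (cmod (f z)) + log_plus (cmod (g z)) + ln 2"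
      by (intro log_plus_add_le) auto
    finally show "log_plus (cmod (f z + g z)) \<le> log_plus (cmod (f z)) + log_plus (cmod (g z)) + ln 2" .
  qed (use assms c in \<open>auto intro!: continuous_intros\<close>)
  also have "\<dots> = prox r f + prox r g + ln 2"
    using assms(3) c by (simp add: cmean_add prox_def continuous_on_add)
  finally show "prox r (\<lambda>z. f z + g z) \<le> prox r f + prox r g + ln 2" .
  have "prox r (\<lambda>z. f z * g z) \<le> cmean r (\<lambda>z. log_plus (cmod (f z)) + log_plus (cmod (g z)))"
    unfolding prox_def
    by (intro cmean_mono) (use assms c in \<open>auto intro!: continuous_intros log_plus_mult_le simp: norm_mult\<close>)
  also have "\<dots> = prox r f + prox r g"
    using assms(3) c by (simp add: cmean_add prox_def)
  finally show "prox r (\<lambda>z. f z * g z) \<le> prox r f + prox r g" .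
qed

lemma prox_exp_monomial_le:
  assumes "r \<ge> 0"
  shows   "prox r (\<lambda>z. exp (b * z ^ k)) \<le> cmod b * r ^ k"
proof -
  have "prox r (\<lambda>z. exp (b * z ^ k)) \<le> cmean r (\<lambda>_. cmod b * r ^ k)"
    unfolding prox_def
  proof (intro cmean_mono)
    fix z assume z: "cmod z = r"
    have "Re (b * z ^ k) \<le> cmod (b * z ^ k)" by (rule complex_Re_le_cmod)
    hence "Re (b * z ^ k) \<le> cmod b * r ^ k" by (simp only: norm_mult norm_power z)
    hence "cmod (exp (b * z ^ k)) \<le> exp (cmod b * r ^ k)" by (simp only: norm_exp_eq_Re exp_le_cancel_iff)
    moreover have "1 \<le> exp (cmod b * r ^ k)" using assms by simp
    ultimately have "max 1 (cmod (exp (b * z ^ k))) \<le> exp (cmod b * r ^ k)" by simp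
    hence "log_plus (cmod (exp (b * z ^ k))) \<le> ln (exp (cmod b * r ^ k))"
      unfolding log_plus_def by (intro ln_mono) (auto simp: less_max_iff_disj)
    thus "log_plus (cmod (exp (b * z ^ k))) \<le> cmod b * r ^ k" by simp
  qed (use assms in \<open>auto intro!: continuous_intros\<close>)
  thus ?thesis by simp
qed

definition expoly :: "nat \<Rightarrow> (complex \<Rightarrow> complex) \<Rightarrow> complex \<Rightarrow> complex \<Rightarrow> complex" where
  "expoly k p b z = p z * exp (b * z ^ k)"

lemma
  assumes "small_entire k p"
  shows expoly_holomorphic: "expoly k p b holomorphic_on A"
    and expoly_nzmero: "nzmero (expoly k p b)"
proof -
  have p: "p holomorphic_on UNIV" "nzmero p" using assms by (auto simp: small_entire_def)
  have "expoly k p b holomorphic_on UNIV"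
    unfolding expoly_def by (intro holomorphic_intros p)
  thus "expoly k p b holomorphic_on A" by (rule holomorphic_on_subset) auto
  have "nzmero (\<lambda>z. exp (b * z ^ k))"
    by (rule nzmero_holomorphic) (auto intro!: holomorphic_intros)
  thus "nzmero (expoly k p b)" unfolding expoly_def by (intro nzmero_mult p)
qed

lemma prox_expoly_le:
  assumes "small_entire k p"
  shows "\<forall>\<^sub>F r in ae_at_top. prox r (expoly k p b) \<le> (1 + cmod b) * r ^ k"
proof -
  have hol: "p holomorphic_on UNIV" using assms by (auto simp: small_entire_def)
  from neglD[OF small_entire_negligible[OF assms], of 1] have "\<forall>\<^sub>F r in ae_at_top. prox r p \<le> 1 * r ^ k" by simp
  thus ?thesis using eventually_ae_at_top_ge[of 0]
  proof eventually_elim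
    case (elim r)
    have "prox r (expoly k p b) \<le> prox r p + prox r (\<lambda>z. exp (b * z ^ k))"
      unfolding expoly_def using hol elim by (intro prox_mult_le) (auto intro!: continuous_intros)
    thus ?case using elim prox_exp_monomial_le[of r b k] by (simp add: ring_distribs)
  qed
qed

text \<open>The exponent has mean 0. In the mean of ln|F0 F1 F2 F3| the exponential terms thus cost
  only o(r^k), although the maximum J is of size at least r^k because of them.\<close>

lemma cmean_ln_expoly_le:
  assumes "small_entire k p" "k \<ge> 1"
  shows "\<forall>\<^sub>F r in ae_at_top. cmean r (\<lambda>z. ln (cmod (expoly k p b z))) \<le> prox r p"
proof -
  have p: "p holomorphic_on UNIV" "nzmero p" using assms by (auto simp: small_entire_def)
  show ?thesis using nzmero_ae_at_top[OF p(2)] eventually_ae_at_top_gt[of 0]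
  proof eventually_elim
    case (elim r)
    have c: "continuous_on (sphere 0 r) (\<lambda>z. ln (cmod (p z)))"
      using elim by (intro continuous_on_ln_reg) auto
    have "cmean r (\<lambda>z. ln (cmod (expoly k p b z))) = cmean r (\<lambda>z. ln (cmod (p z)) + Re (b * z ^ k))"
      using elim by (intro cmean_cong) (auto simp: reg_def expoly_def norm_mult ln_mult)
    also have "\<dots> = cmean r (\<lambda>z. ln (cmod (p z))) + cmean r (\<lambda>z. Re (b * z ^ k))"
      by (rule cmean_add[OF c]) (use elim in \<open>auto intro!: continuous_intros\<close>)
    also have "cmean r (\<lambda>z. Re (b * z ^ k)) = 0" using assms elim by (intro cmean_Re_monomial) auto
    also have "cmean r (\<lambda>z. ln (cmod (p z))) \<le> prox r p"
      unfolding prox_def using elim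
      by (intro cmean_mono c continuous_on_log_plus continuous_on_norm entire_continuous p ln_le_log_plus) auto
    finally show ?case by simp
  qed
qed

lemma power_le_exp_powr:
  assumes "\<delta> > 0"
  shows   "\<forall>\<^sub>F r::real in at_top. C * r ^ k \<le> exp (r powr \<delta>)"
proof -
  have "(\<lambda>r. r ^ k) \<in> o(\<lambda>r. exp (r powr \<delta>))" using assms by real_asymp
  hence "(\<lambda>r. C * r ^ k) \<in> o(\<lambda>r. exp (r powr \<delta>))" by simp
  from landau_o.smallD[OF this, of 1] show ?thesis by (auto elim!: eventually_mono)
qed

lemma log_derivative_negligible_polynomial_growth:
  assumes h: "nzmero h" "h holomorphic_on UNIV" and k: "k \<ge> 1"
    and growth: "\<forall>\<^sub>F r in ae_at_top. prox r h \<le> C * r ^ k"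
  shows "negligible k (\<lambda>r. prox r (\<lambda>z. deriv h z / h z))"
    and "negligible k (\<lambda>r. prox r (\<lambda>z. deriv (deriv h) z / h z))"
proof -
  have "\<forall>\<^sub>F r in ae_at_top. nchar r h \<le> exp (1 * r powr (1/2))"
    using growth eventually_at_top_imp_ae_at_top[OF power_le_exp_powr[of "1/2" C k]]
    by (simp add: entire_nchar_eq_prox h eventually_conj_iff) (auto elim: eventually_elim2)
  \<comment> \<open>Polynomial growth lies below exp (r^\<delta>) for every \<delta> > 0; the choice
    1/2 is below every k >= 1.\<close>
  moreover have "1/2 < real k" using k by simp
  ultimately show "negligible k (\<lambda>r. prox r (\<lambda>z. deriv h z / h z))"
    and "negligible k (\<lambda>r. prox r (\<lambda>z. deriv (deriv h) z / h z))"
    using log_derivative_negligible[OF h(1), of "1/2" k 1] by auto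
qed

lemma reg_deriv_continuous:
  assumes "\<And>z. cmod z = r \<Longrightarrow> reg h z"
  shows "continuous_on (sphere 0 r) (\<lambda>z. deriv h z / h z)"
        "continuous_on (sphere 0 r) (\<lambda>z. deriv (deriv h) z / h z)"
  using assms by (auto intro!: continuous_on_reg_sphere analytic_intros analytic_deriv simp: reg_def)

text \<open>If the Wronskian vanished, G would be a constant multiple c F. Then ln|F| plus a
  constant would dominate both exponential terms, while its mean is o(r^k), against the lower bound
  for such majorants.\<close>

lemma expoly_wronskian_nzmero:
  assumes k: "k \<ge> 1" and p: "small_entire k p1" "small_entire k p2" and b: "b1 \<noteq> b2"
  defines "F \<equiv> expoly k p1 b1" and "G \<equiv> expoly k p2 b2"
  shows   "nzmero (\<lambda>z. F z * deriv G z - deriv F z * G z)"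
proof (rule ccontr)
  define W where "W = (\<lambda>z. F z * deriv G z - deriv F z * G z)"
  have FG: "F holomorphic_on UNIV" "G holomorphic_on UNIV" "nzmero F" "nzmero G"
    unfolding F_def G_def using p by (auto intro: expoly_holomorphic expoly_nzmero)
  assume "\<not> nzmero (\<lambda>z. F z * deriv G z - deriv F z * G z)"
  hence "\<not> nzmero W" by (simp add: W_def)
  moreover have "W holomorphic_on UNIV"
    unfolding W_def by (intro holomorphic_intros holomorphic_deriv FG open_UNIV)
  ultimately have W0: "W z = 0" for z using nzmero_holomorphic by blast
  define q where "q = (\<lambda>z. G z / F z)"
  have "\<forall>\<^sub>F z in at 0. reg F z"
    using nzmero_cosparse_reg[OF FG(3)] by (rule eventually_cosparse_imp_eventually_at) auto
  then obtain z0 where "reg F z0" using eventually_happens'[OF at_neq_bot] by blast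
  then obtain S where S: "open S" "z0 \<in> S" "\<And>z. z \<in> S \<Longrightarrow> reg F z"
    using reg_eventually_nhds[of F z0] by (auto simp: eventually_nhds)
  then obtain e where e: "e > 0" "ball z0 e \<subseteq> S" using open_contains_ball by blast
  have "q constant_on ball z0 e"
  proof (rule has_field_derivative_0_imp_constant_on)
    fix z assume z: "z \<in> ball z0 e"
    hence nz: "F z \<noteq> 0" using S e by (auto simp: reg_def)
    have "(F has_field_derivative deriv F z) (at z)" "(G has_field_derivative deriv G z) (at z)"
      using FG by (auto intro: holomorphic_derivI)
    hence "(q has_field_derivative (deriv G z * F z - G z * deriv F z) / (F z * F z)) (at z)"
      unfolding q_def using nz by (intro DERIV_divide)
    moreover have "deriv G z * F z - G z * deriv F z = 0" using W0[of z] by (simp add: W_def algebra_simps)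
    ultimately show "(q has_field_derivative 0) (at z)" by simp
  qed (auto intro: connected_ball)
  then obtain c where c: "\<And>z. z \<in> ball z0 e \<Longrightarrow> q z = c" by (auto simp: constant_on_def)
  have loc: "G z - c * F z = 0" if "z \<in> ball z0 e" for z
    using c[OF that] S(3)[of z] e that by (auto simp: q_def reg_def field_simps)
  have eq: "G z - c * F z = 0" for z
  proof (rule analytic_continuation_open[of "ball z0 e" UNIV "\<lambda>z. G z - c * F z" "\<lambda>_. 0"])
    show "(\<lambda>z. G z - c * F z) holomorphic_on UNIV" by (intro holomorphic_intros FG)
  qed (use e loc in auto)
  hence G_eq: "G z = c * F z" for z by simp
  have c0: "c \<noteq> 0"
  proof
    assume "c = 0"
    hence "G z = 0" for z using G_eq by simp
    thus False using nzmero_frequently_at[OF FG(4), of 0] by simp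
  qed
  define J where "J z = ln (cmod (F z)) + \<bar>ln (cmod c)\<bar>" for z
  have "\<forall>\<^sub>F r in ae_at_top. cmod (b2 - b1) / 8 * r ^ k \<le> cmean r J"
  proof (rule two_exponentials_lower_bound[OF k p b])
    show "\<forall>\<^sub>F r in ae_at_top. continuous_on (sphere 0 r) J"
      using nzmero_ae_at_top[OF FG(3)]
      by eventually_elim (auto simp: J_def intro!: continuous_on_add continuous_on_const continuous_on_ln_reg)
    show "\<forall>\<^sub>F r in ae_at_top. \<forall>z. cmod z = r \<longrightarrow>
               ln (cmod (p1 z * exp (b1 * z ^ k))) \<le> J z \<and> ln (cmod (p2 z * exp (b2 * z ^ k))) \<le> J z"
      using nzmero_ae_at_top[OF FG(3)]
    proof eventually_elim
      case (elim r)
      show ?case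
      proof (intro allI impI)
        fix z assume "cmod z = r"
        hence "F z \<noteq> 0" using elim by (auto simp: reg_def)
        hence "ln (cmod (G z)) = ln (cmod (F z)) + ln (cmod c)"
          using c0 by (simp add: G_eq norm_mult ln_mult)
        thus "ln (cmod (p1 z * exp (b1 * z ^ k))) \<le> J z \<and> ln (cmod (p2 z * exp (b2 * z ^ k))) \<le> J z"
          unfolding F_def G_def expoly_def J_def by simp
      qed
    qed
  qed
  moreover have "\<forall>\<^sub>F r in ae_at_top. cmean r J \<le> prox r p1 + \<bar>ln (cmod c)\<bar>"
    using cmean_ln_expoly_le[OF p(1) k, of b1] nzmero_ae_at_top[OF FG(3)] eventually_ae_at_top_gt[of 0]
  proof eventually_elim
    case (elim r)
    have "cmean r J = cmean r (\<lambda>z. ln (cmod (F z))) + \<bar>ln (cmod c)\<bar>"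
      unfolding J_def using elim by (subst cmean_add) (auto intro!: continuous_on_ln_reg)
    thus ?case using elim by (simp add: F_def)
  qed
  moreover have "negligible k (\<lambda>r. prox r p1 + \<bar>ln (cmod c)\<bar>)"
    by (intro negligible_add small_entire_negligible p negligible_const k)
  from neglD[OF this, of "cmod (b2 - b1) / 16"] b
  have "\<forall>\<^sub>F r in ae_at_top. prox r p1 + \<bar>ln (cmod c)\<bar> \<le> cmod (b2 - b1) / 16 * r ^ k" by simp
  ultimately have "\<forall>\<^sub>F r in ae_at_top. False"
    using eventually_ae_at_top_gt[of 0]
  proof eventually_elim
    case (elim r)
    have "cmod (b2 - b1) * r ^ k > 0" using b elim by simp
    thus ?case using elim by linarith
  qed
  thus False using ae_at_top_in_intervals[of "\<lambda>_. False"] by (metis less_add_one order_refl)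
qed

section \<open>Three terms\<close>

lemma ae_at_top_neq_bot: "\<not> (\<forall>\<^sub>F r in ae_at_top. False)"
  using ae_at_top_in_intervals[of "\<lambda>_. False"] by (metis less_add_one order_refl)

text \<open>Cartan's argument for three terms: the Wronskian loses only one order at each zero of
  f, whereas f^n vanishes there to order at least n.\<close>
theorem power_not_sum_of_two_exponentials:
  assumes k: "k \<ge> 1" and n: "n \<ge> 2" and p: "small_entire k p1" "small_entire k p2" and b: "b1 \<noteq> b2"
    and f: "f meromorphic_on UNIV"
    and eq: "\<forall>\<^sub>F z in cosparse UNIV. f z ^ n = p1 z * exp (b1 * z ^ k) + p2 z * exp (b2 * z ^ k)"
  shows False
proof -
  define F where "F = expoly k p1 b1"
  define G where "G = expoly k p2 b2"
  define H where "H = (\<lambda>z. F z + G z)"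
  define W where "W = (\<lambda>z. F z * deriv G z - deriv F z * G z)"
  have FG: "F holomorphic_on A" "G holomorphic_on A" "nzmero F" "nzmero G" for A
    unfolding F_def G_def using p by (auto intro: expoly_holomorphic expoly_nzmero)
  have Hh: "H holomorphic_on UNIV" unfolding H_def by (intro holomorphic_intros FG)
  have W: "nzmero W" unfolding W_def F_def G_def by (rule expoly_wronskian_nzmero[OF k p b])
  have dF: "(F has_field_derivative deriv F z) (at z)" and dG: "(G has_field_derivative deriv G z) (at z)" for z
    by (rule holomorphic_derivI[OF FG(1) open_UNIV] holomorphic_derivI[OF FG(2) open_UNIV]; simp)+
  have dH: "deriv H z = deriv F z + deriv G z" for z
    unfolding H_def by (rule DERIV_imp_deriv) (intro DERIV_add dF dG)
  have Hz: "H z = F z + G z" for z by (simp add: H_def)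
  \<comment> \<open>H = F + G allows W to be formed from any two of the three functions.
    \<open>W1\<close> will bound ln|G| and \<open>W2\<close> will bound ln|F|.\<close>
  have W1: "W z = F z * deriv H z - deriv F z * H z" and W2: "W z = H z * deriv G z - deriv H z * G z" for z
    by (simp_all add: W_def dH Hz algebra_simps)
  have H: "nzmero H"
  proof (rule nzmero_holomorphic[OF Hh], rule ccontr)
    assume "\<not> (\<exists>z. H z \<noteq> 0)"
    hence 0: "H = (\<lambda>_. 0)" by auto
    have "W z = 0" for z using W1[of z] by (simp add: 0)
    thus False using nzmero_frequently_at[OF W, of 0] by simp
  qed
  have eq': "\<forall>\<^sub>F z in cosparse UNIV. f z ^ n = H z"
    using eq by (simp add: H_def F_def G_def expoly_def)
  have fn: "nzmero f"
    unfolding nzmero_def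
  proof
    from eq' nzmero_cosparse_reg[OF H] show "\<forall>\<^sub>F z in cosparse UNIV. f z \<noteq> 0"
      by eventually_elim (use n in \<open>auto simp: reg_def power_0_left\<close>)
  qed (rule f)
  have zH: "zorder H a = int n * zorder f a" for a
  proof -
    have "\<forall>\<^sub>F z in at a. H z = f z ^ n"
      using eventually_cosparse_imp_eventually_at[OF eq', of a UNIV] by (auto elim: eventually_mono)
    hence "zorder H a = zorder (\<lambda>z. f z ^ n) a" by (intro zorder_cong) auto
    also have "\<dots> = int n * zorder f a"
      using fn by (intro zorder_power) (auto simp: nzmero_frequently_at)
    finally show ?thesis .
  qed
  have x0: "zorder f a \<ge> 0" for a
    using entire_zorder_nonneg(1)[OF Hh H, of a] n by (simp add: zH zero_le_mult_iff)
  have zW: "zorder W a \<ge> (int n - 1) * zorder f a" for a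
  proof (rule zorder_geI[OF W])
    define e where "e = (int n - 1) * zorder f a"
    have oF: "ord_ge F a 0" "ord_ge (deriv F) a 0"
      using ord_ge_mono[OF ord_ge_zorder[OF FG(3)] entire_zorder_nonneg(1)[OF FG(1,3)]]
      by (auto intro: ord_ge_deriv_0)
    have oH: "ord_ge H a (int n * zorder f a)" using ord_ge_zorder[OF H, of a] by (simp add: zH)
    have "ord_ge H a e" "ord_ge (deriv H) a e"
    proof -
      show "ord_ge H a e" by (rule ord_ge_mono[OF oH]) (use x0[of a] in \<open>simp add: e_def left_diff_distrib\<close>)
      show "ord_ge (deriv H) a e"
      \<comment> \<open>At a point where f has order 0 differentiation loses nothing; at a zero the
        loss of one order is covered by n x - 1 >= (n - 1) x.\<close>
      proof (cases "zorder f a = 0")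
        case True
        thus ?thesis using oH by (auto simp: e_def intro: ord_ge_deriv_0)
      next
        case False
        thus ?thesis using x0[of a]
          by (intro ord_ge_mono[OF ord_ge_deriv[OF oH]]) (simp add: e_def left_diff_distrib)
      qed
    qed
    hence "ord_ge (\<lambda>z. F z * deriv H z - deriv F z * H z) a (0 + e)"
      by (intro ord_ge_diff ord_ge_mult oF)
    thus "ord_ge W a ((int n - 1) * zorder f a)"
      by (simp add: e_def W1 [abs_def])
  qed
  define J where "J z = max (ln (cmod (F z))) (ln (cmod (G z)))" for z
  define E where "E z = ln 2 + (log_plus (cmod (deriv F z / F z)) + (log_plus (cmod (deriv G z / G z)) +
                          log_plus (cmod (deriv H z / H z))))" for z
  define mE where "mE r = ln 2 + (prox r (\<lambda>z. deriv F z / F z) + (prox r (\<lambda>z. deriv G z / G z) +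
                       prox r (\<lambda>z. deriv H z / H z)))" for r
  have good: "\<forall>\<^sub>F r in ae_at_top. \<forall>z. cmod z = r \<longrightarrow> reg F z \<and> reg G z \<and> reg H z \<and> reg W z"
    using nzmero_ae_at_top[OF FG(3)] nzmero_ae_at_top[OF FG(4)] nzmero_ae_at_top[OF H] nzmero_ae_at_top[OF W]
    by eventually_elim auto
  have Jcont: "\<forall>\<^sub>F r in ae_at_top. continuous_on (sphere 0 r) J"
    using good by eventually_elim (auto simp: J_def intro!: continuous_on_max continuous_on_ln_reg)
  define \<beta> where "\<beta> = cmod (b2 - b1) / 8"
  have \<beta>: "\<beta> > 0" using b by (simp add: \<beta>_def)
  have lower: "\<forall>\<^sub>F r in ae_at_top. \<beta> * r ^ k \<le> cmean r J"
    unfolding \<beta>_def using Jcont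
    by (intro two_exponentials_lower_bound[OF k p b]) (auto simp: J_def F_def G_def expoly_def)
  have upper: "\<forall>\<^sub>F r in ae_at_top. cmean r J \<le> 2 * (prox r p1 + prox r p2 + mE r) + (ln 2 + \<bar>jensen_const H\<bar> + 2 * \<bar>jensen_const W\<bar>)"
    using good Jcont cmean_ln_expoly_le[OF p(1) k, of b1] cmean_ln_expoly_le[OF p(2) k, of b2] eventually_ae_at_top_ge[of 1]
  proof eventually_elim
    case (elim r)
    have r: "r \<ge> 0" "r > 0" "r \<ge> 1" using elim by auto
    have cl: "continuous_on (sphere 0 r) (\<lambda>z. ln (cmod (F z)))" "continuous_on (sphere 0 r) (\<lambda>z. ln (cmod (G z)))"
             "continuous_on (sphere 0 r) (\<lambda>z. ln (cmod (H z)))" "continuous_on (sphere 0 r) (\<lambda>z. ln (cmod (W z)))"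
      using elim by (auto intro!: continuous_on_ln_reg)
    have cu: "continuous_on (sphere 0 r) (\<lambda>z. log_plus (cmod (deriv F z / F z)))"
             "continuous_on (sphere 0 r) (\<lambda>z. log_plus (cmod (deriv G z / G z)))"
             "continuous_on (sphere 0 r) (\<lambda>z. log_plus (cmod (deriv H z / H z)))"
      using elim by (intro continuous_on_log_plus continuous_on_norm reg_deriv_continuous; simp)+
    have cE: "continuous_on (sphere 0 r) E"
      unfolding E_def by (intro continuous_on_add continuous_on_const cu)
    have EmE: "cmean r E = mE r"
      unfolding E_def mE_def prox_def
      by (simp only: cmean_add[OF continuous_on_const continuous_on_add[OF cu(1) continuous_on_add[OF cu(2,3)]] r(1)]
         cmean_add[OF cu(1) continuous_on_add[OF cu(2,3)] r(1)] cmean_add[OF cu(2,3) r(1)] cmean_const)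
    have diffbound: "ln (cmod w) \<le> ln (cmod s) + ln (cmod t) + (ln 2 + log_plus (cmod u) + log_plus (cmod v))"
      if "w = s * t * (u - v)" "w \<noteq> 0" for w s t u v :: complex
    proof -
      have "ln (cmod w) = ln (cmod s) + ln (cmod t) + ln (cmod (u - v))"
        using that by (simp add: norm_mult ln_mult)
      also have "ln (cmod (u - v)) \<le> log_plus (cmod (u - v))" by (rule ln_le_log_plus) auto
      also have "\<dots> \<le> log_plus (cmod u + cmod v)" by (intro log_plus_mono norm_triangle_ineq4)
      also have "\<dots> \<le> log_plus (cmod u) + log_plus (cmod v) + ln 2" by (intro log_plus_add_le) auto
      finally show ?thesis by simp
    qed
    have pt: "J z \<le> (ln (cmod (F z)) + ln (cmod (G z))) + (ln (cmod (H z)) - ln (cmod (W z))) + E z"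
      if z: "cmod z = r" for z
    proof -
      have nz: "F z \<noteq> 0" "G z \<noteq> 0" "H z \<noteq> 0" "W z \<noteq> 0" using elim z by (auto simp: reg_def)
      have "W z = F z * H z * (deriv H z / H z - deriv F z / F z)"
        using nz by (simp add: W1 field_simps)
      from diffbound[OF this nz(4)]
      have 1: "ln (cmod (W z)) \<le> ln (cmod (F z)) + ln (cmod (H z)) + E z"
        unfolding E_def using log_plus_nonneg[of "cmod (deriv G z / G z)"] by linarith
      have "W z = G z * H z * (deriv G z / G z - deriv H z / H z)"
        using nz by (simp add: W2 field_simps)
      from diffbound[OF this nz(4)]
      have 2: "ln (cmod (W z)) \<le> ln (cmod (G z)) + ln (cmod (H z)) + E z"
        unfolding E_def using log_plus_nonneg[of "cmod (deriv F z / F z)"] by linarith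
      show ?thesis using 1 2 unfolding J_def by (auto simp: max_def)
    qed
    have "cmean r J \<le> cmean r (\<lambda>z. (ln (cmod (F z)) + ln (cmod (G z))) + (ln (cmod (H z)) - ln (cmod (W z))) + E z)"
      by (intro cmean_mono elim(2) continuous_on_add continuous_on_diff cl cE r pt)
    also have "\<dots> = (cmean r (\<lambda>z. ln (cmod (F z))) + cmean r (\<lambda>z. ln (cmod (G z)))) +
                    (cmean r (\<lambda>z. ln (cmod (H z))) - cmean r (\<lambda>z. ln (cmod (W z)))) + mE r"
      using r by (simp only: cmean_add cmean_diff cl cE continuous_on_add continuous_on_diff EmE)
    finally have main: "cmean r J \<le> (cmean r (\<lambda>z. ln (cmod (F z))) + cmean r (\<lambda>z. ln (cmod (G z)))) +
                    (cmean r (\<lambda>z. ln (cmod (H z))) - cmean r (\<lambda>z. ln (cmod (W z)))) + mE r" .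
    define S where "S = ordsum r (zorder f)"
    have S0: "S \<ge> 0" unfolding S_def using r x0 by (intro ordsum_nonneg) auto
    have AH: "cmean r (\<lambda>z. ln (cmod (H z))) = real n * S + jensen_const H"
    proof -
      have "zorder H = (\<lambda>a. int n * zorder f a)" by (rule ext) (rule zH)
      hence "ordsum r (zorder H) = real n * S" using n by (simp add: ordsum_cmul S_def)
      thus ?thesis using jensen_formula[OF H r(2)] elim by simp
    qed
    have "ordsum r (\<lambda>a. (int n - 1) * zorder f a) \<le> ordsum r (zorder W)"
      using r zW fin_orders_zorder[OF fn] fin_orders_zorder[OF W]
      by (intro ordsum_mono) (auto intro: fin_orders_compose)
    hence AW: "cmean r (\<lambda>z. ln (cmod (W z))) \<ge> (real n - 1) * S + jensen_const W"
      using jensen_formula[OF W r(2)] elim n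
      by (subst (asm) ordsum_cmul) (auto simp: S_def)
    \<comment> \<open>|H| is at most twice the larger of |F| and |G|, while the mean of ln|H|
      contains n S; hence n S is at most J plus a constant.\<close>
    have "cmean r (\<lambda>z. ln (cmod (H z))) \<le> cmean r (\<lambda>z. J z + ln 2)"
    proof (intro cmean_mono cl continuous_on_add continuous_on_const elim(2) r)
      fix z assume z: "cmod z = r"
      have nz: "F z \<noteq> 0" "G z \<noteq> 0" "H z \<noteq> 0" using elim z by (auto simp: reg_def)
      have "cmod (H z) \<le> cmod (F z) + cmod (G z)" unfolding H_def by (rule norm_triangle_ineq)
      also have "\<dots> \<le> exp (J z) + exp (J z)"
        using nz by (intro add_mono) (auto simp: J_def ln_ge_iff [symmetric] le_max_iff_disj
             intro: order.trans[OF eq_refl[OF exp_ln [symmetric]]])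
      finally have "ln (cmod (H z)) \<le> ln (2 * exp (J z))" using nz by (intro ln_mono) auto
      thus "ln (cmod (H z)) \<le> J z + ln 2" by (simp add: ln_mult_pos)
    qed
    also have "\<dots> = cmean r J + ln 2" using r by (simp add: cmean_add elim(2))
    finally have "real n * S + jensen_const H \<le> cmean r J + ln 2" by (simp add: AH)
    \<comment> \<open>So S is at most half of J up to a constant. As the means of ln|H| and ln|W|
      differ by S, half of J remains on the left.\<close>
    moreover have "2 * S \<le> real n * S" using S0 n by (intro mult_right_mono) auto
    ultimately have "2 * S \<le> cmean r J + ln 2 - jensen_const H" by linarith
    moreover have "cmean r (\<lambda>z. ln (cmod (H z))) - cmean r (\<lambda>z. ln (cmod (W z))) \<le> S + jensen_const H - jensen_const W"
      using AH AW by (simp add: algebra_simps)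
    moreover have arith: "2 * s \<le> j + l - jh \<Longrightarrow> h - w \<le> s + jh - jw \<Longrightarrow> j \<le> (u + v) + (h - w) + e \<Longrightarrow>
        u \<le> pu \<Longrightarrow> v \<le> pv \<Longrightarrow> j \<le> 2 * (pu + pv + e) + (l + \<bar>jh\<bar> + 2 * \<bar>jw\<bar>)"
      for s j l jh h w jw u v e pu pv :: real
      using abs_ge_self[of jh] abs_ge_minus_self[of jw] by simp
    ultimately show ?case
      using main elim(3,4) unfolding F_def [symmetric] G_def [symmetric] by (intro arith)
  qed
  have growth: "\<forall>\<^sub>F r in ae_at_top. prox r F \<le> (1 + cmod b1) * r ^ k" "\<forall>\<^sub>F r in ae_at_top. prox r G \<le> (1 + cmod b2) * r ^ k"
    unfolding F_def G_def by (intro prox_expoly_le p)+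
  have growthH: "\<forall>\<^sub>F r in ae_at_top. prox r H \<le> ((1 + cmod b1) + (1 + cmod b2) + 1) * r ^ k"
    using growth eventually_ae_at_top_ge[of 1]
  proof eventually_elim
    case (elim r)
    have "prox r H \<le> prox r F + prox r G + ln 2"
      unfolding H_def using elim FG by (intro prox_add_le entire_continuous) auto
    moreover have "ln 2 \<le> (1::real)" using ln_le_minus_one[of "2::real"] by simp
    moreover have "1 \<le> r ^ k" using elim by simp
    ultimately show ?case using elim(1,2) unfolding ring_distribs by linarith
  qed
  have "negligible k mE"
    unfolding mE_def
    by (intro negligible_add negligible_const k log_derivative_negligible_polynomial_growth[OF FG(3) FG(1) k growth(1)]
       log_derivative_negligible_polynomial_growth[OF FG(4) FG(2) k growth(2)]
       log_derivative_negligible_polynomial_growth[OF H Hh k growthH])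
  hence "negligible k (\<lambda>r. 2 * (prox r p1 + prox r p2 + mE r) + (ln 2 + \<bar>jensen_const H\<bar> + 2 * \<bar>jensen_const W\<bar>))"
    by (intro negligible_add negligible_cmul negligible_const small_entire_negligible p k) auto
  from neglD[OF this, of "\<beta> / 2"] \<beta>
  have "\<forall>\<^sub>F r in ae_at_top. 2 * (prox r p1 + prox r p2 + mE r) + (ln 2 + \<bar>jensen_const H\<bar> + 2 * \<bar>jensen_const W\<bar>)
                    \<le> \<beta> / 2 * r ^ k" by simp
  with lower upper eventually_ae_at_top_gt[of 0] have "\<forall>\<^sub>F r in ae_at_top. False"
  proof eventually_elim
    case (elim r)
    have "\<beta> * r ^ k > 0" using \<beta> elim by simp
    thus ?case using elim by linarith
  qed
  thus False using ae_at_top_neq_bot by blast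
qed

section \<open>Four terms\<close>

definition wron3 :: "(complex \<Rightarrow> complex) \<Rightarrow> (complex \<Rightarrow> complex) \<Rightarrow> (complex \<Rightarrow> complex) \<Rightarrow> complex \<Rightarrow> complex" where
  "wron3 f g h z =
     f z * (deriv g z * deriv (deriv h) z - deriv (deriv g) z * deriv h z) -
     g z * (deriv f z * deriv (deriv h) z - deriv (deriv f) z * deriv h z) +
     h z * (deriv f z * deriv (deriv g) z - deriv (deriv f) z * deriv g z)"

lemma log_plus_power: "x \<ge> 0 \<Longrightarrow> log_plus (x ^ n) = real n * log_plus x"
proof (cases "x \<ge> 1")
  case True
  assume "x \<ge> 0"
  have "x ^ n \<ge> 1" using True by simp
  thus ?thesis using True by (simp add: log_plus_def max_def ln_realpow)
next
  case False
  assume "x \<ge> 0"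
  hence "x ^ n \<le> 1" using False by (simp add: power_le_one)
  thus ?thesis using False by (simp add: log_plus_def max_def)
qed

definition logder_weight :: "(complex \<Rightarrow> complex) \<Rightarrow> complex \<Rightarrow> real" where
  "logder_weight f z = log_plus (cmod (deriv f z / f z)) + log_plus (cmod (deriv (deriv f) z / f z))"

lemma logder_weight_nonneg: "logder_weight f z \<ge> 0"
  by (simp add: logder_weight_def)

text \<open>Dividing the Wronskian by f g h leaves six products of logarithmic derivatives, each
  dominated by the product Q of all factors max 1 |.|. The number w stands apart from the
  determinant because one W is compared with four Wronskians of equal modulus.\<close>

lemma ln_wron3_le:
  assumes nz: "f z \<noteq> 0" "g z \<noteq> 0" "h z \<noteq> 0" and w: "cmod w = cmod (wron3 f g h z)" "w \<noteq> 0"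
  shows   "ln (cmod w) \<le> ln (cmod (f z)) + ln (cmod (g z)) + ln (cmod (h z)) +
             (ln 6 + logder_weight f z + logder_weight g z + logder_weight h z)"
proof -
  define u where "u F = deriv F z / F z" for F
  define v where "v F = deriv (deriv F) z / F z" for F
  define X where "X F = max 1 (cmod (u F))" for F
  define Y where "Y F = max 1 (cmod (v F))" for F
  define D where "D = (u g * v h - v g * u h) - (u f * v h - v f * u h) + (u f * v g - v f * u g)"
  define Q where "Q = (X f * Y f) * (X g * Y g) * (X h * Y h)"
  have X: "X F \<ge> 1" "Y F \<ge> 1" "cmod (u F) \<le> X F" "cmod (v F) \<le> Y F" for F
    by (auto simp: X_def Y_def)
  have XY: "X F * Y F \<ge> 1" "X F \<le> X F * Y F" "Y F \<le> X F * Y F" for F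
    using X[of F] mult_mono[of 1 "X F" 1 "Y F"] by auto
  have W: "wron3 f g h z = f z * g z * h z * D"
    using nz by (simp add: wron3_def D_def u_def v_def field_simps)
  have uv: "cmod (u F * v G) \<le> (X F * Y F) * (X G * Y G)" for F G
    unfolding norm_mult
    by (intro mult_mono order.trans[OF X(3) XY(2)] order.trans[OF X(4) XY(3)])
       (use XY(1)[of F] in auto)
  have uv': "cmod (v F * u G) \<le> (X F * Y F) * (X G * Y G)" for F G
    using uv[of G F] by (simp add: mult.commute)
  have step: "x * y \<le> x * y * z" "x * z \<le> x * y * z" "y * z \<le> x * y * z" if "x \<ge> 1" "y \<ge> 1" "z \<ge> 1" for x y z :: real
  proof -
    have "x * y * 1 \<le> x * y * z" "x * 1 * z \<le> x * y * z" "1 * y * z \<le> x * y * z"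
      by (intro mult_mono mult_nonneg_nonneg; use that in linarith)+
    thus "x * y \<le> x * y * z" "x * z \<le> x * y * z" "y * z \<le> x * y * z" by auto
  qed
  have le: "cmod (u f * v g) \<le> Q" "cmod (v f * u g) \<le> Q" "cmod (u f * v h) \<le> Q"
           "cmod (v f * u h) \<le> Q" "cmod (u g * v h) \<le> Q" "cmod (v g * u h) \<le> Q"
    unfolding Q_def
    by (rule order.trans[OF uv step(1)] order.trans[OF uv' step(1)] order.trans[OF uv step(2)]
             order.trans[OF uv' step(2)] order.trans[OF uv step(3)] order.trans[OF uv' step(3)]; rule XY)+
  have "cmod D \<le> cmod ((u g * v h - v g * u h) - (u f * v h - v f * u h)) + cmod (u f * v g - v f * u g)"
    unfolding D_def by (rule norm_triangle_ineq)
  also have "cmod ((u g * v h - v g * u h) - (u f * v h - v f * u h)) \<le>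
             cmod (u g * v h - v g * u h) + cmod (u f * v h - v f * u h)"
    by (rule norm_triangle_ineq4)
  also have "cmod (u g * v h - v g * u h) \<le> cmod (u g * v h) + cmod (v g * u h)"
    by (rule norm_triangle_ineq4)
  also have "cmod (u f * v h - v f * u h) \<le> cmod (u f * v h) + cmod (v f * u h)"
    by (rule norm_triangle_ineq4)
  also have "cmod (u f * v g - v f * u g) \<le> cmod (u f * v g) + cmod (v f * u g)"
    by (rule norm_triangle_ineq4)
  finally have D: "cmod D \<le> 6 * Q" using le by linarith
  have pos: "X F > 0" "Y F > 0" for F using X(1,2)[of F] by linarith+
  have Dnz: "D \<noteq> 0" using w W by auto
  have "ln (cmod w) = ln (cmod (f z)) + ln (cmod (g z)) + ln (cmod (h z)) + ln (cmod D)"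
    using nz Dnz by (simp add: w W norm_mult ln_mult)
  also have "ln (cmod D) \<le> ln (6 * Q)" using D Dnz by (intro ln_mono) auto
  also have "\<dots> = ln 6 + logder_weight f z + logder_weight g z + logder_weight h z"
    using pos by (simp add: Q_def ln_mult_pos logder_weight_def log_plus_def X_def Y_def u_def v_def less_max_iff_disj)
  finally show ?thesis by simp
qed

lemma higher_deriv_linear_combination:
  assumes an: "reg f z" "reg g z" "reg h z"
    and eq: "\<forall>\<^sub>F w in nhds z. k w = f w + g w - h w"
  shows   "deriv k z = deriv f z + deriv g z - deriv h z"
    and   "deriv (deriv k) z = deriv (deriv f) z + deriv (deriv g) z - deriv (deriv h) z"
proof -
  have lin: "deriv (\<lambda>w. f w + g w - h w) w = deriv f w + deriv g w - deriv h w"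
    if "f analytic_on {w}" "g analytic_on {w}" "h analytic_on {w}" for f g h :: "complex \<Rightarrow> complex" and w
    using that by (intro DERIV_imp_deriv DERIV_add DERIV_diff)
      (auto simp: DERIV_deriv_iff_field_differentiable analytic_on_imp_differentiable_at)
  have an': "\<forall>\<^sub>F w in nhds z. reg f w \<and> reg g w \<and> reg h w"
    using reg_eventually_nhds[OF an(1)] reg_eventually_nhds[OF an(2)] reg_eventually_nhds[OF an(3)]
    by eventually_elim auto
  have "\<forall>\<^sub>F w in nhds z. \<forall>\<^sub>F v in nhds w. k v = f v + g v - h v"
    using eq by (simp add: eventually_eventually)
  hence d: "\<forall>\<^sub>F w in nhds z. deriv k w = deriv f w + deriv g w - deriv h w"
    using an'
  proof eventually_elim
    case (elim w)
    have "deriv k w = deriv (\<lambda>w. f w + g w - h w) w" by (rule deriv_cong_ev[OF elim(1) refl])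
    thus ?case using elim by (simp add: lin reg_def)
  qed
  thus "deriv k z = deriv f z + deriv g z - deriv h z" by (rule eventually_nhds_x_imp_x)
  have "deriv (deriv k) z = deriv (\<lambda>w. deriv f w + deriv g w - deriv h w) z"
    by (rule deriv_cong_ev[OF d refl])
  also have "\<dots> = deriv (deriv f) z + deriv (deriv g) z - deriv (deriv h) z"
    using an by (intro lin) (auto simp: reg_def intro: analytic_deriv)
  finally show "deriv (deriv k) z = deriv (deriv f) z + deriv (deriv g) z - deriv (deriv h) z" .
qed

text \<open>Replacing a column by a linear combination dictated by the relation changes the
  determinant only in sign. Thus any three of the four functions give the same modulus, and each of
  the four can be the one left out.\<close>

lemma wron3_relation:
  assumes "reg f0 z" "reg f1 z" "reg f2 z" "\<forall>\<^sub>F w in nhds z. f3 w = f0 w + f1 w - f2 w"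
  shows   "cmod (wron3 f0 f1 f2 z) = cmod (wron3 f0 f1 f3 z)"
    and   "cmod (wron3 f0 f1 f2 z) = cmod (wron3 f0 f2 f3 z)"
    and   "cmod (wron3 f0 f1 f2 z) = cmod (wron3 f1 f2 f3 z)"
proof -
  have v: "f3 z = f0 z + f1 z - f2 z" using assms(4) by (rule eventually_nhds_x_imp_x)
  note d = higher_deriv_linear_combination[OF assms]
  have "wron3 f0 f1 f3 z = - wron3 f0 f1 f2 z" "wron3 f0 f2 f3 z = - wron3 f0 f1 f2 z"
       "wron3 f1 f2 f3 z = wron3 f0 f1 f2 z"
    unfolding wron3_def v d by (simp_all add: algebra_simps)
  thus "cmod (wron3 f0 f1 f2 z) = cmod (wron3 f0 f1 f3 z)"
       "cmod (wron3 f0 f1 f2 z) = cmod (wron3 f0 f2 f3 z)"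
       "cmod (wron3 f0 f1 f2 z) = cmod (wron3 f1 f2 f3 z)" by simp_all
qed

text \<open>Here x is the order of the base and n x that of its power. Two derivatives lose at most
  two orders, and none where x = 0. For x > 0 one has n x - 2 >= (n - 2) x; for x < 0 one has n x -
  2 >= (n + 2) x, which is (n - 2) x minus 4 times -x. The exponent e merges these cases.\<close>

lemma ord_ge_power_column:
  assumes F: "ord_ge F a (int n * x)" and n: "n \<ge> 2"
  defines "e \<equiv> (int n - 2) * x - 4 * max 0 (-x)"
  shows   "ord_ge F a e" "ord_ge (deriv F) a e" "ord_ge (deriv (deriv F)) a e"
proof -
  have 1: "ord_ge (deriv F) a (int n * x - 1)" by (rule ord_ge_deriv[OF F])
  have 2: "ord_ge (deriv (deriv F)) a (int n * x - 2)" using ord_ge_deriv[OF 1] by simp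
  consider "x = 0" | "x \<noteq> 0" "e \<le> int n * x - 2"
  proof (cases "x > 0")
    case False
    thus ?thesis using that by (cases "x = 0") (auto simp: e_def left_diff_distrib)
  qed (use that in \<open>auto simp: e_def left_diff_distrib\<close>)
  hence "ord_ge F a e \<and> ord_ge (deriv F) a e \<and> ord_ge (deriv (deriv F)) a e"
  proof cases
    case 1
    hence "ord_ge F a 0" "e = 0" using F by (simp_all add: e_def)
    thus ?thesis by (auto intro: ord_ge_deriv_0)
  next
    case 2
    show ?thesis
      using 2(2) by (intro conjI ord_ge_mono[OF F] ord_ge_mono[OF \<open>ord_ge (deriv F) a (int n * x - 1)\<close>]
         ord_ge_mono[OF \<open>ord_ge (deriv (deriv F)) a (int n * x - 2)\<close>]) auto
  qed
  thus "ord_ge F a e" "ord_ge (deriv F) a e" "ord_ge (deriv (deriv F)) a e" by auto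
qed

text \<open>Each product in the determinant has one factor from each column, so the bounds of the
  columns add up.\<close>

lemma ord_ge_wron3:
  assumes "ord_ge f a e" "ord_ge (deriv f) a e" "ord_ge (deriv (deriv f)) a e"
    and   "ord_ge g a d" "ord_ge (deriv g) a d" "ord_ge (deriv (deriv g)) a d"
    and   "ord_ge h a 0"
  shows   "ord_ge (wron3 f g h) a (e + d)"
proof -
  have h: "ord_ge (deriv h) a 0" "ord_ge (deriv (deriv h)) a 0"
    using assms(7) by (auto intro: ord_ge_deriv_0)
  have m: "ord_ge (\<lambda>z. u z * v z) a d" if "ord_ge u a d" "ord_ge v a 0" for u v
    using ord_ge_mult[OF that] by simp
  have m': "ord_ge (\<lambda>z. u z * v z) a (e + d)" if "ord_ge u a 0" "ord_ge v a (e + d)" for u v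
    using ord_ge_mult[OF that] by simp
  have m'': "ord_ge (\<lambda>z. u z * v z) a e" if "ord_ge u a e" "ord_ge v a 0" for u v
    using ord_ge_mult[OF that] by simp
  have "ord_ge (\<lambda>z. g z * (deriv f z * deriv (deriv h) z - deriv (deriv f) z * deriv h z)) a (d + e)"
    by (intro ord_ge_mult ord_ge_diff m'' assms h)
  hence 2: "ord_ge (\<lambda>z. g z * (deriv f z * deriv (deriv h) z - deriv (deriv f) z * deriv h z)) a (e + d)"
    by (simp only: add.commute)
  have "ord_ge (\<lambda>z. deriv g z * deriv (deriv h) z - deriv (deriv g) z * deriv h z) a d"
    by (intro ord_ge_diff m assms h)
  from ord_ge_mult[OF assms(1) this]
  have 1: "ord_ge (\<lambda>z. f z * (deriv g z * deriv (deriv h) z - deriv (deriv g) z * deriv h z)) a (e + d)" .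
  have 3: "ord_ge (\<lambda>z. h z * (deriv f z * deriv (deriv g) z - deriv (deriv f) z * deriv g z)) a (e + d)"
    by (rule m'[OF assms(7)]) (intro ord_ge_diff ord_ge_mult assms)
  show ?thesis
    unfolding wron3_def [abs_def] by (rule ord_ge_add[OF ord_ge_diff[OF 1 2] 3])
qed

text \<open>An exceptional set of finite measure cannot contain almost all of a half-line. Hence the
  estimate by S(r,f) and a property of almost all large radii hold together at some radius.\<close>

lemma is_S_meets_ae_at_top:
  assumes S: "is_S h f" and P: "\<forall>\<^sub>F r in ae_at_top. P r" and \<epsilon>: "\<epsilon> > 0"
  shows   "\<exists>r. P r \<and> \<bar>h r\<bar> \<le> \<epsilon> * \<bar>nevanlinna_char r f\<bar>"
proof -
  obtain E where E: "E \<in> lmeasurable"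
    and o: "h \<in> o[inf at_top (principal (- E))](\<lambda>r. nevanlinna_char r f)"
    using S by (auto simp: is_S_def)
  from landau_o.smallD[OF o \<epsilon>] obtain r1 where r1: "\<And>r. r \<ge> r1 \<Longrightarrow> r \<notin> E \<Longrightarrow> \<bar>h r\<bar> \<le> \<epsilon> * \<bar>nevanlinna_char r f\<bar>"
    by (auto simp: eventually_inf_principal eventually_at_top_linorder)
  obtain r0 where r0: "AE r in lborel. r \<ge> r0 \<longrightarrow> P r" using P by (auto simp: eventually_ae_at_top)
  show ?thesis
  proof (rule ccontr)
    assume *: "\<not> ?thesis"
    define c where "c = max r0 r1"
    \<comment> \<open>The interval from c to d is longer by 1 than the measure of E.\<close>
    define d where "d = c + measure lebesgue E + 1"
    from r0 have "AE r in lebesgue. r \<ge> r0 \<longrightarrow> P r" by (rule AE_completion)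
    hence "AE r in lebesgue. r \<in> {c..d} \<longrightarrow> r \<in> E"
    proof eventually_elim
      case (elim r)
      show ?case
      proof (intro impI, rule ccontr)
        assume "r \<in> {c..d}" "r \<notin> E"
        thus False using * elim r1[of r] by (auto simp: c_def)
      qed
    qed
    hence "emeasure lebesgue {c..d} \<le> emeasure lebesgue E"
      using E by (intro emeasure_mono_AE) auto
    also have "\<dots> = ennreal (measure lebesgue E)"
      using E by (intro emeasure_eq_measure2) (auto simp: fmeasurable_def)
    finally have "ennreal (d - c) \<le> ennreal (measure lebesgue E)"
      by (simp add: d_def)
    thus False by (simp add: d_def)
  qed
qed

text \<open>The quantitative outcome is J <= (4/5) J + 8 N(r,f) + o(r^k), that is J <= 40 N(r,f) +
  o(r^k). Since T(r,f) is bounded by J, r^k and N(r,f), a radius at which N(r,f) is a small fraction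
  of T(r,f) contradicts the lower bound for J.\<close>

theorem wron3_not_nzmero:
  assumes k: "k \<ge> 1" and n: "n > 4" and p: "small_entire k p1" "small_entire k p2" and b: "b1 \<noteq> b2"
    and a: "a \<noteq> 0" and f: "nzmero f" and g: "nzmero g"
    and eq: "\<forall>\<^sub>F z in cosparse UNIV. f z ^ n + a * g z ^ n = expoly k p1 b1 z + expoly k p2 b2 z"
    and ho: "hyper_order f < 1" and N: "is_S (\<lambda>r. pole_counting r f) f"
  shows "\<not> nzmero (wron3 (\<lambda>z. f z ^ n) (\<lambda>z. a * g z ^ n) (expoly k p1 b1))"
proof
  define F0 where "F0 = (\<lambda>z. f z ^ n)"
  define F1 where "F1 = (\<lambda>z. a * g z ^ n)"
  define F2 where "F2 = expoly k p1 b1"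
  define F3 where "F3 = expoly k p2 b2"
  define W where "W = wron3 F0 F1 F2"
  assume "nzmero (wron3 (\<lambda>z. f z ^ n) (\<lambda>z. a * g z ^ n) (expoly k p1 b1))"
  hence W: "nzmero W" by (simp add: W_def F0_def F1_def F2_def)
  have nz: "nzmero F0" "nzmero F1" "nzmero F2" "nzmero F3"
    unfolding F0_def F1_def F2_def F3_def
    using f g a p by (auto intro: nzmero_power nzmero_mult nzmero_const expoly_nzmero)
  have hol: "F2 holomorphic_on UNIV" "F3 holomorphic_on UNIV"
    unfolding F2_def F3_def using p by (auto intro: expoly_holomorphic)
  have eq': "\<forall>\<^sub>F z in cosparse UNIV. F3 z = F0 z + F1 z - F2 z"
    using eq by eventually_elim (auto simp: F0_def F1_def F2_def F3_def algebra_simps)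
  have zF0: "zorder F0 x = int n * zorder f x" for x
    unfolding F0_def using f by (intro zorder_power) (auto simp: nzmero_frequently_at)
  have zF1: "zorder F1 x = int n * zorder g x" for x
  proof -
    have "zorder F1 x = zorder (\<lambda>_. a) x + zorder (\<lambda>z. g z ^ n) x"
      unfolding F1_def
      by (intro zorder_mult nzmero_mero nzmero_frequently_at nzmero_power nzmero_const a g)
    thus ?thesis using a g by (simp add: zorder_power nzmero_frequently_at)
  qed
  have oF2: "ord_ge F2 x 0" "ord_ge F3 x 0" for x
    using ord_ge_mono[OF ord_ge_zorder] entire_zorder_nonneg(1) hol nz by blast+
  \<comment> \<open>Near x, \<open>F1\<close> is \<open>F2 + F3 - F0\<close> with \<open>F2\<close>
    and \<open>F3\<close> entire, so the poles of g^n come from f^n with at most the same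
    order.\<close>
  have gf: "pole_order g x \<le> pole_order f x" for x
  proof -
    define m where "m = min 0 (int n * zorder f x)"
    have "ord_ge (\<lambda>z. F2 z + F3 z - F0 z) x m"
      using ord_ge_zorder[OF nz(1), of x] unfolding zF0 m_def
      by (intro ord_ge_diff ord_ge_add) (auto intro: ord_ge_mono[OF oF2(1)] ord_ge_mono[OF oF2(2)] ord_ge_mono)
    hence "ord_ge F1 x m"
    proof (rule ord_ge_cong)
      show "\<forall>\<^sub>F z in at x. F2 z + F3 z - F0 z = F1 z"
        using eventually_cosparse_imp_eventually_at[OF eq', of x UNIV] by (auto elim!: eventually_mono)
    qed
    hence "m \<le> int n * zorder g x" using zorder_geI[OF nz(2)] by (simp add: zF1)
    moreover have "m = int n * min 0 (zorder f x)"
      by (simp add: m_def min_def zero_le_mult_iff mult_le_0_iff)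
    ultimately have "min 0 (zorder f x) \<le> zorder g x" using n by simp
    thus ?thesis by (auto simp: pole_order_def)
  qed
  \<comment> \<open>The 8 consists of 4 for each of the two power columns, the pole orders of g
    being bounded by those of f. The third column is entire and costs nothing.\<close>
  have zW: "(int n - 2) * zorder f x + ((int n - 2) * zorder g x + (- 8) * pole_order f x) \<le> zorder W x" for x
  proof (rule zorder_geI[OF W])
    have n2: "n \<ge> 2" using n by simp
    have o0: "ord_ge F0 x (int n * zorder f x)" using ord_ge_zorder[OF nz(1), of x] by (simp add: zF0)
    have o1: "ord_ge F1 x (int n * zorder g x)" using ord_ge_zorder[OF nz(2), of x] by (simp add: zF1)
    have "ord_ge W x (((int n - 2) * zorder f x - 4 * max 0 (- zorder f x)) +
                      ((int n - 2) * zorder g x - 4 * max 0 (- zorder g x)))"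
      unfolding W_def by (intro ord_ge_wron3 ord_ge_power_column o0 o1 n2 oF2)
    thus "ord_ge W x ((int n - 2) * zorder f x + ((int n - 2) * zorder g x + (- 8) * pole_order f x))"
      by (rule ord_ge_mono) (use gf[of x] in \<open>simp add: pole_order_def\<close>)
  qed

  \<comment> \<open>The relation is recorded on a neighbourhood of each point of the circle, because
    it will be differentiated twice.\<close>
  have good: "\<forall>\<^sub>F r in ae_at_top. \<forall>z. cmod z = r \<longrightarrow> reg f z \<and> reg g z \<and> reg F0 z \<and> reg F1 z \<and> reg F2 z \<and> reg F3 z \<and> reg W z \<and>
                  (\<forall>\<^sub>F w in nhds z. F3 w = F0 w + F1 w - F2 w)"
  proof -
    have "\<forall>\<^sub>F z in cosparse UNIV. \<forall>\<^sub>F w in nhds z. F3 w = F0 w + F1 w - F2 w"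
      using eq'
    proof eventually_elim
      case (elim z)
      moreover have "\<forall>\<^sub>F w in at z. F3 w = F0 w + F1 w - F2 w"
        by (rule eventually_cosparse_imp_eventually_at[OF eq']) auto
      ultimately show ?case by (simp add: eventually_nhds_conv_at)
    qed
    from eventually_cosparse_imp_ae_at_top[OF this] nzmero_ae_at_top[OF f] nzmero_ae_at_top[OF g]
      nzmero_ae_at_top[OF nz(1)] nzmero_ae_at_top[OF nz(2)] nzmero_ae_at_top[OF nz(3)] nzmero_ae_at_top[OF nz(4)] nzmero_ae_at_top[OF W]
    show ?thesis by eventually_elim blast
  qed

  obtain \<delta> where \<delta>: "0 < \<delta>" "\<delta> < 1" and growth: "\<forall>\<^sub>F r in ae_at_top. nchar r f \<le> exp (r powr \<delta>)"
    using hyper_order_imp_nchar[OF f ho] by blast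
  have \<delta>k: "\<delta> < real k" using \<delta> k by simp
  have g2: "\<forall>\<^sub>F r in ae_at_top. prox r F2 \<le> (1 + cmod b1) * r ^ k" and g3: "\<forall>\<^sub>F r in ae_at_top. prox r F3 \<le> (1 + cmod b2) * r ^ k"
    unfolding F2_def F3_def by (intro prox_expoly_le p)+
  define K where "K = (1 + cmod b1) + (1 + cmod b2) + 2"
  have chr0: "\<forall>\<^sub>F r in ae_at_top. nchar r F0 = real n * nchar r f"
    using good eventually_ae_at_top_ge[of 0]
  proof eventually_elim
    case (elim r)
    have "prox r F0 = real n * prox r f"
      unfolding prox_def F0_def by (simp add: norm_power log_plus_power cmean_cmul)
    moreover have "pole_order F0 = (\<lambda>x. int n * pole_order f x)"
      using n by (auto simp: fun_eq_iff pole_order_def zF0 max_def mult_less_0_iff zero_less_mult_iff not_le)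
    hence "ordsum r (pole_order F0) = real n * ordsum r (pole_order f)" using n by (simp add: ordsum_cmul)
    ultimately show ?case by (simp add: nchar_def ring_distribs)
  qed
  have chr1: "\<forall>\<^sub>F r in ae_at_top. nchar r F1 \<le> real n * nchar r f + K * r ^ k"
    using good eventually_ae_at_top_ge[of 1] g2 g3
  proof eventually_elim
    case (elim r)
    have cont: "continuous_on (sphere 0 r) F0" "continuous_on (sphere 0 r) F1" "continuous_on (sphere 0 r) F2"
         "continuous_on (sphere 0 r) F3" "continuous_on (sphere 0 r) f"
      using elim by (auto intro!: continuous_on_reg)
    have r0: "r \<ge> 0" using elim by simp
    have "prox r F1 = prox r (\<lambda>z. (F2 z + F3 z) + (- F0 z))"
      unfolding prox_def
    proof (rule cmean_cong)
      fix z assume "cmod z = r"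
      hence "F3 z = F0 z + F1 z - F2 z" using elim(1) eventually_nhds_x_imp_x by blast
      thus "log_plus (cmod (F1 z)) = log_plus (cmod (F2 z + F3 z + - F0 z))" by simp
    qed (use r0 in auto)
    also have "\<dots> \<le> prox r (\<lambda>z. F2 z + F3 z) + prox r (\<lambda>z. - F0 z) + ln 2"
      using cont r0 by (intro prox_add_le continuous_on_add continuous_on_minus)
    also have "prox r (\<lambda>z. - F0 z) = real n * prox r f"
      unfolding prox_def F0_def by (simp add: norm_power log_plus_power cmean_cmul)
    also have "prox r (\<lambda>z. F2 z + F3 z) \<le> prox r F2 + prox r F3 + ln 2"
      using cont r0 by (intro prox_add_le)
    finally have "prox r F1 \<le> prox r F2 + prox r F3 + ln 2 + real n * prox r f + ln 2" by simp
    moreover have "ln 2 \<le> (1::real)" using ln_le_minus_one[of "2::real"] by simp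
    moreover have "1 \<le> r ^ k" using elim by simp
    ultimately have m: "prox r F1 \<le> real n * prox r f + K * r ^ k"
      using elim(3,4) unfolding K_def ring_distribs by linarith
    have "pole_order F1 x \<le> int n * pole_order f x" for x
    proof -
      have "pole_order F1 x = int n * pole_order g x"
        using n by (auto simp: fun_eq_iff pole_order_def zF1 max_def mult_less_0_iff zero_less_mult_iff not_le)
      thus ?thesis using gf[of x] by (simp add: mult_left_mono)
    qed
    hence "ordsum r (pole_order F1) \<le> ordsum r (\<lambda>x. int n * pole_order f x)"
      using elim fin_orders_pole_order[OF nz(2)] fin_orders_pole_order[OF f]
      by (intro ordsum_mono) (auto intro: fin_orders_compose)
    also have "\<dots> = real n * ordsum r (pole_order f)" using n by (simp add: ordsum_cmul)
    finally show ?case using m by (simp add: nchar_def ring_distribs)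
  qed
  \<comment> \<open>One unit is the growth of f itself; n + 1 further units absorb the factor n + 1
    by means of x + 1 <= exp x.\<close>
  define C where "C = real n + 2"
  have bigger: "\<forall>\<^sub>F r in ae_at_top. nchar r F0 \<le> exp (C * r powr \<delta>)" "\<forall>\<^sub>F r in ae_at_top. nchar r F1 \<le> exp (C * r powr \<delta>)"
  proof -
    have "filterlim (\<lambda>r. r powr \<delta>) at_top at_top" using \<delta>(1) by real_asymp
    hence "\<forall>\<^sub>F r in ae_at_top. r powr \<delta> \<ge> 1"
      by (intro eventually_at_top_imp_ae_at_top) (auto simp: filterlim_at_top)
    hence *: "\<forall>\<^sub>F r in ae_at_top. (real n + 1) * exp (r powr \<delta>) \<le> exp (C * r powr \<delta>)"
    proof eventually_elim
      case (elim r)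
      have "real n + 1 \<le> 1 + (real n + 1) * r powr \<delta>" using mult_left_mono[OF elim, of "real n + 1"] by (simp add: algebra_simps)
      also have "\<dots> \<le> exp ((real n + 1) * r powr \<delta>)" by (rule exp_ge_add_one_self)
      finally have "(real n + 1) * exp (r powr \<delta>) \<le> exp ((real n + 1) * r powr \<delta>) * exp (r powr \<delta>)"
        by (intro mult_right_mono) auto
      thus ?case by (simp add: C_def exp_add [symmetric] algebra_simps)
    qed
    from * chr0 growth show "\<forall>\<^sub>F r in ae_at_top. nchar r F0 \<le> exp (C * r powr \<delta>)"
    proof eventually_elim
      case (elim r)
      have "real n * nchar r f \<le> real n * exp (r powr \<delta>)" using elim by (intro mult_left_mono) auto
      thus ?case using elim exp_gt_zero[of "r powr \<delta>"] unfolding ring_distribs by linarith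
    qed
    from * chr1 growth eventually_at_top_imp_ae_at_top[OF power_le_exp_powr[OF \<delta>(1), of K k]]
    show "\<forall>\<^sub>F r in ae_at_top. nchar r F1 \<le> exp (C * r powr \<delta>)"
    proof eventually_elim
      case (elim r)
      have "real n * nchar r f \<le> real n * exp (r powr \<delta>)" using elim by (intro mult_left_mono) auto
      thus ?case using elim unfolding ring_distribs by linarith
    qed
  qed
  have C: "C > 0" by (simp add: C_def)
  have ld: "negligible k (\<lambda>r. prox r (\<lambda>z. deriv F z / F z))" "negligible k (\<lambda>r. prox r (\<lambda>z. deriv (deriv F) z / F z))"
    if "F \<in> {F0, F1, F2, F3}" for F
    using that log_derivative_negligible[OF nz(1) \<delta>(1) \<delta>k bigger(1) C] log_derivative_negligible[OF nz(2) \<delta>(1) \<delta>k bigger(2) C]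
      log_derivative_negligible_polynomial_growth[OF nz(3) hol(1) k g2]
      log_derivative_negligible_polynomial_growth[OF nz(4) hol(2) k g3]
    by (elim insertE; simp)+
  define w where "w F r = prox r (\<lambda>z. deriv F z / F z) + prox r (\<lambda>z. deriv (deriv F) z / F z)" for F r
  define E where "E z = ln 6 + (logder_weight F0 z + (logder_weight F1 z + (logder_weight F2 z + logder_weight F3 z)))" for z
  define mE where "mE r = ln 6 + (w F0 r + (w F1 r + (w F2 r + w F3 r)))" for r
  have mE_negligible: "negligible k mE"
    unfolding mE_def w_def by (intro negligible_add negligible_const k ld) auto
  define J where "J z = max (max (ln (cmod (F0 z))) (ln (cmod (F1 z)))) (max (ln (cmod (F2 z))) (ln (cmod (F3 z))))" for z
  have Jcont: "\<forall>\<^sub>F r in ae_at_top. continuous_on (sphere 0 r) J"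
    using good by eventually_elim (auto simp: J_def intro!: continuous_on_max continuous_on_ln_reg)
  define \<beta> where "\<beta> = cmod (b2 - b1) / 8"
  have \<beta>: "\<beta> > 0" using b by (simp add: \<beta>_def)
  have lower: "\<forall>\<^sub>F r in ae_at_top. \<beta> * r ^ k \<le> cmean r J"
  proof -
    have "ln (cmod (p1 z * exp (b1 * z ^ k))) \<le> J z \<and> ln (cmod (p2 z * exp (b2 * z ^ k))) \<le> J z" for z
      by (simp add: J_def F2_def F3_def expoly_def le_max_iff_disj)
    thus ?thesis
      unfolding \<beta>_def using Jcont by (intro two_exponentials_lower_bound[OF k p b]) auto
  qed
  \<comment> \<open>7/5 = 1 + 2/5: ln|a| occurs once in the mean of ln|F1| and again, with weight
    2/n <= 2/5, when the mean of ln|g| is bounded through J.\<close>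
  define c0 where "c0 = \<bar>jensen_const W\<bar> + (real n * \<bar>jensen_const f\<bar> + real n * \<bar>jensen_const g\<bar>) + 7/5 * \<bar>ln (cmod a)\<bar>"
  have upper: "\<forall>\<^sub>F r in ae_at_top. cmean r J \<le> 40 * ordsum r (pole_order f) + 5 * (prox r p1 + prox r p2 + mE r + c0)"
    using good Jcont cmean_ln_expoly_le[OF p(1) k, of b1] cmean_ln_expoly_le[OF p(2) k, of b2] eventually_ae_at_top_ge[of 1] lower
  proof eventually_elim
    case (elim r)
    have r: "r \<ge> 0" "r > 0" "r \<ge> 1" using elim by auto
    have cl: "continuous_on (sphere 0 r) (\<lambda>z. ln (cmod (F z)))" if "F \<in> {F0, F1, F2, F3, W, f, g}" for F
      using that elim by (intro continuous_on_ln_reg) auto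
    have cu: "continuous_on (sphere 0 r) (\<lambda>z. log_plus (cmod (deriv F z / F z)))"
             "continuous_on (sphere 0 r) (\<lambda>z. log_plus (cmod (deriv (deriv F) z / F z)))" if "F \<in> {F0, F1, F2, F3}" for F
      using that elim by (intro continuous_on_log_plus continuous_on_norm reg_deriv_continuous; force)+
    have cw: "continuous_on (sphere 0 r) (logder_weight F)" if "F \<in> {F0, F1, F2, F3}" for F
      unfolding logder_weight_def by (intro continuous_on_add cu that)
    have mw: "cmean r (logder_weight F) = w F r" if "F \<in> {F0, F1, F2, F3}" for F
      unfolding logder_weight_def w_def prox_def by (intro cmean_add cu that r)
    have cE: "continuous_on (sphere 0 r) E"
      unfolding E_def by (intro continuous_on_add continuous_on_const cw) auto
    have EmE: "cmean r E = mE r"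
      unfolding E_def mE_def
      by (subst cmean_add; (intro continuous_on_add continuous_on_const cw r; simp)?)+ (simp add: mw)
    have pt: "J z \<le> ((ln (cmod (F0 z)) + ln (cmod (F1 z))) + (ln (cmod (F2 z)) + ln (cmod (F3 z)))) - ln (cmod (W z)) + E z"
      if z: "cmod z = r" for z
    proof -
      have reg: "reg F0 z" "reg F1 z" "reg F2 z" and ev: "\<forall>\<^sub>F w in nhds z. F3 w = F0 w + F1 w - F2 w"
        using elim z by auto
      have ne: "F0 z \<noteq> 0" "F1 z \<noteq> 0" "F2 z \<noteq> 0" "F3 z \<noteq> 0" "W z \<noteq> 0"
        using elim z by (auto simp: reg_def)
      note rel = wron3_relation[OF reg ev, folded W_def]
      note nn = logder_weight_nonneg[of F0 z] logder_weight_nonneg[of F1 z]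
        logder_weight_nonneg[of F2 z] logder_weight_nonneg[of F3 z]
      have "ln (cmod (F3 z)) \<le> ((ln (cmod (F0 z)) + ln (cmod (F1 z))) + (ln (cmod (F2 z)) + ln (cmod (F3 z)))) - ln (cmod (W z)) + E z"
        using ln_wron3_le[of F0 z F1 F2 "W z", OF ne(1,2,3) _ ne(5)] nn unfolding W_def E_def by simp
      moreover have "ln (cmod (F2 z)) \<le> ((ln (cmod (F0 z)) + ln (cmod (F1 z))) + (ln (cmod (F2 z)) + ln (cmod (F3 z)))) - ln (cmod (W z)) + E z"
        using ln_wron3_le[of F0 z F1 F3 "W z", OF ne(1,2,4) rel(1) ne(5)] nn unfolding E_def by simp
      moreover have "ln (cmod (F1 z)) \<le> ((ln (cmod (F0 z)) + ln (cmod (F1 z))) + (ln (cmod (F2 z)) + ln (cmod (F3 z)))) - ln (cmod (W z)) + E z"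
        using ln_wron3_le[of F0 z F2 F3 "W z", OF ne(1,3,4) rel(2) ne(5)] nn unfolding E_def by simp
      moreover have "ln (cmod (F0 z)) \<le> ((ln (cmod (F0 z)) + ln (cmod (F1 z))) + (ln (cmod (F2 z)) + ln (cmod (F3 z)))) - ln (cmod (W z)) + E z"
        using ln_wron3_le[of F1 z F2 F3 "W z", OF ne(2,3,4) rel(3) ne(5)] nn unfolding E_def by simp
      ultimately show ?thesis unfolding J_def by (simp add: max_def)
    qed
    define A where "A F = cmean r (\<lambda>z. ln (cmod (F z)))" for F
    have "cmean r J \<le> cmean r (\<lambda>z. ((ln (cmod (F0 z)) + ln (cmod (F1 z))) + (ln (cmod (F2 z)) + ln (cmod (F3 z)))) - ln (cmod (W z)) + E z)"
      by (intro cmean_mono elim(2) continuous_on_add continuous_on_diff cl cE r pt) auto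
    also have "\<dots> = ((A F0 + A F1) + (A F2 + A F3)) - A W + mE r"
    proof -
      have cl': "continuous_on (sphere 0 r) (\<lambda>z. ln (cmod (F0 z)))" "continuous_on (sphere 0 r) (\<lambda>z. ln (cmod (F1 z)))"
        "continuous_on (sphere 0 r) (\<lambda>z. ln (cmod (F2 z)))" "continuous_on (sphere 0 r) (\<lambda>z. ln (cmod (F3 z)))"
        "continuous_on (sphere 0 r) (\<lambda>z. ln (cmod (W z)))" by (intro cl; simp)+
      show ?thesis unfolding A_def
        using r(1) by (simp only: cmean_add cmean_diff cl' cE continuous_on_add continuous_on_diff EmE)
    qed
    finally have main: "cmean r J \<le> ((A F0 + A F1) + (A F2 + A F3)) - A W + mE r" .
    have A23: "A F2 \<le> prox r p1" "A F3 \<le> prox r p2"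
      using elim(3,4) by (simp_all add: A_def F2_def F3_def)
    have AJ: "A F0 \<le> cmean r J" "A F1 \<le> cmean r J"
      unfolding A_def by (intro cmean_mono elim(2) cl r; simp add: J_def)+
    have A0: "A F0 = real n * A f"
    proof -
      have "A F0 = cmean r (\<lambda>z. real n * ln (cmod (f z)))"
        unfolding A_def using elim r
        by (intro cmean_cong) (auto simp: F0_def norm_power ln_realpow reg_def)
      thus ?thesis by (simp add: cmean_cmul A_def)
    qed
    have A1: "A F1 = ln (cmod a) + real n * A g"
    proof -
      have "A F1 = cmean r (\<lambda>z. ln (cmod a) + real n * ln (cmod (g z)))"
        unfolding A_def using elim r a
        by (intro cmean_cong) (auto simp: F1_def norm_mult norm_power ln_mult ln_realpow reg_def)
      also have "\<dots> = ln (cmod a) + real n * A g"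
        using r cl[of g] by (subst cmean_add) (auto simp: cmean_cmul A_def intro!: continuous_on_mult continuous_on_const)
      finally show ?thesis .
    qed
    define Np where "Np = ordsum r (pole_order f)"
    have jf: "A f = ordsum r (zorder f) + jensen_const f" "A g = ordsum r (zorder g) + jensen_const g"
             "A W = ordsum r (zorder W) + jensen_const W"
      unfolding A_def using elim r f g W by (auto intro!: jensen_formula)
    have fo: "fin_orders (\<lambda>x. (int n - 2) * zorder f x)" "fin_orders (\<lambda>x. (int n - 2) * zorder g x)"
             "fin_orders (\<lambda>x. (- 8) * pole_order f x)"
      using fin_orders_zorder[OF f] fin_orders_zorder[OF g] fin_orders_pole_order[OF f]
      by (auto intro: fin_orders_compose)
    have fo2: "fin_orders (\<lambda>x. (int n - 2) * zorder g x + (- 8) * pole_order f x)"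
      by (rule fin_orders_compose2[OF fo(2,3)]) auto
    have fo3: "fin_orders (\<lambda>x. (int n - 2) * zorder f x + ((int n - 2) * zorder g x + (- 8) * pole_order f x))"
      by (rule fin_orders_compose2[OF fo(1) fo2]) auto
    have "ordsum r (\<lambda>x. (int n - 2) * zorder f x + ((int n - 2) * zorder g x + (- 8) * pole_order f x)) \<le> ordsum r (zorder W)"
      by (intro ordsum_mono fo3 fin_orders_zorder W r zW)
    also have "ordsum r (\<lambda>x. (int n - 2) * zorder f x + ((int n - 2) * zorder g x + (- 8) * pole_order f x)) =
               (real n - 2) * ordsum r (zorder f) + ((real n - 2) * ordsum r (zorder g) + (- 8) * Np)"
      using n unfolding ordsum_add[OF fo(1) fo2] ordsum_add[OF fo(2,3)]
      by (subst (1 2 3) ordsum_cmul) (auto simp: Np_def)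
    finally have AW: "(real n - 2) * (A f - jensen_const f) + (real n - 2) * (A g - jensen_const g) - 8 * Np + jensen_const W \<le> A W"
      by (simp add: jf)
    have J0: "0 \<le> cmean r J"
      using elim(6) \<beta> r by (meson mult_nonneg_nonneg less_imp_le order.trans zero_le_power)
    have jb: "(real n - 2) * y \<le> real n * \<bar>y\<bar>" for y
    proof -
      have "(real n - 2) * y \<le> (real n - 2) * \<bar>y\<bar>" using n by (intro mult_left_mono) auto
      also have "\<dots> \<le> real n * \<bar>y\<bar>" by (intro mult_right_mono) auto
      finally show ?thesis .
    qed
    have 2: "2 * A f \<le> 2 / real n * cmean r J"
      using AJ(1) n by (simp add: A0 field_simps)
    have 3: "2 * A g \<le> 2 / real n * (cmean r J + \<bar>ln (cmod a)\<bar>)"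
    proof -
      have "real n * A g \<le> cmean r J + \<bar>ln (cmod a)\<bar>" using AJ(2) unfolding A1 by linarith
      thus ?thesis using n by (simp add: field_simps)
    qed
    \<comment> \<open>The use of n >= 5: the means of ln|f| and ln|g| give back at most 4/5 of J.
      \<open>J0\<close> allows the multiplication by the mean of J, which could a priori be
      negative.\<close>
    have n5: "2 / real n \<le> 2 / 5" using n by (intro divide_left_mono) auto
    have "2 / real n * cmean r J \<le> 2 / 5 * cmean r J" using n5 J0 by (rule mult_right_mono)
    moreover have "2 / real n * (cmean r J + \<bar>ln (cmod a)\<bar>) \<le> 2 / 5 * (cmean r J + \<bar>ln (cmod a)\<bar>)"
      using n5 J0 by (intro mult_right_mono) auto
    ultimately have "2 * A f + 2 * A g \<le> 4 / 5 * cmean r J + 2 / 5 * \<bar>ln (cmod a)\<bar>"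
      using 2 3 unfolding ring_distribs by linarith
    moreover have "(A F0 + A F1) - A W \<le> 2 * A f + 2 * A g + 8 * Np + ln (cmod a) +
       ((real n - 2) * jensen_const f + (real n - 2) * jensen_const g) - jensen_const W"
      using AW unfolding A0 A1 by (simp add: algebra_simps)
    moreover have "- jensen_const W \<le> \<bar>jensen_const W\<bar>" "ln (cmod a) \<le> \<bar>ln (cmod a)\<bar>" by simp_all
    ultimately have "cmean r J \<le> 40 * Np + 5 * (prox r p1 + prox r p2 + mE r + c0)"
      using main A23 jb[of "jensen_const f"] jb[of "jensen_const g"] unfolding c0_def by argo
    thus ?case by (simp add: Np_def)
  qed
  \<comment> \<open>log+|F0| is the larger of 0 and ln|F0|. The second lies below J, and so does 0
    up to the added terms, because J >= ln|F2| and ln|F2| is no smaller than minus their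
    sum.\<close>
  have proxle: "\<forall>\<^sub>F r in ae_at_top. 5 * prox r f \<le> cmean r J + cmean r (\<lambda>z. \<bar>ln (cmod (p1 z))\<bar>) + cmod b1 * r ^ k"
  proof -
    have "nzmero p1" using p by (auto simp: small_entire_def)
    from good Jcont nzmero_ae_at_top[OF this] eventually_ae_at_top_ge[of 1] show ?thesis
    proof eventually_elim
      case (elim r)
      have r: "r \<ge> 0" using elim by simp
      have c: "continuous_on (sphere 0 r) (\<lambda>z. \<bar>ln (cmod (p1 z))\<bar>)"
        using elim by (intro continuous_on_rabs continuous_on_ln_reg) auto
      have cf: "continuous_on (sphere 0 r) f" using elim by (intro continuous_on_reg) auto
      have "5 * prox r f \<le> real n * prox r f"
        using n prox_nonneg[OF cf r] by (intro mult_right_mono) auto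
      also have "\<dots> = cmean r (\<lambda>z. log_plus (cmod (F0 z)))"
        unfolding prox_def F0_def by (simp add: norm_power log_plus_power cmean_cmul)
      also have "\<dots> \<le> cmean r (\<lambda>z. J z + \<bar>ln (cmod (p1 z))\<bar> + cmod b1 * r ^ k)"
      proof (intro cmean_mono continuous_on_add continuous_on_const elim(2) c r)
        show "continuous_on (sphere 0 r) (\<lambda>z. log_plus (cmod (F0 z)))"
          using elim by (intro continuous_on_log_plus continuous_on_norm continuous_on_reg) auto
        fix z assume z: "cmod z = r"
        have ne: "F0 z \<noteq> 0" "p1 z \<noteq> 0" using elim z by (auto simp: reg_def)
        have "ln (cmod (F2 z)) = ln (cmod (p1 z)) + Re (b1 * z ^ k)"
          using ne by (simp add: F2_def expoly_def norm_mult ln_mult)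
        moreover have "\<bar>Re (b1 * z ^ k)\<bar> \<le> cmod b1 * r ^ k"
          using abs_Re_le_cmod[of "b1 * z ^ k"] by (simp only: norm_mult norm_power z)
        moreover have "ln (cmod (F2 z)) \<le> J z" "ln (cmod (F0 z)) \<le> J z" by (simp_all add: J_def)
        moreover have "log_plus (cmod (F0 z)) = max 0 (ln (cmod (F0 z)))"
          using ne by (auto simp: log_plus_def max_def)
        ultimately show "log_plus (cmod (F0 z)) \<le> J z + \<bar>ln (cmod (p1 z))\<bar> + cmod b1 * r ^ k"
          by linarith
      qed
      also have "\<dots> = cmean r J + cmean r (\<lambda>z. \<bar>ln (cmod (p1 z))\<bar>) + cmod b1 * r ^ k"
        using r by (simp add: cmean_add c elim(2) continuous_on_add)
      finally show ?case .
    qed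
  qed
  \<comment> \<open>With \<rho> = r^k the bounds for J and for the proximity function give 5 T <= 45
    N + (|b1| + \<beta>/2) \<rho>. If N <= T/18, half of the left side is absorbed and T <= 2 B
    \<rho> remains. The other entry of the minimum defining \<epsilon> then yields 40 N <= \<beta>
    \<rho> / 4, so J <= \<beta> \<rho> / 2, against J >= \<beta> \<rho>.\<close>
  define B where "B = (cmod b1 + \<beta>) / 5"
  define \<epsilon> where "\<epsilon> = min (1/18) (\<beta> / (320 * B))"
  have B: "B > 0" using \<beta> by (simp add: B_def add_nonneg_pos)
  have \<epsilon>: "\<epsilon> > 0" "\<epsilon> \<le> 1/18" using \<beta> B by (simp_all add: \<epsilon>_def)
  have "\<epsilon> \<le> \<beta> / (320 * B)" by (simp add: \<epsilon>_def)
  hence \<epsilon>B: "80 * (\<epsilon> * B) \<le> \<beta> / 4" using B by (simp add: field_simps)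
  have "negligible k (\<lambda>r. 5 * (prox r p1 + prox r p2 + mE r + c0))"
    by (intro negligible_cmul negligible_add small_entire_negligible p mE_negligible negligible_const k) auto
  from neglD[OF this, of "\<beta> / 4"] \<beta>
  have e1: "\<forall>\<^sub>F r in ae_at_top. 5 * (prox r p1 + prox r p2 + mE r + c0) \<le> \<beta> / 4 * r ^ k" by simp
  from neglD[OF small_entire_abs_ln_negligible[OF p(1) k], of "\<beta> / 4"] \<beta>
  have e2: "\<forall>\<^sub>F r in ae_at_top. cmean r (\<lambda>z. \<bar>ln (cmod (p1 z))\<bar>) \<le> \<beta> / 4 * r ^ k" by simp
  have "\<forall>\<^sub>F r in ae_at_top. \<not> \<bar>pole_counting r f\<bar> \<le> \<epsilon> * \<bar>nevanlinna_char r f\<bar>"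
    using lower upper proxle e1 e2 good eventually_ae_at_top_ge[of 1]
  proof eventually_elim
    case (elim r)
    have reg: "\<And>z. cmod z = r \<Longrightarrow> reg f z" using elim by auto
    have "r > 0" using elim by simp
    have pc: "pole_counting r f = ordsum r (pole_order f)" "nevanlinna_char r f = nchar r f"
      using pole_counting_eq_ordsum[OF f \<open>r > 0\<close> reg] nevanlinna_char_eq_nchar[OF f \<open>r > 0\<close> reg] by simp_all
    have T0: "nchar r f \<ge> 0" by (rule nchar_nonneg[OF _ reg]) (use elim in auto)
    define Np where "Np = ordsum r (pole_order f)"
    define \<rho> where "\<rho> = r ^ k"
    have \<rho>: "\<rho> > 0" using \<open>r > 0\<close> by (simp add: \<rho>_def)
    have T: "nchar r f = prox r f + Np" by (simp add: nchar_def Np_def)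
    show ?case
    proof
      assume "\<bar>pole_counting r f\<bar> \<le> \<epsilon> * \<bar>nevanlinna_char r f\<bar>"
      hence small: "Np \<le> \<epsilon> * nchar r f" using T0 by (simp add: pc Np_def)
      also have "\<dots> \<le> 1/18 * nchar r f" using \<epsilon> T0 by (intro mult_right_mono)
      finally have small': "18 * Np \<le> nchar r f" by simp
      have "B * \<rho> = cmod b1 * \<rho> / 5 + \<beta> * \<rho> / 5" by (simp add: B_def add_divide_distrib ring_distribs)
      moreover have "\<beta> * \<rho> > 0" using \<beta> \<rho> by simp
      ultimately have "nchar r f \<le> 2 * (B * \<rho>)"
        using elim(2,3,4,5) small' T unfolding Np_def [symmetric] \<rho>_def [symmetric] by linarith
      hence "\<epsilon> * nchar r f \<le> \<epsilon> * (2 * (B * \<rho>))" using \<epsilon> by (intro mult_left_mono) auto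
      from order.trans[OF small this] have "Np \<le> 2 * (\<epsilon> * B * \<rho>)" by (simp add: mult_ac)
      hence "40 * Np \<le> 80 * (\<epsilon> * B) * \<rho>" by (simp add: mult_ac)
      also have "\<dots> \<le> \<beta> / 4 * \<rho>" using \<epsilon>B \<rho> by (intro mult_right_mono) auto
      finally have "40 * Np \<le> \<beta> * \<rho> / 4" by simp
      thus False
        using elim(1,2,4) \<open>\<beta> * \<rho> > 0\<close> unfolding Np_def [symmetric] \<rho>_def [symmetric] by linarith
    qed
  qed
  from is_S_meets_ae_at_top[OF N this \<epsilon>(1)] show False by auto
qed

section \<open>The degenerate case\<close>

text \<open>By Cauchy's estimates the second term is at most exp (Re (b1 z^k)) up to factors of lower
  order, which is incompatible with its being p2 exp (b2 z^k).\<close>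
theorem no_power_pair:
  assumes k: "k \<ge> 1" and n: "n \<ge> 1" and p: "small_entire k p1" "small_entire k p2" and b: "b1 \<noteq> b2"
    and a: "a \<noteq> 0" and f: "f meromorphic_on UNIV"
    and eq1: "\<forall>\<^sub>F z in cosparse UNIV. s * f z ^ n = expoly k p1 b1 z" and s: "s \<noteq> 0"
    and eq2: "\<forall>\<^sub>F z in cosparse UNIV. a * (deriv ^^ l) f (z + c) ^ n = expoly k p2 b2 z"
  shows False
proof -
  \<comment> \<open>A constant multiple of f^n agrees with an entire function off a sparse set, so f
    has no poles and removing singularities makes it entire.\<close>
  define h where "h = remove_sings f"
  have p': "p1 holomorphic_on UNIV" "nzmero p1" "p2 holomorphic_on UNIV" "nzmero p2"
    using p by (auto simp: small_entire_def)
  have an: "h analytic_on {z}" for z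
  proof -
    have iso: "isolated_singularity_at f z" "not_essential f z"
      using f by (meson meromorphic_on_subset meromorphic_on_isolated_singularity meromorphic_on_not_essential subset_UNIV)+
    have "\<not> is_pole f z"
    proof
      assume "is_pole f z"
      hence "is_pole (\<lambda>w. f w ^ n) z"
        unfolding is_pole_def by (rule Limits.filterlim_power_at_infinity) (use n in auto)
      hence "is_pole (\<lambda>w. s * f w ^ n) z" using s by simp
      moreover have "\<forall>\<^sub>F w in at z. s * f w ^ n = expoly k p1 b1 w"
        by (rule eventually_cosparse_imp_eventually_at[OF eq1]) auto
      ultimately have "is_pole (expoly k p1 b1) z" using is_pole_cong[of "\<lambda>w. s * f w ^ n" "expoly k p1 b1" z z] by blast
      moreover have "expoly k p1 b1 analytic_on {z}"
        using expoly_holomorphic[OF p(1), of b1 UNIV] by (auto simp: analytic_at)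
      ultimately show False using analytic_at_imp_no_pole by blast
    qed
    thus ?thesis using iso unfolding h_def by (auto simp: not_essential_def intro: remove_sings_analytic_at)
  qed
  have hol: "h holomorphic_on A" for A
  proof -
    have "h analytic_on A" using an by (subst analytic_on_analytic_at) auto
    thus ?thesis by (rule analytic_imp_holomorphic)
  qed
  have fan: "\<forall>\<^sub>F z in cosparse UNIV. f analytic_on {z}"
    using f by (rule meromorphic_on_imp_analytic_cosparse)
  have holomorphic_eqI: "u = v" if "u holomorphic_on UNIV" "v holomorphic_on UNIV" "\<forall>\<^sub>F z in cosparse UNIV. u z = v z"
    for u v :: "complex \<Rightarrow> complex"
  proof (rule ext)
    fix z
    have "\<forall>\<^sub>F w in at z. u w = v w" by (rule eventually_cosparse_imp_eventually_at[OF that(3)]) auto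
    moreover have "isCont u z" "isCont v z"
      using that(1,2) continuous_on_eq_continuous_at holomorphic_on_imp_continuous_on by blast+
    hence "u \<midarrow>z\<rightarrow> u z" "v \<midarrow>z\<rightarrow> v z" by (simp_all add: isCont_def)
    ultimately show "u z = v z"
      using tendsto_cong[of u v "at z" "u z"] tendsto_unique[OF at_neq_bot, of v "u z" z "v z"] by blast
  qed
  have h1: "(\<lambda>z. s * h z ^ n) = expoly k p1 b1"
  proof (rule holomorphic_eqI)
    show "\<forall>\<^sub>F z in cosparse UNIV. s * h z ^ n = expoly k p1 b1 z"
      using eq1 fan by eventually_elim (simp add: h_def)
  qed (auto intro!: holomorphic_intros hol expoly_holomorphic p)
  have dh: "(deriv ^^ l) h holomorphic_on UNIV" by (intro holomorphic_higher_deriv hol open_UNIV)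
  have h2: "(\<lambda>z. a * (deriv ^^ l) h (z + c) ^ n) = expoly k p2 b2"
  proof (rule holomorphic_eqI)
    have "\<forall>\<^sub>F z in cosparse UNIV. f analytic_on {z + c}"
    proof -
      have "\<forall>\<^sub>F w in at z. f analytic_on {w + c}" for z
      proof -
        have "\<forall>\<^sub>F w in at (z + c). f analytic_on {w}"
          by (rule eventually_cosparse_imp_eventually_at[OF fan]) auto
        thus ?thesis by (subst at_to_0) (subst (asm) at_to_0, simp add: eventually_filtermap add_ac)
      qed
      thus ?thesis by (auto simp: eventually_cosparse_open_eq)
    qed
    with eq2 show "\<forall>\<^sub>F z in cosparse UNIV. a * (deriv ^^ l) h (z + c) ^ n = expoly k p2 b2 z"
    proof eventually_elim
      case (elim z)
      from elim(2) obtain S where S: "open S" "z + c \<in> S" "f holomorphic_on S" by (auto simp: analytic_at)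
      have "\<forall>\<^sub>F w in nhds (z + c). w \<in> S" using S by (intro eventually_nhds_in_open)
      hence "\<forall>\<^sub>F w in nhds (z + c). h w = f w"
        by eventually_elim (use S in \<open>auto simp: h_def analytic_at intro!: remove_sings_at_analytic\<close>)
      hence "(deriv ^^ l) h (z + c) = (deriv ^^ l) f (z + c)" by (rule higher_deriv_cong_ev) simp
      thus ?case using elim by simp
    qed
    have "(\<lambda>z. (deriv ^^ l) h (z + c)) holomorphic_on UNIV"
      using holomorphic_on_compose[of "\<lambda>z. z + c" UNIV "(deriv ^^ l) h"] dh
      by (simp add: o_def holomorphic_on_subset holomorphic_on_add holomorphic_on_ident holomorphic_on_const)
    thus "(\<lambda>z. a * (deriv ^^ l) h (z + c) ^ n) holomorphic_on UNIV" by (intro holomorphic_intros)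
  qed (auto intro: expoly_holomorphic p)
  obtain \<kappa> where \<kappa>: "0 < \<kappa>" "\<kappa> < real k" "\<forall>\<^sub>F r in ae_at_top. prox r p1 \<le> r powr \<kappa>"
    using p(1) by (auto simp: small_entire_def)
  obtain \<kappa>' where \<kappa>': "\<kappa> < \<kappa>'" "\<kappa>' < real k" using dense[OF \<kappa>(2)] by blast
  have mm: "\<forall>\<^sub>F r in at_top. \<forall>z. cmod z \<le> r \<longrightarrow> cmod (p1 z) \<le> exp (r powr \<kappa>')"
    by (rule maximum_modulus_growth[OF p'(1,2) \<kappa>(1) \<kappa>'(1) \<kappa>(3)])
  \<comment> \<open>The unit circle about z + c, on which Cauchy's estimate is applied, lies within
    distance d of z.\<close>
  define d where "d = cmod c + 1"
  have d: "d > 0" by (simp add: d_def add_nonneg_pos)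
  \<comment> \<open>The loss on a disc of radius d about a point of modulus r: the growth of
    \<open>p1\<close>, with exponent \<kappa>' < k, and the variation of b1 z^k, of order r^(k - 1).
    Both are o(r^k).\<close>
  define M where "M r = (r + d) powr \<kappa>' + cmod b1 * (real k * d * (r + d) ^ (k - 1))" for r
  define C where "C = ln (cmod a) + real n * ln (fact l) - ln (cmod s)"
  have pw: "cmod (w ^ k - z ^ k) \<le> real k * d * (r + d) ^ (k - 1)" if "cmod z = r" "cmod (w - z) \<le> d" "r \<ge> 0" for w z r
  proof -
    have cw: "cmod w \<le> r + d" using norm_triangle_ineq[of z "w - z"] that by simp
    have "w ^ k - z ^ k = (w - z) * (\<Sum>i<k. z ^ (k - Suc i) * w ^ i)"
      by (rule power_diff_sumr2)
    hence "cmod (w ^ k - z ^ k) = cmod (w - z) * cmod (\<Sum>i<k. z ^ (k - Suc i) * w ^ i)"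
      by (simp only: norm_mult)
    also have "\<dots> \<le> cmod (w - z) * (\<Sum>i<k. cmod (z ^ (k - Suc i) * w ^ i))"
      by (intro mult_left_mono norm_sum) auto
    also have "\<dots> \<le> d * (\<Sum>i<k. (r + d) ^ (k - 1))"
    proof (intro mult_mono sum_mono)
      fix i assume "i \<in> {..<k}"
      hence i: "k - 1 = (k - Suc i) + i" by auto
      have "cmod (z ^ (k - Suc i) * w ^ i) = cmod z ^ (k - Suc i) * cmod w ^ i" by (simp add: norm_mult norm_power)
      also have "\<dots> \<le> (r + d) ^ (k - Suc i) * (r + d) ^ i"
        using that d cw by (intro mult_mono power_mono) auto
      also have "\<dots> = (r + d) ^ (k - 1)" unfolding i power_add ..
      finally show "cmod (z ^ (k - Suc i) * w ^ i) \<le> (r + d) ^ (k - 1)" .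
    qed (use that d in \<open>auto intro: sum_nonneg\<close>)
    finally show ?thesis by (simp add: mult_ac)
  qed
  have "\<forall>\<^sub>F r in at_top. \<forall>z. cmod z \<le> r + d \<longrightarrow> cmod (p1 z) \<le> exp ((r + d) powr \<kappa>')"
    by (rule eventually_compose_filterlim[OF mm]) real_asymp
  hence bound: "\<forall>\<^sub>F r in at_top. \<forall>z. cmod z = r \<longrightarrow> cmod (expoly k p2 b2 z) \<le> exp (C + M r + Re (b1 * z ^ k))"
    using eventually_ge_at_top[of 0]
  proof eventually_elim
    case (elim r)
    show ?case
    proof (intro allI impI)
      fix z assume z: "cmod z = r"
      \<comment> \<open>The n-th root of the bound for |h|^n on the unit circle about z + c, written
        as an exponential.\<close>
      define B where "B = exp ((M r + Re (b1 * z ^ k) - ln (cmod s)) / real n)"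
      have hb: "cmod (h w) \<le> B" if w: "cmod (w - (z + c)) = 1" for w
      proof -
        have wz: "cmod (w - z) \<le> d"
          using norm_triangle_ineq[of "w - (z + c)" c] w by (simp add: d_def)
        have "cmod w \<le> r + d" using norm_triangle_ineq[of z "w - z"] wz z by simp
        hence P: "cmod (p1 w) \<le> exp ((r + d) powr \<kappa>')" using elim by blast
        have "Re (b1 * w ^ k) = Re (b1 * z ^ k) + Re (b1 * (w ^ k - z ^ k))" by (simp add: algebra_simps)
        also have "Re (b1 * (w ^ k - z ^ k)) \<le> cmod (b1 * (w ^ k - z ^ k))" by (rule complex_Re_le_cmod)
        also have "\<dots> \<le> cmod b1 * (real k * d * (r + d) ^ (k - 1))"
          unfolding norm_mult by (intro mult_left_mono pw z wz elim) auto
        finally have R: "Re (b1 * w ^ k) \<le> Re (b1 * z ^ k) + cmod b1 * (real k * d * (r + d) ^ (k - 1))" by simp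
        have "cmod s * cmod (h w) ^ n = cmod (expoly k p1 b1 w)"
          using fun_cong[OF h1, of w] by (metis norm_mult norm_power)
        also have "\<dots> = cmod (p1 w) * exp (Re (b1 * w ^ k))" by (simp add: expoly_def norm_mult)
        also have "\<dots> \<le> exp ((r + d) powr \<kappa>') * exp (Re (b1 * z ^ k) + cmod b1 * (real k * d * (r + d) ^ (k - 1)))"
          by (intro mult_mono P) (use R in auto)
        also have "\<dots> = exp (M r + Re (b1 * z ^ k))" by (simp add: M_def exp_add [symmetric] add_ac)
        finally have "cmod (h w) ^ n \<le> exp (M r + Re (b1 * z ^ k)) / cmod s"
          using s by (simp add: field_simps)
        also have "\<dots> = exp (M r + Re (b1 * z ^ k) - ln (cmod s))" using s by (simp add: exp_diff)
        also have "\<dots> = B ^ n" using n by (simp add: B_def exp_of_nat_mult [symmetric])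
        finally show ?thesis using n by (subst (asm) power_mono_iff) (auto simp: B_def)
      qed
      have "cmod ((deriv ^^ l) h (z + c)) \<le> fact l * B / 1 ^ l"
        by (rule Cauchy_inequality) (auto intro!: hol holomorphic_on_imp_continuous_on hb simp: norm_minus_commute)
      hence "cmod ((deriv ^^ l) h (z + c)) ^ n \<le> (fact l * B) ^ n" by (intro power_mono) auto
      hence "cmod a * cmod ((deriv ^^ l) h (z + c)) ^ n \<le> cmod a * (fact l * B) ^ n"
        by (intro mult_left_mono) auto
      moreover have "cmod (expoly k p2 b2 z) = cmod a * cmod ((deriv ^^ l) h (z + c)) ^ n"
        using fun_cong[OF h2, of z] by (metis norm_mult norm_power)
      moreover have "cmod a * (fact l * B) ^ n = exp (C + M r + Re (b1 * z ^ k))"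
      proof -
        have "B ^ n = exp (M r + Re (b1 * z ^ k) - ln (cmod s))" using n by (simp add: B_def exp_of_nat_mult [symmetric])
        moreover have "fact l ^ n = exp (real n * ln (fact l :: real))" by (simp add: exp_of_nat_mult)
        moreover have "cmod a = exp (ln (cmod a))" using a by simp
        ultimately have "cmod a * (fact l * B) ^ n = exp (ln (cmod a)) * (exp (real n * ln (fact l)) * exp (M r + Re (b1 * z ^ k) - ln (cmod s)))"
          by (simp add: power_mult_distrib)
        also have "\<dots> = exp (C + M r + Re (b1 * z ^ k))"
          unfolding exp_add [symmetric] C_def by (simp add: algebra_simps)
        finally show ?thesis .
      qed
      ultimately show "cmod (expoly k p2 b2 z) \<le> exp (C + M r + Re (b1 * z ^ k))" by simp
    qed
  qed
  define \<beta> where "\<beta> = cmod (b2 - b1) / 4"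
  have \<beta>: "\<beta> > 0" using b by (simp add: \<beta>_def)
  have "negligible k (\<lambda>r. cmean r (\<lambda>z. \<bar>ln (cmod (p2 z))\<bar>) + (\<bar>C\<bar> + M r))"
  proof (intro negligible_add small_entire_abs_ln_negligible p k negligible_const)
    have "(\<lambda>r. (r + d) powr \<kappa>') \<in> o(\<lambda>r. r powr real k)" using \<kappa>' \<kappa> d by real_asymp
    also have "(\<lambda>r::real. r powr real k) \<in> \<Theta>(\<lambda>r. r ^ k)"
      by (intro bigthetaI_cong eventually_mono[OF eventually_gt_at_top[of 0]]) (auto simp: powr_realpow)
    finally have 1: "negligible k (\<lambda>r. (r + d) powr \<kappa>')" by (rule negligible_smallo)
    have "(\<lambda>r. (r + d) ^ (k - 1)) \<in> o(\<lambda>r. r ^ k)"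
    proof -
      obtain j where "k = Suc j" using k by (cases k) auto
      thus ?thesis using d by simp real_asymp
    qed
    hence "negligible k (\<lambda>r. (cmod b1 * (real k * d)) * (r + d) ^ (k - 1))"
      using d by (intro negligible_cmul negligible_smallo) auto
    from negligible_add[OF 1 this] show "negligible k M" by (simp add: M_def [abs_def] mult_ac)
  qed
  from neglD[OF this, of "\<beta> / 2"] \<beta>
  have small: "\<forall>\<^sub>F r in ae_at_top. cmean r (\<lambda>z. \<bar>ln (cmod (p2 z))\<bar>) + (\<bar>C\<bar> + M r) \<le> \<beta> / 2 * r ^ k" by simp
  from eventually_at_top_imp_ae_at_top[OF bound] small nzmero_ae_at_top[OF p'(4)] eventually_ae_at_top_gt[of 0]
  have "\<forall>\<^sub>F r in ae_at_top. False"
  proof eventually_elim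
    case (elim r)
    have c: "continuous_on (sphere 0 r) (\<lambda>z. \<bar>ln (cmod (p2 z))\<bar>)"
      using elim by (intro continuous_on_rabs continuous_on_ln_reg) auto
    have M0: "M r \<ge> 0" unfolding M_def using elim d by (intro add_nonneg_nonneg mult_nonneg_nonneg) auto
    have "\<beta> * r ^ k \<le> cmean r (\<lambda>z. max 0 (Re ((b2 - b1) * z ^ k)))"
      using cmean_pos_part_monomial_ge[OF k elim(4), of "b2 - b1"] by (simp only: \<beta>_def)
    also have "\<dots> \<le> cmean r (\<lambda>z. \<bar>ln (cmod (p2 z))\<bar> + (\<bar>C\<bar> + M r))"
    proof (intro cmean_mono continuous_on_add c continuous_on_const less_imp_le[OF elim(4)])
      show "continuous_on (sphere 0 r) (\<lambda>z. max 0 (Re ((b2 - b1) * z ^ k)))" by (intro continuous_intros)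
      fix z assume z: "cmod z = r"
      have ne: "p2 z \<noteq> 0" using elim z by (auto simp: reg_def)
      have "ln (cmod (p2 z)) + Re (b2 * z ^ k) = ln (cmod (expoly k p2 b2 z))"
        using ne by (simp add: expoly_def norm_mult ln_mult)
      also have "\<dots> \<le> ln (exp (C + M r + Re (b1 * z ^ k)))"
        using elim(1) z ne by (intro ln_mono) (auto simp: expoly_def)
      finally have "ln (cmod (p2 z)) + Re (b2 * z ^ k) \<le> C + M r + Re (b1 * z ^ k)" by simp
      moreover have "Re ((b2 - b1) * z ^ k) = Re (b2 * z ^ k) - Re (b1 * z ^ k)" by (simp add: left_diff_distrib)
      ultimately show "max 0 (Re ((b2 - b1) * z ^ k)) \<le> \<bar>ln (cmod (p2 z))\<bar> + (\<bar>C\<bar> + M r)"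
        using M0 by linarith
    qed
    also have "\<dots> = cmean r (\<lambda>z. \<bar>ln (cmod (p2 z))\<bar>) + (\<bar>C\<bar> + M r)"
      using elim by (simp add: cmean_add c)
    also have "\<dots> \<le> \<beta> / 2 * r ^ k" by (rule elim(2))
    finally have "\<beta> * r ^ k \<le> 0" by simp
    moreover have "\<beta> * r ^ k > 0" using \<beta> elim by simp
    ultimately show ?case by linarith
  qed
  thus False using ae_at_top_neq_bot by blast
qed

text \<open>The factor adds log+|s| to the mean, which a slightly larger exponent \<kappa>' below k
  absorbs. This lets coefficients of the exponentials be moved into p1 and p2.\<close>

lemma small_entire_cmul:
  assumes p: "small_entire k p" and s: "s \<noteq> 0"
  shows   "small_entire k (\<lambda>z. s * p z)"
proof -
  obtain \<kappa> where \<kappa>: "0 < \<kappa>" "\<kappa> < real k" "\<forall>\<^sub>F r in ae_at_top. prox r p \<le> r powr \<kappa>"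
    and hol: "p holomorphic_on UNIV" and nz: "nzmero p"
    using p by (auto simp: small_entire_def)
  obtain \<kappa>' where \<kappa>': "\<kappa> < \<kappa>'" "\<kappa>' < real k" using dense[OF \<kappa>(2)] by blast
  have "\<forall>\<^sub>F r in at_top. r powr \<kappa> + log_plus (cmod s) \<le> r powr \<kappa>'"
    using \<kappa>(1) \<kappa>'(1) by real_asymp
  from \<kappa>(3) eventually_at_top_imp_ae_at_top[OF this] eventually_ae_at_top_ge[of 0]
  have "\<forall>\<^sub>F r in ae_at_top. prox r (\<lambda>z. s * p z) \<le> r powr \<kappa>'"
  proof eventually_elim
    case (elim r)
    have "prox r (\<lambda>z. s * p z) \<le> prox r (\<lambda>_. s) + prox r p"
      using elim hol by (intro prox_mult_le) (auto intro: continuous_intros)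
    also have "prox r (\<lambda>_. s) = log_plus (cmod s)" by (simp add: prox_def)
    finally show ?case using elim by simp
  qed
  moreover have "(\<lambda>z. s * p z) holomorphic_on UNIV" by (intro holomorphic_intros hol)
  moreover have "nzmero (\<lambda>z. s * p z)" by (intro nzmero_mult nzmero_const s nz)
  ultimately show ?thesis using \<kappa>(1) \<kappa>' unfolding small_entire_def by (meson order.strict_trans)
qed

text \<open>Cramer's rule for the system f = \<alpha> F + \<beta> G, f' = \<alpha> F' + \<beta> G'
  defines \<alpha> and \<beta> on a disc where the Wronskian of F and G has no zero. They turn out
  constant there, and the identity theorem extends the relation to the plane.\<close>

lemma wron3_eq_0_imp_linear_combination:
  assumes f: "f meromorphic_on UNIV" and F: "F holomorphic_on UNIV" and G: "G holomorphic_on UNIV"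
    and W2: "nzmero (\<lambda>z. F z * deriv G z - deriv F z * G z)"
    and W3: "\<forall>\<^sub>F z in cosparse UNIV. wron3 f F G z = 0"
  shows "\<exists>\<alpha> \<beta>. \<forall>\<^sub>F z in cosparse UNIV. f z = \<alpha> * F z + \<beta> * G z"
proof -
  define W where "W = (\<lambda>z. F z * deriv G z - deriv F z * G z)"
  have "\<forall>\<^sub>F z in cosparse UNIV. reg W z \<and> f analytic_on {z}"
    unfolding W_def
    by (intro eventually_conj nzmero_cosparse_reg W2 meromorphic_on_imp_analytic_cosparse f)
  hence "\<forall>\<^sub>F z in at 0. reg W z \<and> f analytic_on {z}"
    by (rule eventually_cosparse_imp_eventually_at) auto
  then obtain z0 where z0: "reg W z0" "f analytic_on {z0}" using eventually_happens'[OF at_neq_bot] by blast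
  obtain S where S: "open S" "z0 \<in> S" "f holomorphic_on S" using z0(2) by (auto simp: analytic_at)
  obtain T where T: "open T" "z0 \<in> T" "\<And>z. z \<in> T \<Longrightarrow> reg W z"
    using reg_eventually_nhds[OF z0(1)] by (auto simp: eventually_nhds)
  obtain e where e: "e > 0" "ball z0 e \<subseteq> S \<inter> T"
    using open_contains_ball[of "S \<inter> T"] S T by blast
  define D where "D = ball z0 e"
  have D: "open D" "connected D" "z0 \<in> D" "f holomorphic_on D" "\<And>z. z \<in> D \<Longrightarrow> W z \<noteq> 0"
    using e T(3) S(3) by (auto simp: D_def reg_def intro: holomorphic_on_subset)
  have df: "(f has_field_derivative deriv f z) (at z)" "(deriv f has_field_derivative deriv (deriv f) z) (at z)" if "z \<in> D" for z
    using D that by (auto intro!: holomorphic_derivI holomorphic_deriv)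
  have dF: "(F has_field_derivative deriv F z) (at z)" "(deriv F has_field_derivative deriv (deriv F) z) (at z)" for z
    using F by (auto intro!: holomorphic_derivI[where S = UNIV] holomorphic_deriv)
  have dG: "(G has_field_derivative deriv G z) (at z)" "(deriv G has_field_derivative deriv (deriv G) z) (at z)" for z
    using G by (auto intro!: holomorphic_derivI[where S = UNIV] holomorphic_deriv)
  have cont: "continuous_on D (wron3 f F G)"
    unfolding wron3_def [abs_def]
    by (intro continuous_intros holomorphic_on_imp_continuous_on holomorphic_deriv D
        holomorphic_on_subset[OF F] holomorphic_on_subset[OF G]) auto
  \<comment> \<open>The hypothesis allows exceptions on a sparse set; continuity on D removes
    them.\<close>
  have w0: "wron3 f F G z = 0" if z: "z \<in> D" for z
  proof -
    have "isCont (wron3 f F G) z" using cont D(1) z by (simp add: continuous_on_eq_continuous_at)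
    hence "wron3 f F G \<midarrow>z\<rightarrow> wron3 f F G z" by (simp add: isCont_def)
    moreover have "\<forall>\<^sub>F w in at z. wron3 f F G w = 0"
      by (rule eventually_cosparse_imp_eventually_at[OF W3]) auto
    hence "wron3 f F G \<midarrow>z\<rightarrow> 0" by (rule tendsto_eventually)
    ultimately show ?thesis by (rule tendsto_unique[OF at_neq_bot])
  qed
  have dW: "(W has_field_derivative (F z * deriv (deriv G) z - deriv (deriv F) z * G z)) (at z)" for z
    unfolding W_def by (rule derivative_eq_intros dF dG refl)+ (simp add: algebra_simps)
  define \<alpha> where "\<alpha> z = (f z * deriv G z - deriv f z * G z) / W z" for z
  define \<beta> where "\<beta> z = (F z * deriv f z - deriv F z * f z) / W z" for z
  have "\<alpha> constant_on D"
  proof (rule has_field_derivative_0_imp_constant_on[OF _ D(2,1)])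
    fix z assume z: "z \<in> D"
    have "((\<lambda>z. f z * deriv G z - deriv f z * G z) has_field_derivative
            (f z * deriv (deriv G) z - deriv (deriv f) z * G z)) (at z)"
      by (rule derivative_eq_intros df[OF z] dG refl)+ (simp add: algebra_simps)
    from DERIV_divide[OF this dW D(5)[OF z]]
    have "(\<alpha> has_field_derivative
       ((f z * deriv (deriv G) z - deriv (deriv f) z * G z) * W z -
        (f z * deriv G z - deriv f z * G z) * (F z * deriv (deriv G) z - deriv (deriv F) z * G z)) / (W z * W z)) (at z)"
      unfolding \<alpha>_def .
    \<comment> \<open>A determinant identity: the numerator of the derivative is a multiple of the
      Wronskian of the three functions, which vanishes.\<close>
    also have "(f z * deriv (deriv G) z - deriv (deriv f) z * G z) * W z -
        (f z * deriv G z - deriv f z * G z) * (F z * deriv (deriv G) z - deriv (deriv F) z * G z) =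
        - G z * wron3 f F G z"
      by (simp add: W_def wron3_def algebra_simps)
    finally show "(\<alpha> has_field_derivative 0) (at z)" using w0[OF z] by simp
  qed
  moreover have "\<beta> constant_on D"
  proof (rule has_field_derivative_0_imp_constant_on[OF _ D(2,1)])
    fix z assume z: "z \<in> D"
    have "((\<lambda>z. F z * deriv f z - deriv F z * f z) has_field_derivative
            (F z * deriv (deriv f) z - deriv (deriv F) z * f z)) (at z)"
      by (rule derivative_eq_intros df[OF z] dF refl)+ (simp add: algebra_simps)
    from DERIV_divide[OF this dW D(5)[OF z]]
    have "(\<beta> has_field_derivative
       ((F z * deriv (deriv f) z - deriv (deriv F) z * f z) * W z -
        (F z * deriv f z - deriv F z * f z) * (F z * deriv (deriv G) z - deriv (deriv F) z * G z)) / (W z * W z)) (at z)"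
      unfolding \<beta>_def .
    also have "(F z * deriv (deriv f) z - deriv (deriv F) z * f z) * W z -
        (F z * deriv f z - deriv F z * f z) * (F z * deriv (deriv G) z - deriv (deriv F) z * G z) =
        F z * wron3 f F G z"
      by (simp add: W_def wron3_def algebra_simps)
    finally show "(\<beta> has_field_derivative 0) (at z)" using w0[OF z] by simp
  qed
  ultimately obtain A B where AB: "\<And>z. z \<in> D \<Longrightarrow> \<alpha> z = A" "\<And>z. z \<in> D \<Longrightarrow> \<beta> z = B"
    by (auto simp: constant_on_def)
  have "f z - (A * F z + B * G z) = 0" if z: "z \<in> D" for z
  proof -
    have "(A * F z + B * G z) * W z = f z * W z"
      using D(5)[OF z] by (simp add: AB(1)[OF z, symmetric] AB(2)[OF z, symmetric] \<alpha>_def \<beta>_def field_simps)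
         (simp add: W_def algebra_simps)
    thus ?thesis using D(5)[OF z] by simp
  qed
  moreover have "\<forall>\<^sub>F z in at z0. z \<in> D" using D by (intro eventually_at_in_open')
  ultimately have "\<forall>\<^sub>F z in at z0. f z - (A * F z + B * G z) = 0" by (auto elim: eventually_mono)
  hence "\<not> (\<forall>\<^sub>F z in at z0. f z - (A * F z + B * G z) \<noteq> 0)"
    using eventually_frequently[OF at_neq_bot] by (force simp: frequently_def)
  hence "\<not> (\<forall>\<^sub>F z in cosparse UNIV. f z - (A * F z + B * G z) \<noteq> 0)"
    using eventually_cosparse_imp_eventually_at[of _ UNIV z0 UNIV] by blast
  moreover have "(\<lambda>z. f z - (A * F z + B * G z)) meromorphic_on UNIV"
    using F G by (intro meromorphic_intros f analytic_on_imp_meromorphic_on) (auto simp: analytic_on_open)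
  ultimately have "\<forall>\<^sub>F z in cosparse UNIV. f z - (A * F z + B * G z) = 0"
    using meromorphic_imp_constant_or_avoid[of "\<lambda>z. f z - (A * F z + B * G z)" UNIV 0] by auto
  hence "\<forall>\<^sub>F z in cosparse UNIV. f z = A * F z + B * G z" by eventually_elim simp
  thus ?thesis by blast
qed

text \<open>The equation is imposed off a sparse set because the values of f at its poles carry no
  meaning. In the degenerate case f^n = \<alpha> F + \<beta> G and a g^n = (1 - \<alpha>) F + (1 -
  \<beta>) G; as neither may involve both exponentials, the pair (\<alpha>, \<beta>) is (1, 0) or
  (0, 1).\<close>

theorem corollary1p3:
  fixes l k n :: nat
    and p1 p2 :: "complex \<Rightarrow> complex"
    and a a1 a2 c :: complex
  assumes "l \<ge> 1" and "k \<ge> 1" and "n > 4"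
    and "p1 holomorphic_on UNIV" and "\<exists>z. p1 z \<noteq> 0" and "growth_order p1 < ereal (real k)"
    and "p2 holomorphic_on UNIV" and "\<exists>z. p2 z \<noteq> 0" and "growth_order p2 < ereal (real k)"
    and "a \<noteq> 0" and "a1 \<noteq> 0" and "a2 \<noteq> 0" and "a1 \<noteq> a2"
  shows "\<not> (\<exists>f :: complex \<Rightarrow> complex.
            f meromorphic_on UNIV \<and>
            eventually (\<lambda>z. f z ^ n + a * ((deriv ^^ l) f (z + c)) ^ n
                            = p1 z * exp (a1 * z ^ k) + p2 z * exp (a2 * z ^ k))
              (cosparse UNIV) \<and>
            hyper_order f < 1 \<and>
            is_S (\<lambda>r. pole_counting r f) f)"
proof
  assume "\<exists>f :: complex \<Rightarrow> complex.
            f meromorphic_on UNIV \<and>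
            eventually (\<lambda>z. f z ^ n + a * ((deriv ^^ l) f (z + c)) ^ n
                            = p1 z * exp (a1 * z ^ k) + p2 z * exp (a2 * z ^ k))
              (cosparse UNIV) \<and>
            hyper_order f < 1 \<and>
            is_S (\<lambda>r. pole_counting r f) f"
  then obtain f where f: "f meromorphic_on UNIV"
    and eq0: "\<forall>\<^sub>F z in cosparse UNIV. f z ^ n + a * ((deriv ^^ l) f (z + c)) ^ n
                            = p1 z * exp (a1 * z ^ k) + p2 z * exp (a2 * z ^ k)"
    and ho: "hyper_order f < 1" and N: "is_S (\<lambda>r. pole_counting r f) f" by blast
  define g where "g z = (deriv ^^ l) f (z + c)" for z
  define F where "F = expoly k p1 a1"
  define G where "G = expoly k p2 a2"
  have p: "small_entire k p1" "small_entire k p2"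
    unfolding small_entire_def
    using assms by (auto intro: nzmero_holomorphic growth_order_imp_prox)
  have eq: "\<forall>\<^sub>F z in cosparse UNIV. f z ^ n + a * g z ^ n = F z + G z"
    using eq0 by (simp add: g_def F_def G_def expoly_def)
  have n: "n \<ge> 2" "n \<ge> 1" "n \<noteq> 0" using \<open>n > 4\<close> by auto
  have "(deriv ^^ l) f meromorphic_on UNIV" by (intro meromorphic_intros f)
  hence g: "g meromorphic_on UNIV"
    unfolding g_def by (rule meromorphic_on_compose) (auto intro!: analytic_intros)
  have no_sum: False
    if "h meromorphic_on UNIV" "s \<noteq> 0" "t \<noteq> 0" "\<forall>\<^sub>F z in cosparse UNIV. h z ^ n = s * F z + t * G z" for h s t
    by (rule power_not_sum_of_two_exponentials[OF \<open>k \<ge> 1\<close> n(1)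
          small_entire_cmul[OF p(1) that(2)] small_entire_cmul[OF p(2) that(3)] \<open>a1 \<noteq> a2\<close> that(1)])
       (use that(4) in \<open>simp add: F_def G_def expoly_def mult_ac\<close>)
  have FG: "F holomorphic_on UNIV" "G holomorphic_on UNIV" "nzmero F" "nzmero G"
    unfolding F_def G_def using p by (auto intro: expoly_holomorphic expoly_nzmero)
  have zero: "\<forall>\<^sub>F z in cosparse UNIV. h z = 0" if "h meromorphic_on UNIV" "\<not> nzmero h" for h
    using that meromorphic_imp_constant_or_avoid[OF that(1), of 0] by (auto simp: nzmero_def)
  have "\<exists>\<alpha> \<beta>. \<forall>\<^sub>F z in cosparse UNIV. f z ^ n = \<alpha> * F z + \<beta> * G z"
  proof (cases "nzmero f \<and> nzmero g")
    case True
    let ?F0 = "\<lambda>z. f z ^ n" and ?F1 = "\<lambda>z. a * g z ^ n"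
    have nz: "nzmero ?F0" "nzmero ?F1" using True \<open>a \<noteq> 0\<close> by (auto intro: nzmero_power nzmero_mult nzmero_const)
    have "\<not> nzmero (wron3 ?F0 ?F1 F)"
      unfolding F_def
      by (rule wron3_not_nzmero[OF \<open>k \<ge> 1\<close> \<open>n > 4\<close> p \<open>a1 \<noteq> a2\<close> \<open>a \<noteq> 0\<close> _ _ _ ho N])
         (use True eq in \<open>auto simp: F_def G_def\<close>)
    moreover have "wron3 ?F0 ?F1 F meromorphic_on UNIV"
      unfolding wron3_def [abs_def] using FG by (intro meromorphic_intros f g nzmero_mero)
    ultimately have W0: "\<forall>\<^sub>F z in cosparse UNIV. wron3 ?F0 ?F1 F z = 0" by (intro zero)
    \<comment> \<open>Valid near z, hence open to differentiation. It exchanges a g^n for G in the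
      Wronskian, so that f^n is compared with two entire functions whose own Wronskian is known not
      to vanish identically.\<close>
    have ev: "\<forall>\<^sub>F z in cosparse UNIV. \<forall>\<^sub>F w in nhds z. G w = ?F0 w + ?F1 w - F w"
      using eq
    proof eventually_elim
      case (elim z)
      have "\<forall>\<^sub>F w in at z. f w ^ n + a * g w ^ n = F w + G w"
        by (rule eventually_cosparse_imp_eventually_at[OF eq]) auto
      hence "\<forall>\<^sub>F w in nhds z. f w ^ n + a * g w ^ n = F w + G w"
        using elim by (simp add: eventually_nhds_conv_at)
      thus ?case by eventually_elim (simp add: algebra_simps)
    qed
    have "\<forall>\<^sub>F z in cosparse UNIV. wron3 ?F0 F G z = 0"
      using W0 ev nzmero_cosparse_reg[OF nz(1)] nzmero_cosparse_reg[OF nz(2)] nzmero_cosparse_reg[OF FG(3)]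
    proof eventually_elim
      case (elim z)
      from wron3_relation(2)[OF elim(3,4,5,2)] elim(1) show ?case by simp
    qed
    moreover have "nzmero (\<lambda>z. F z * deriv G z - deriv F z * G z)"
      unfolding F_def G_def by (rule expoly_wronskian_nzmero[OF \<open>k \<ge> 1\<close> p \<open>a1 \<noteq> a2\<close>])
    ultimately show ?thesis
      using nz(1) by (intro wron3_eq_0_imp_linear_combination FG nzmero_mero)
  next
    case False
    show ?thesis
    proof (cases "nzmero f")
      case True
      hence "\<forall>\<^sub>F z in cosparse UNIV. g z = 0" using False g by (intro zero) auto
      with eq have "\<forall>\<^sub>F z in cosparse UNIV. f z ^ n = 1 * F z + 1 * G z"
        by eventually_elim (use n in \<open>simp add: power_0_left\<close>)
      thus ?thesis by blast
    next
      case False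
      hence "\<forall>\<^sub>F z in cosparse UNIV. f z = 0" using f by (intro zero)
      hence "\<forall>\<^sub>F z in cosparse UNIV. f z ^ n = 0 * F z + 0 * G z"
        by eventually_elim (use n in \<open>simp add: power_0_left\<close>)
      thus ?thesis by blast
    qed
  qed
  then obtain \<alpha> \<beta> where fn: "\<forall>\<^sub>F z in cosparse UNIV. f z ^ n = \<alpha> * F z + \<beta> * G z" by blast
  have gn: "\<forall>\<^sub>F z in cosparse UNIV. a * g z ^ n = (1 - \<alpha>) * F z + (1 - \<beta>) * G z"
    using eq fn by eventually_elim (simp add: algebra_simps)
  have "\<alpha> = 0 \<or> \<beta> = 0" using no_sum[OF f _ _ fn] by blast
  moreover have "\<alpha> = 1 \<or> \<beta> = 1"
  proof (rule ccontr)
    assume "\<not> (\<alpha> = 1 \<or> \<beta> = 1)"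
    hence "(1 - \<alpha>) / a \<noteq> 0" "(1 - \<beta>) / a \<noteq> 0" using \<open>a \<noteq> 0\<close> by auto
    moreover have "\<forall>\<^sub>F z in cosparse UNIV. g z ^ n = (1 - \<alpha>) / a * F z + (1 - \<beta>) / a * G z"
      using gn
    proof eventually_elim
      case (elim z)
      hence "a * g z ^ n = a * ((1 - \<alpha>) / a * F z + (1 - \<beta>) / a * G z)"
        using \<open>a \<noteq> 0\<close> by (simp add: distrib_left)
      thus ?case using \<open>a \<noteq> 0\<close> by simp
    qed
    ultimately show False using no_sum[OF g] by blast
  qed
  ultimately consider "\<alpha> = 1" "\<beta> = 0" | "\<alpha> = 0" "\<beta> = 1" by auto
  thus False
  proof cases
    case 1
    show False
      by (rule no_power_pair[OF \<open>k \<ge> 1\<close> n(2) p \<open>a1 \<noteq> a2\<close> \<open>a \<noteq> 0\<close> f, of 1 l c])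
         (use fn gn 1 in \<open>simp_all add: F_def G_def g_def\<close>)
  next
    case 2
    show False
      by (rule no_power_pair[OF \<open>k \<ge> 1\<close> n(2) p(2,1) \<open>a1 \<noteq> a2\<close>[symmetric] \<open>a \<noteq> 0\<close> f, of 1 l c])
         (use fn gn 2 in \<open>simp_all add: F_def G_def g_def\<close>)
  qed
qed

end
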